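(* There exists an absolute constant $C>0$ such that the following holds. Let $\mathrm d=(d_1,\ldots,d_n)$ be a degree sequence such that $n_1(\mathrm d)=n_2(\mathrm d)=0$ and such that $\mathcal G_{\mathrm d}$ is nonempty, and let $\mathbf G$ be a uniformly random element of $\mathcal G_{\mathrm d}$. Then $\mathbb P\{\operatorname{diam}^+(\mathbf G)\ge 62\log n\}\le C/n$.
   Context: A degree sequence is a sequence $\mathrm d=(d_1,\dots,d_n)$ of positive integers with even sum. $n_b(\mathrm d)=|\{v\in[n]:d_v=b\}|$, where $[n]=\{1,\dots,n\}$. $\mathcal G_{\mathrm d}$ is the set of all (not necessarily connected) simple graphs $G$ with vertex set $[n]$ such that $\deg_G(v)=d_v$ for all $v\in[n]$. $\operatorname{diam}^+(G)=\max_{u,v\in V(G)}\operatorname{dist}_G(u,v)$, where $\operatorname{dist}_G$ is the graph distance, so $\operatorname{diam}^+(G)=\infty$ if $G$ is not connected. *)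

theory Defs
  imports "HOL-Probability.Probability_Mass_Function" "Graph_Theory.Shortest_Path"
    "Graph_Theory.Pair_Digraph"
begin

text \<open>A sequence \<open>(d\<^sub>1, \<dots>, d\<^sub>n)\<close> is a function \<open>d\<close> of which only the values on \<open>{1..n}\<close>
  matter. Sequences are nonempty, as the diameter is a maximum over pairs of vertices.\<close>

definition degree_sequence :: "nat \<Rightarrow> (nat \<Rightarrow> nat) \<Rightarrow> bool" where
  "degree_sequence n d \<longleftrightarrow> n \<ge> 1 \<and> (\<forall>v\<in>{1..n}. d v > 0) \<and> even (\<Sum>v\<in>{1..n}. d v)"

definition num_degree :: "nat \<Rightarrow> (nat \<Rightarrow> nat) \<Rightarrow> nat \<Rightarrow> nat" where
  "num_degree n d b = card {v \<in> {1..n}. d v = b}"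

text \<open>\<^locale>\<open>pair_graph\<close> represents a finite simple graph by its irreflexive symmetric adjacency
  relation: an edge \<open>uv\<close> is the pair of arcs \<open>(u, v)\<close>, \<open>(v, u)\<close>. So the number of arcs leaving
  \<open>v\<close> is the degree of \<open>v\<close>, and distinct elements of the set below are distinct labelled
  graphs.\<close>

definition graphs_with_degrees :: "nat \<Rightarrow> (nat \<Rightarrow> nat) \<Rightarrow> nat pair_pre_digraph set" where
  "graphs_with_degrees n d =
     {G. pair_graph G \<and> pverts G = {1..n} \<and> (\<forall>v\<in>{1..n}. out_degree (with_proj G) v = d v)}"

text \<open>With unit arc weights \<^const>\<open>wf_digraph.\<mu>\<close> is the least length of a walk from \<open>u\<close> to \<open>v\<close>,
  and \<open>\<infinity>\<close> if there is none.\<close>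

definition graph_dist :: "'a pair_pre_digraph \<Rightarrow> 'a \<Rightarrow> 'a \<Rightarrow> ereal" where
  "graph_dist G u v = wf_digraph.\<mu> (with_proj G) (\<lambda>_. 1) u v"

definition diam_plus :: "'a pair_pre_digraph \<Rightarrow> ereal" where
  "diam_plus G = Max {graph_dist G u v | u v. u \<in> pverts G \<and> v \<in> pverts G}"

text \<open>Needed for \<^const>\<open>pmf_of_set\<close> to be the uniform distribution.\<close>

lemma finite_graphs_with_degrees: "finite (graphs_with_degrees n d)"
proof (rule finite_subset)
  show "graphs_with_degrees n d \<subseteq>
      (\<lambda>A. \<lparr>pverts = {1..n}, parcs = A\<rparr>) ` Pow ({1..n} \<times> {1..n})"
  proof
    fix G assume "G \<in> graphs_with_degrees n d"
    then have G: "pair_wf_digraph G" "pverts G = {1..n}"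
      by (auto simp: graphs_with_degrees_def pair_graph_def pair_digraph_def
          pair_fin_digraph_def)
    then have "parcs G \<subseteq> {1..n} \<times> {1..n}"
      using pair_wf_digraph.in_arcsD1 pair_wf_digraph.in_arcsD2 by fast
    then show "G \<in> (\<lambda>A. \<lparr>pverts = {1..n}, parcs = A\<rparr>) ` Pow ({1..n} \<times> {1..n})"
      using G by (intro image_eqI[of _ _ "parcs G"]) auto
  qed
qed simp

end

theory Submission
  imports Defs "HOL-Real_Asymp.Real_Asymp"
begin

text \<open>
  A graph of minimum degree three can only have large diameter if the ball around some vertex
  grows slowly, or if two large balls fail to meet. Both events are shown to be improbable by
  switchings: edges \<open>xz\<close> and \<open>ab\<close> are replaced by \<open>xa\<close> and \<open>zb\<close>, which keeps all degrees. If every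
  graph of a set \<open>\<Omega>\<close> has many switchings and every graph arises from \<open>\<Omega>\<close> by few of them, then \<open>\<Omega>\<close> is a
  small fraction of all graphs with the given degrees (lemma \<open>switching_bound\<close>). Switching \<open>j\<close> pairs
  of edges at once raises the gain of one switching to the power \<open>j\<close>, so that any gain that is a
  power of the number \<open>m\<close> of edges leads, for a constant \<open>j\<close>, to a probability below any required
  power of \<open>1/m\<close>.

  \<^emph>\<open>Growth.\<close> Fix a breadth-first tree of the ball around \<open>u\<close> and call the other edges inside the ball
  excess edges. As degrees are at least three, the ball grows by a factor \<open>3/2\<close> in every step in which
  it has few excess edges (lemma \<open>ball_growth\<close>). It cannot do so for more than logarithmically many
  steps, so a ball of large radius has many excess edges. Now suppose that the volume of the ball, its
  sum of degrees, is at most \<open>K\<close>. An excess edge can be switched with almost any of the \<open>m\<close> edges of the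
  graph, and the tree survives. To undo the switching one needs two edges touching the old ball,
  for which there are only about \<open>K\<^sup>2\<close> possibilities: this is lemma \<open>card_detachable_le\<close>,
  which has to cope with the ball of the new graph being possibly much larger than the old one. Hence having \<open>L\<close> excess
  edges within volume \<open>K\<close> has probability at most a constant times \<open>(K\<^sup>2 / (m L))\<^sup>j\<close>
  (lemma \<open>excess_switching\<close>). A ball of logarithmic radius has at least three excess edges; so it has
  volume above \<open>m powr (1/6)\<close> except with probability \<open>O(m\<^sup>-\<^sup>2)\<close>. From there the volume is raised to
  \<open>m powr (1/2)\<close>, \<open>m powr (2/3)\<close> and \<open>m powr (4/5)\<close>, where each step needs a logarithmic number of
  levels: a ball that has volume \<open>K\<close> gains \<open>K/16\<close> excess edges within that many levels
  (lemma \<open>excess_ge_of_volume\<close>).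

  \<^emph>\<open>Joining.\<close> Consider vertices \<open>u\<close> and \<open>v\<close> with balls of volume \<open>m powr (4/5)\<close> that are far apart. Some shell
  around each of them has about that many edges. If the shell of \<open>u\<close> contains a large matching, then
  switching matching edges with shell edges of \<open>v\<close> creates edges between the two spheres, which can be
  recognised afterwards since the balls inside the shells do not change
  (lemma \<open>parallel_switching\<close>). If neither shell has a large matching, then there are vertices \<open>w\<close> and
  \<open>w'\<close> of degree above \<open>\<surd>m\<close> near \<open>u\<close> and \<open>v\<close>. Choose for each neighbour of \<open>w\<close> a second edge, and do the
  same for \<open>w'\<close>. Either these edges contain a large matching at one of the two hubs, and parallel
  switchings apply again, or there are \<open>q\<close> with many common neighbours with \<open>w\<close> and \<open>q'\<close> with many common
  neighbours with \<open>w'\<close>. In the last case exchanging the edges from \<open>q\<close> and \<open>q'\<close> to such neighbours joins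
  \<open>w\<close> to \<open>q'\<close> by paths of length two, of which there were none (lemma \<open>cross_switching\<close>).

  The exponents leave room at every step: the exponent of the volume must exceed \<open>3/4\<close> for the joining
  part, and a growth step from \<open>m powr a\<close> to \<open>m powr b\<close> needs \<open>2 b - a < 1\<close>.
\<close>

section \<open>Graphs with given degrees and their balls\<close>

definition simple_edges :: "'a set \<Rightarrow> 'a set set" where
  "simple_edges V = {e. e \<subseteq> V \<and> card e = 2}"

text \<open>Graphs on \<open>V\<close> are sets of two-element sets, so that a switching is a set difference followed by a
union.\<close>

definition realizations :: "'a set \<Rightarrow> ('a \<Rightarrow> nat) \<Rightarrow> 'a set set set" where
  "realizations V d = {E. E \<subseteq> simple_edges V \<and> (\<forall>v\<in>V. card {e \<in> E. v \<in> e} = d v)}"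

primrec gball :: "'a set set \<Rightarrow> 'a \<Rightarrow> nat \<Rightarrow> 'a set" where
  "gball E u 0 = {u}"
| "gball E u (Suc r) = gball E u r \<union> {w. \<exists>v\<in>gball E u r. {v, w} \<in> E}"

lemma simple_edgesE:
  assumes "e \<in> simple_edges V"
  obtains x y where "e = {x, y}" "x \<noteq> y" "x \<in> V" "y \<in> V"
  using assms unfolding simple_edges_def card_2_iff by auto

lemma doubleton_simple_iff: "{x, y} \<in> simple_edges V \<longleftrightarrow> x \<noteq> y \<and> x \<in> V \<and> y \<in> V"
  by (auto simp: simple_edges_def card_2_iff doubleton_eq_iff)

lemma finite_simple_edges: "finite V \<Longrightarrow> finite (simple_edges V)"
  unfolding simple_edges_def by simp

lemma simple_edges_other_end:
  assumes "e \<in> simple_edges V" "v \<in> e"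
  obtains w where "e = {v, w}" "w \<noteq> v"
  using assms by (elim simple_edgesE) (auto simp: insert_commute)

lemma finite_realizations: "finite V \<Longrightarrow> finite (realizations V d)"
  unfolding realizations_def
  by (rule finite_subset[of _ "Pow (simple_edges V)"]) (auto simp: finite_simple_edges)

lemma realizations_simple: "E \<in> realizations V d \<Longrightarrow> E \<subseteq> simple_edges V"
  by (auto simp: realizations_def)

lemma realizations_degree: "E \<in> realizations V d \<Longrightarrow> v \<in> V \<Longrightarrow> card {e \<in> E. v \<in> e} = d v"
  by (auto simp: realizations_def)

lemma edges_at_eq_neighbours:
  assumes "E \<subseteq> simple_edges V"
  shows "card {e \<in> E. v \<in> e} = card {w. {v, w} \<in> E}"
proof -
  have "{e \<in> E. v \<in> e} = (\<lambda>w. {v, w}) ` {w. {v, w} \<in> E}"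
    using assms by (auto elim!: simple_edges_other_end)
  moreover have "inj_on (\<lambda>w. {v, w}) {w. {v, w} \<in> E}"
    by (auto simp: inj_on_def doubleton_eq_iff)
  ultimately show ?thesis by (simp add: card_image)
qed

lemma gball_self: "u \<in> gball E u r"
  by (induction r) auto

lemma gball_step: "v \<in> gball E u r \<Longrightarrow> {v, w} \<in> E \<Longrightarrow> w \<in> gball E u (Suc r)"
  by auto

lemma gball_mono: "r \<le> s \<Longrightarrow> gball E u r \<subseteq> gball E u s"
  by (rule lift_Suc_mono_le) auto

lemma gball_monoD: "w \<in> gball E u r \<Longrightarrow> r \<le> s \<Longrightarrow> w \<in> gball E u s"
  using gball_mono[of r s E u] by auto

lemma gball_mono_edges: "E \<subseteq> E' \<Longrightarrow> gball E u r \<subseteq> gball E' u r"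
  by (induction r) auto

lemma gball_subset:
  assumes "E \<subseteq> simple_edges V" "u \<in> V"
  shows "gball E u r \<subseteq> V"
  using assms by (induction r) (auto simp: simple_edges_def)

lemma gball_trans: "v \<in> gball E u r \<Longrightarrow> w \<in> gball E v s \<Longrightarrow> w \<in> gball E u (r + s)"
  by (induction s arbitrary: w) auto

lemma gball_sym: "v \<in> gball E u r \<Longrightarrow> u \<in> gball E v r"
proof (induction r arbitrary: v)
  case (Suc r)
  then consider "v \<in> gball E u r" | x where "x \<in> gball E u r" "{x, v} \<in> E" by auto
  then show ?case
  proof cases
    case 1
    then show ?thesis using Suc.IH[of v] by simp
  next
    case 2
    have "x \<in> gball E v 1" using 2 by (auto simp: insert_commute)
    from gball_trans[OF this Suc.IH[OF 2(1)]] show ?thesis by simp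
  qed
qed auto

lemma gball_Int_trans:
  assumes "x \<in> gball E u r" "x \<in> gball E v s"
  shows "v \<in> gball E u (r + s)"
  using assms gball_sym gball_trans by metis

text \<open>The ball of radius \<open>r + 1\<close> is determined by the edges that touch the ball of radius \<open>r\<close>; the switchings
below that leave these edges alone therefore preserve the first levels of a breadth-first search.\<close>

lemma gball_local:
  assumes "\<And>e. e \<inter> gball E u r \<noteq> {} \<Longrightarrow> e \<in> E' \<longleftrightarrow> e \<in> E"
    and "s \<le> Suc r"
  shows "gball E' u s = gball E u s"
  using assms(2)
proof (induction s)
  case (Suc s)
  then have IH: "gball E' u s = gball E u s" and "gball E u s \<subseteq> gball E u r"
    by (auto intro: gball_mono[THEN subsetD])
  then have "{v, w} \<in> E' \<longleftrightarrow> {v, w} \<in> E" if "v \<in> gball E u s" for v w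
    using assms(1)[of "{v, w}"] that by auto
  then show ?case using IH by auto
qed auto

declare gball.simps(2) [simp del]

section \<open>Switchings\<close>

text \<open>An entry \<open>(x, z, a, b)\<close> stands for replacing \<open>xz\<close> and \<open>ab\<close> by \<open>xa\<close> and \<open>zb\<close>. A list of entries is switched
simultaneously; keeping the list instead of the resulting graph makes the operation invertible.\<close>

definition removed_edges :: "('a \<times> 'a \<times> 'a \<times> 'a) list \<Rightarrow> 'a set list" where
  "removed_edges c = concat (map (\<lambda>(x, z, a, b). [{x, z}, {a, b}]) c)"

definition added_edges :: "('a \<times> 'a \<times> 'a \<times> 'a) list \<Rightarrow> 'a set list" where
  "added_edges c = concat (map (\<lambda>(x, z, a, b). [{x, a}, {z, b}]) c)"

definition switchable :: "'a set set \<Rightarrow> ('a \<times> 'a \<times> 'a \<times> 'a) list \<Rightarrow> bool" where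
  "switchable E c \<longleftrightarrow> distinct (removed_edges c) \<and> distinct (added_edges c) \<and>
     set (removed_edges c) \<subseteq> E \<and> set (added_edges c) \<inter> E = {} \<and>
     (\<forall>(x, z, a, b)\<in>set c. x \<noteq> a \<and> z \<noteq> b)"

definition switch :: "'a set set \<Rightarrow> ('a \<times> 'a \<times> 'a \<times> 'a) list \<Rightarrow> 'a set set" where
  "switch E c = (E - set (removed_edges c)) \<union> set (added_edges c)"

lemma length_added_edges: "length (added_edges c) = 2 * length c"
  by (induction c) (auto simp: added_edges_def)

lemma removed_edges_simps [simp]:
  "removed_edges [] = []"
  "removed_edges ((x, z, a, b) # c) = {x, z} # {a, b} # removed_edges c"
  by (auto simp: removed_edges_def)

lemma added_edges_simps [simp]:
  "added_edges [] = []"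
  "added_edges ((x, z, a, b) # c) = {x, a} # {z, b} # added_edges c"
  by (auto simp: added_edges_def)

lemma set_removed_edges: "set (removed_edges c) = (\<Union>(x, z, a, b)\<in>set c. {{x, z}, {a, b}})"
  by (simp add: removed_edges_def case_prod_unfold)

lemma set_added_edges: "set (added_edges c) = (\<Union>(x, z, a, b)\<in>set c. {{x, a}, {z, b}})"
  by (simp add: added_edges_def case_prod_unfold)

lemma switchableD:
  assumes "switchable E c"
  shows "distinct (removed_edges c)" "distinct (added_edges c)"
    "set (removed_edges c) \<subseteq> E" "set (added_edges c) \<inter> E = {}"
  using assms unfolding switchable_def by simp_all

lemma switch_inverse:
  "switchable E c \<Longrightarrow> (switch E c - set (added_edges c)) \<union> set (removed_edges c) = E"
  using switchableD(3,4)[of E c] unfolding switch_def by blast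

lemma switch_minus_added:
  "switchable E c \<Longrightarrow> switch E c - set (added_edges c) = E - set (removed_edges c)"
  using switchableD(4)[of E c] unfolding switch_def by blast

lemma card_filter_distinct: "distinct xs \<Longrightarrow> card {x \<in> set xs. P x} = length (filter P xs)"
  by (metis distinct_card distinct_filter set_filter)

text \<open>Every vertex occurs in the removed edges of an entry as often as in its added edges. As the edges in
each of the two lists are distinct, the degrees stay the same.\<close>

lemma switch_realization:
  assumes fin: "finite V" and E: "E \<in> realizations V d" and c: "switchable E c"
  shows "switch E c \<in> realizations V d"
proof -
  let ?R = "removed_edges c" and ?A = "added_edges c"
  have simp: "E \<subseteq> simple_edges V" using E by (rule realizations_simple)
  have finE: "finite E" using finite_subset[OF simp finite_simple_edges[OF fin]] .
  have in_c: "x \<noteq> z \<and> a \<noteq> b \<and> x \<noteq> a \<and> z \<noteq> b \<and> x \<in> V \<and> z \<in> V \<and> a \<in> V \<and> b \<in> V"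
    if "(x, z, a, b) \<in> set c" for x z a b
  proof -
    have "{x, z} \<in> simple_edges V" "{a, b} \<in> simple_edges V"
      using that c simp unfolding switchable_def set_removed_edges by fast+
    then show ?thesis using c that by (auto simp: doubleton_simple_iff switchable_def)
  qed
  have "set ?A \<subseteq> simple_edges V"
    using in_c by (auto simp: set_added_edges doubleton_simple_iff)
  then have sub: "switch E c \<subseteq> simple_edges V" using simp by (auto simp: switch_def)
  have deg: "card {e \<in> switch E c. v \<in> e} = d v" if v: "v \<in> V" for v
  proof -
    have same: "length (filter (\<lambda>e. v \<in> e) ?R) = length (filter (\<lambda>e. v \<in> e) ?A)"
      using in_c
    proof (induction c)
      case (Cons q c)
      obtain x z a b where q: "q = (x, z, a, b)" by (cases q)
      have "length (filter (\<lambda>e. v \<in> e) (removed_edges c)) = length (filter (\<lambda>e. v \<in> e) (added_edges c))"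
        by (rule Cons.IH; rule Cons.prems; simp)
      moreover have "x \<noteq> z" "a \<noteq> b" "x \<noteq> a" "z \<noteq> b" using Cons.prems[of x z a b] q by auto
      ultimately show ?case by (auto simp: q)
    qed simp
    have R: "card {e \<in> set ?R. v \<in> e} = length (filter (\<lambda>e. v \<in> e) ?R)"
      and A: "card {e \<in> set ?A. v \<in> e} = length (filter (\<lambda>e. v \<in> e) ?A)"
      using c by (auto intro!: card_filter_distinct simp: switchable_def)
    have "{e \<in> switch E c. v \<in> e} = ({e \<in> E. v \<in> e} - {e \<in> set ?R. v \<in> e}) \<union> {e \<in> set ?A. v \<in> e}"
      by (auto simp: switch_def)
    also have "card \<dots> = card ({e \<in> E. v \<in> e} - {e \<in> set ?R. v \<in> e}) + card {e \<in> set ?A. v \<in> e}"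
      using c finE by (intro card_Un_disjoint) (auto simp: switchable_def)
    also have "card ({e \<in> E. v \<in> e} - {e \<in> set ?R. v \<in> e}) = card {e \<in> E. v \<in> e} - card {e \<in> set ?R. v \<in> e}"
      using c by (intro card_Diff_subset) (auto simp: switchable_def)
    also have "\<dots> + card {e \<in> set ?A. v \<in> e} = card {e \<in> E. v \<in> e}"
    proof -
      have "card {e \<in> set ?R. v \<in> e} \<le> card {e \<in> E. v \<in> e}"
        using c finE by (intro card_mono) (auto simp: switchable_def)
      then show ?thesis using R A same by simp
    qed
    finally show ?thesis using realizations_degree[OF E v] by simp
  qed
  show ?thesis using sub deg by (auto simp: realizations_def)
qed

text \<open>Double counting of the pairs of a graph in \<open>\<Omega>\<close> and one of its codes. The pair is determined by the
switched graph and the code, because switchings can be undone.\<close>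

lemma switching_bound:
  fixes A B :: real
  assumes fin: "finite V" and \<Omega>: "\<Omega> \<subseteq> realizations V d"
    and C: "\<And>E c. E \<in> \<Omega> \<Longrightarrow> c \<in> C E \<Longrightarrow> switchable E c"
    and finC: "\<And>E. E \<in> \<Omega> \<Longrightarrow> finite (C E)"
    and A: "\<And>E. E \<in> \<Omega> \<Longrightarrow> A \<le> card (C E)"
    and B: "\<And>E'. E' \<in> realizations V d \<Longrightarrow> real (card {c. \<exists>E\<in>\<Omega>. c \<in> C E \<and> switch E c = E'}) \<le> B"
  shows "A * card \<Omega> \<le> B * card (realizations V d)"
proof -
  let ?D = "\<lambda>E'. {c. \<exists>E\<in>\<Omega>. c \<in> C E \<and> switch E c = E'}"
  have fin\<Omega>: "finite \<Omega>" using finite_subset[OF \<Omega> finite_realizations[OF fin]] .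
  have finD: "finite (?D E')" for E'
    by (rule finite_subset[of _ "\<Union>E\<in>\<Omega>. C E"]) (use fin\<Omega> finC in auto)
  have inj: "inj_on (\<lambda>(E, c). (switch E c, c)) (Sigma \<Omega> C)"
  proof -
    have eq: "E = E'" if "E \<in> \<Omega>" "c \<in> C E" "E' \<in> \<Omega>" "c \<in> C E'" "switch E c = switch E' c" for E c E'
    proof -
      have "E = (switch E' c - set (added_edges c)) \<union> set (removed_edges c)"
        using switch_inverse[OF C[OF that(1,2)]] by (simp only: that(5))
      then show ?thesis by (simp only: switch_inverse[OF C[OF that(3,4)]])
    qed
    show ?thesis
    proof (rule inj_onI)
      fix p p' assume *: "p \<in> Sigma \<Omega> C" "p' \<in> Sigma \<Omega> C"
        "(\<lambda>(E, c). (switch E c, c)) p = (\<lambda>(E, c). (switch E c, c)) p'"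
      then obtain E c E' where p: "p = (E, c)" "p' = (E', c)" by (cases p; cases p') auto
      show "p = p'" using * eq[of E c E'] unfolding p by simp
    qed
  qed
  have "A * card \<Omega> = (\<Sum>E\<in>\<Omega>. A)" by simp
  also have "\<dots> \<le> (\<Sum>E\<in>\<Omega>. real (card (C E)))" by (intro sum_mono A)
  also have "\<dots> = real (card (Sigma \<Omega> C))"
    using fin\<Omega> finC by (simp add: card_SigmaI)
  also have "\<dots> \<le> real (card (Sigma (realizations V d) ?D))"
    using inj fin finite_realizations finD \<Omega> C switch_realization[OF fin]
    by (intro of_nat_mono card_inj_on_le[of "\<lambda>(E, c). (switch E c, c)"])
      (auto intro!: finite_SigmaI)
  also have "\<dots> = (\<Sum>E'\<in>realizations V d. real (card (?D E')))"
    using finD fin finite_realizations by (subst card_SigmaI) auto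
  also have "\<dots> \<le> (\<Sum>E'\<in>realizations V d. B)" by (intro sum_mono B)
  finally show ?thesis by (simp add: mult.commute)
qed

text \<open>Codes are counted from below by choosing their entries one after the other: it suffices that each
entry has \<open>N\<close> choices that are compatible with the previous ones.\<close>

lemma greedy_lists:
  fixes N :: real
  assumes nil: "P []" and tl: "\<And>x xs. P (x # xs) \<Longrightarrow> P xs"
    and fin: "\<And>xs. finite {x. P (x # xs)}" and N: "0 \<le> N"
    and ext: "\<And>xs. P xs \<Longrightarrow> length xs < j \<Longrightarrow> N \<le> card {x. P (x # xs)}"
  shows "finite {xs. length xs = j \<and> P xs} \<and> N ^ j \<le> card {xs. length xs = j \<and> P xs}"
  using ext
proof (induction j)
  case 0
  have "{xs. length xs = 0 \<and> P xs} = {[]}" using nil by auto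
  then show ?case by simp
next
  case (Suc j)
  let ?L = "\<lambda>j. {xs. length xs = j \<and> P xs}"
  have IH: "finite (?L j)" "N ^ j \<le> card (?L j)" using Suc by auto
  have eq: "?L (Suc j) = (\<lambda>(xs, x). x # xs) ` (SIGMA xs:?L j. {x. P (x # xs)})"
    by (force simp: length_Suc_conv intro: tl)
  have "N ^ Suc j \<le> (\<Sum>xs\<in>?L j. N)" using mult_left_mono[OF IH(2) N] by (simp add: mult.commute)
  also have "\<dots> \<le> (\<Sum>xs\<in>?L j. real (card {x. P (x # xs)}))"
    using Suc.prems by (intro sum_mono) auto
  also have "\<dots> = real (card (SIGMA xs:?L j. {x. P (x # xs)}))"
    using IH fin by (simp add: card_SigmaI)
  also have "\<dots> = card (?L (Suc j))"
    unfolding eq by (subst card_image) (auto simp: inj_on_def)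
  finally show ?case using IH fin eq by auto
qed

lemma card_lists_over:
  assumes "finite Q" "L \<subseteq> {xs. set xs \<subseteq> Q \<and> length xs = j}" "real (card Q) \<le> q"
  shows "real (card L) \<le> q ^ j"
proof -
  have "real (card L) \<le> real (card {xs. set xs \<subseteq> Q \<and> length xs = j})"
    using assms finite_lists_length_eq by (intro of_nat_mono card_mono) auto
  also have "\<dots> = real (card Q) ^ j" using assms by (simp add: card_lists_length_eq)
  also have "\<dots> \<le> q ^ j" using assms by (intro power_mono) auto
  finally show ?thesis .
qed

section \<open>Breadth-first trees and excess edges\<close>

definition level :: "'a set set \<Rightarrow> 'a \<Rightarrow> 'a \<Rightarrow> nat" where
  "level E u w = (LEAST r. w \<in> gball E u r)"

text \<open>Any fixed choice of parents does, as long as it depends on the graph only. At \<open>u\<close> itself, and outside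
the component of \<open>u\<close>, the value is arbitrary.\<close>

definition parent :: "'a set set \<Rightarrow> 'a \<Rightarrow> 'a \<Rightarrow> 'a" where
  "parent E u w = (SOME v. v \<in> gball E u (level E u w - 1) \<and> {v, w} \<in> E)"

definition bfs_tree :: "'a set set \<Rightarrow> 'a \<Rightarrow> 'a set set" where
  "bfs_tree E u = {{parent E u w, w} | w. w \<noteq> u \<and> (\<exists>r. w \<in> gball E u r)}"

definition excess :: "'a set set \<Rightarrow> 'a \<Rightarrow> nat \<Rightarrow> 'a set set" where
  "excess E u r = {e \<in> E - bfs_tree E u. e \<subseteq> gball E u r}"

lemma level_le: "w \<in> gball E u r \<Longrightarrow> level E u w \<le> r"
  unfolding level_def by (rule Least_le)

lemma in_gball_level: "w \<in> gball E u r \<Longrightarrow> w \<in> gball E u (level E u w)"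
  unfolding level_def by (rule LeastI)

lemma parent_edge:
  assumes "w \<in> gball E u r" "w \<noteq> u"
  shows "0 < level E u w" "parent E u w \<in> gball E u (level E u w - 1)" "{parent E u w, w} \<in> E"
proof -
  have w: "w \<in> gball E u (level E u w)" using in_gball_level[OF assms(1)] .
  then show pos: "0 < level E u w" using assms(2) by (cases "level E u w") auto
  then obtain s where s: "level E u w = Suc s" by (cases "level E u w") auto
  have "w \<notin> gball E u s" using level_le[of w E u s] s by auto
  then have "\<exists>v. v \<in> gball E u (level E u w - 1) \<and> {v, w} \<in> E" using w s by (auto simp: gball.simps(2))
  from someI_ex[OF this]
  show "parent E u w \<in> gball E u (level E u w - 1)" "{parent E u w, w} \<in> E"
    unfolding parent_def by auto
qed

lemma bfs_tree_subset: "bfs_tree E u \<subseteq> E"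
  using parent_edge(3) unfolding bfs_tree_def by fastforce

text \<open>Distances from \<open>u\<close> to a set of vertices that is closed under parents survive in every graph that
contains the tree edges of this set.\<close>

lemma in_gball_of_tree_path:
  assumes tree: "\<And>w. w \<in> Q \<Longrightarrow> w \<noteq> u \<Longrightarrow> parent E u w \<in> Q \<and> {parent E u w, w} \<in> E'"
    and Q: "Q \<subseteq> gball E u r" and w: "w \<in> Q"
  shows "w \<in> gball E' u (level E u w)"
  using w
proof (induction "level E u w" arbitrary: w rule: less_induct)
  case less
  show ?case
  proof (cases "w = u")
    case False
    have wr: "w \<in> gball E u r" using less Q by auto
    define p where "p = parent E u w"
    have p: "p \<in> gball E u (level E u w - 1)" "0 < level E u w"
      using parent_edge[OF wr False] p_def by auto
    then have "level E u p < level E u w" using level_le[OF p(1)] by linarith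
    then have "p \<in> gball E' u (level E u p)" using less tree False p_def by blast
    then have "p \<in> gball E' u (level E u w - 1)"
      using level_le[OF p(1)] by (rule gball_monoD)
    then have "w \<in> gball E' u (Suc (level E u w - 1))"
      using tree[OF less.prems False] p_def gball_step by metis
    then show ?thesis using p by simp
  qed (simp add: gball_self)
qed

lemma gball_keep_tree:
  assumes "{e \<in> bfs_tree E u. e \<subseteq> gball E u r} \<subseteq> E'" "E' \<subseteq> E"
  shows "gball E' u r = gball E u r"
proof
  show "gball E' u r \<subseteq> gball E u r" using assms(2) by (rule gball_mono_edges)
  show "gball E u r \<subseteq> gball E' u r"
  proof
    fix w assume w: "w \<in> gball E u r"
    have "parent E u w \<in> gball E u r \<and> {parent E u w, w} \<in> E'"
      if "w \<in> gball E u r" "w \<noteq> u" for w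
    proof -
      have p: "parent E u w \<in> gball E u r"
        using parent_edge(2)[OF that] level_le[OF that(1)]
          gball_monoD[of "parent E u w" E u "level E u w - 1" r] by auto
      moreover have "{parent E u w, w} \<in> bfs_tree E u" using that by (auto simp: bfs_tree_def)
      ultimately show ?thesis using assms(1) that by auto
    qed
    from in_gball_of_tree_path[of "gball E u r" u E E' r w, OF this subset_refl w]
    show "w \<in> gball E' u r" using gball_mono[OF level_le[OF w], of E' u] by auto
  qed
qed

lemma card_tree_in_ball:
  assumes "finite (gball E u r)"
  shows "card {e \<in> bfs_tree E u. e \<subseteq> gball E u r} + 1 \<le> card (gball E u r)"
proof -
  have "{e \<in> bfs_tree E u. e \<subseteq> gball E u r} \<subseteq> (\<lambda>w. {parent E u w, w}) ` (gball E u r - {u})"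
    by (auto simp: bfs_tree_def)
  then have "card {e \<in> bfs_tree E u. e \<subseteq> gball E u r} \<le> card (gball E u r - {u})"
    using assms by (meson card_image_le card_mono finite_Diff finite_imageI le_trans)
  moreover have "card (gball E u r) > 0" using assms gball_self[of u E r] by (auto simp: card_gt_0_iff)
  ultimately show ?thesis using assms gball_self[of u E r] by (simp add: card_Diff_singleton)
qed

lemma excess_mono: "r \<le> s \<Longrightarrow> excess E u r \<subseteq> excess E u s"
  using gball_mono[of r s E u] by (auto simp: excess_def)

text \<open>An edge contributes the number of its ends in \<open>W\<close>, and it has two ends in \<open>W\<close> exactly if it lies inside \<open>W\<close>.\<close>

lemma volume_eq_edge_count:
  assumes fin: "finite V" and E: "E \<in> realizations V d" and W: "W \<subseteq> V"
  shows "sum d W = card {e \<in> E. e \<inter> W \<noteq> {}} + card {e \<in> E. e \<subseteq> W}"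
proof -
  have simp: "E \<subseteq> simple_edges V" using E by (rule realizations_simple)
  have finE: "finite E" using finite_subset[OF simp finite_simple_edges[OF fin]] .
  have finW: "finite W" using fin W by (rule rev_finite_subset)
  have "sum d W = (\<Sum>v\<in>W. \<Sum>e\<in>{e \<in> E. v \<in> e}. 1)"
    using realizations_degree[OF E] W by (intro sum.cong) auto
  also have "\<dots> = (\<Sum>e\<in>E. \<Sum>v\<in>{v \<in> W. v \<in> e}. 1)"
    using finE finW by (rule sum.swap_restrict[symmetric])
  also have "\<dots> = (\<Sum>e\<in>E. of_bool (e \<inter> W \<noteq> {}) + of_bool (e \<subseteq> W))"
  proof (rule sum.cong[OF refl])
    fix e assume "e \<in> E"
    then obtain x y where e: "e = {x, y}" "x \<noteq> y" using simp by (meson simple_edgesE subsetD)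
    have "{v \<in> W. v \<in> e} = (if x \<in> W then {x} else {}) \<union> (if y \<in> W then {y} else {})"
      using e by auto
    then show "(\<Sum>v\<in>{v \<in> W. v \<in> e}. 1) = (of_bool (e \<inter> W \<noteq> {}) + of_bool (e \<subseteq> W) :: nat)"
      using e by auto
  qed
  also have "\<dots> = card {e \<in> E. e \<inter> W \<noteq> {}} + card {e \<in> E. e \<subseteq> W}"
    using finE by (simp add: sum.distrib Int_def)
  finally show ?thesis .
qed

text \<open>Write \<open>B\<close> for the ball and \<open>B'\<close> for the next one. The volume of \<open>B\<close> counts the edges that touch \<open>B\<close>, which
all lie in \<open>B'\<close>, and once more those inside \<open>B\<close>. The tree has one edge less than the ball has vertices
inside each of \<open>B\<close> and \<open>B'\<close>, and all other edges are excess edges.\<close>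

lemma ball_growth:
  assumes fin: "finite V" and E: "E \<in> realizations V d" and u: "u \<in> V"
  shows "sum d (gball E u r) + 2 \<le> card (gball E u (Suc r)) + card (gball E u r) + 2 * card (excess E u (Suc r))"
proof -
  have simp: "E \<subseteq> simple_edges V" using E by (rule realizations_simple)
  have finE: "finite E" using finite_subset[OF simp finite_simple_edges[OF fin]] .
  have sub: "gball E u r \<subseteq> V" for r using gball_subset[OF simp u] .
  have finB: "finite (gball E u r)" for r using fin sub by (rule rev_finite_subset)
  let ?T = "\<lambda>r. {e \<in> bfs_tree E u. e \<subseteq> gball E u r}" and ?X = "excess E u (Suc r)"
  have finT: "finite (?T r)" for r using finite_subset[OF bfs_tree_subset finE] by simp
  have finX: "finite ?X" using finE by (simp add: excess_def)
  have "{e \<in> E. e \<inter> gball E u r \<noteq> {}} \<subseteq> ?T (Suc r) \<union> ?X"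
  proof
    fix e assume e: "e \<in> {e \<in> E. e \<inter> gball E u r \<noteq> {}}"
    then obtain v where v: "v \<in> e" "v \<in> gball E u r" by auto
    moreover obtain w where "e = {v, w}" using e simp v by (metis (mono_tags, lifting) mem_Collect_eq simple_edges_other_end subsetD)
    ultimately have "e \<subseteq> gball E u (Suc r)" using e by (auto simp: gball.simps(2))
    then show "e \<in> ?T (Suc r) \<union> ?X" using e by (auto simp: excess_def)
  qed
  then have "card {e \<in> E. e \<inter> gball E u r \<noteq> {}} \<le> card (?T (Suc r)) + card ?X"
    using finT finX by (meson card_Un_le card_mono finite_UnI le_trans)
  moreover have "{e \<in> E. e \<subseteq> gball E u r} \<subseteq> ?T r \<union> ?X"
    using excess_mono[of r "Suc r" E u] by (auto simp: excess_def)
  then have "card {e \<in> E. e \<subseteq> gball E u r} \<le> card (?T r) + card ?X"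
    using finT finX by (meson card_Un_le card_mono finite_UnI le_trans)
  ultimately show ?thesis
    using volume_eq_edge_count[OF fin E sub, of r] card_tree_in_ball[OF finB, of r]
      card_tree_in_ball[OF finB, of "Suc r"] by linarith
qed

lemma sum_degrees_ge:
  fixes d :: "'a \<Rightarrow> nat"
  assumes "\<And>v. v \<in> V \<Longrightarrow> 3 \<le> d v" "W \<subseteq> V"
  shows "3 * card W \<le> sum d W"
proof -
  have "(\<Sum>v\<in>W. 3) \<le> sum d W" using assms by (intro sum_mono) auto
  then show ?thesis by simp
qed

text \<open>With at most two excess edges the sizes of the balls would satisfy \<open>b (r + 1) \<ge> 2 b r - 2\<close>. The first
ball has at least four vertices, so this would keep \<open>b r\<close> above \<open>2 ^ r\<close> beyond the number of vertices.
The constant three cannot be improved: a component may be a complete graph on four vertices.\<close>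

lemma excess_ge_three:
  assumes fin: "finite V" and E: "E \<in> realizations V d" and u: "u \<in> V"
    and deg: "\<And>v. v \<in> V \<Longrightarrow> 3 \<le> d v" and l: "card V < 2 ^ l"
  shows "3 \<le> card (excess E u l)"
proof (rule ccontr)
  assume small: "\<not> 3 \<le> card (excess E u l)"
  have simp: "E \<subseteq> simple_edges V" using E by (rule realizations_simple)
  have finE: "finite E" using finite_subset[OF simp finite_simple_edges[OF fin]] .
  have sub: "gball E u r \<subseteq> V" for r using gball_subset[OF simp u] .
  have vol: "3 * card (gball E u s) \<le> sum d (gball E u s)" for s
    using sum_degrees_ge[of V d] deg sub by blast
  have X: "card (excess E u r) \<le> 2" if "r \<le> l" for r
    using card_mono[OF _ excess_mono[OF that, of E u]] finE small by (auto simp: excess_def)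
  have grow: "2 ^ Suc r + 2 \<le> card (gball E u (Suc r))" if "Suc r \<le> l" for r
    using that
  proof (induction r)
    case 0
    have N: "gball E u (Suc 0) = insert u {w. {u, w} \<in> E}" by (auto simp: gball.simps(2))
    have "u \<notin> {w. {u, w} \<in> E}" using doubleton_simple_iff[of u u V] simp by auto
    moreover have "card {w. {u, w} \<in> E} = d u"
      using edges_at_eq_neighbours[OF simp] realizations_degree[OF E u] by simp
    moreover have "finite {w. {u, w} \<in> E}" using finite_subset[OF sub[of "Suc 0"] fin] N by simp
    ultimately show ?case using deg[OF u] unfolding N by simp
  next
    case (Suc r)
    then show ?case
      using ball_growth[OF fin E u, of "Suc r"] X[of "Suc (Suc r)"]
        vol[of "Suc r"] by simp
  qed
  have "card V > 0" using u fin by (auto simp: card_gt_0_iff)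
  then have "l \<noteq> 0" using l by (intro notI) auto
  then have "2 ^ l + 2 \<le> card (gball E u l)" using grow[of "l - 1"] by simp
  also have "\<dots> \<le> card V" using fin sub by (rule card_mono)
  finally show False using l by simp
qed

text \<open>With fewer than \<open>K / 16\<close> excess edges the volume \<open>K\<close> would force \<open>7 K / 16\<close> vertices into the next ball.
From then on the excess edges are few compared with the ball, which would grow by the factor \<open>3 / 2\<close>
for \<open>l\<close> steps, past the number of vertices.\<close>

lemma excess_ge_of_volume:
  fixes K :: real
  assumes fin: "finite V" and E: "E \<in> realizations V d" and u: "u \<in> V"
    and deg: "\<And>v. v \<in> V \<Longrightarrow> 3 \<le> d v" and l: "card V < (3 / 2 :: real) ^ l"
    and K: "K \<le> real (sum d (gball E u r))"
  shows "K / 16 \<le> card (excess E u (r + 1 + l))"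
proof (rule ccontr)
  let ?b = "\<lambda>r. real (card (gball E u r))" and ?x = "real (card (excess E u (r + 1 + l)))"
  assume "\<not> K / 16 \<le> ?x"
  then have small: "?x < K / 16" by simp
  have simp: "E \<subseteq> simple_edges V" using E by (rule realizations_simple)
  have finE: "finite E" using finite_subset[OF simp finite_simple_edges[OF fin]] .
  have sub: "gball E u r \<subseteq> V" for r using gball_subset[OF simp u] .
  have finB: "finite (gball E u r)" for r using fin sub by (rule rev_finite_subset)
  have grow: "real (sum d (gball E u s)) + 2 \<le> ?b (Suc s) + ?b s + 2 * ?x" if "s \<le> r + l" for s
  proof -
    have "card (excess E u (Suc s)) \<le> card (excess E u (r + 1 + l))"
      using finE that by (intro card_mono excess_mono) (auto simp: excess_def)
    then have "sum d (gball E u s) + 2 \<le> card (gball E u (Suc s)) + card (gball E u s) + 2 * card (excess E u (r + 1 + l))"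
      using ball_growth[OF fin E u, of s] by linarith
    then show ?thesis by linarith
  qed
  have mono: "?b s \<le> ?b t" if "s \<le> t" for s t
    using card_mono[OF finB gball_mono[OF that]] by simp
  have vol: "3 * card (gball E u s) \<le> sum d (gball E u s)" for s
    using sum_degrees_ge[of V d] deg sub by blast
  have start: "7 * K / 16 \<le> ?b (Suc r)"
    using grow[of r] K small mono[of r "Suc r"] by linarith
  have "(3 / 2) ^ i \<le> ?b (Suc r + i)" if "i \<le> l" for i
    using that
  proof (induction i)
    case 0
    have "card (gball E u (Suc r)) > 0" using finB gball_self[of u E "Suc r"] by (auto simp: card_gt_0_iff)
    then show ?case by simp
  next
    case (Suc i)
    have "3 * ?b (Suc r + i) \<le> real (sum d (gball E u (Suc r + i)))"
      using vol[of "Suc r + i"] by linarith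
    moreover have "?b (Suc r) \<le> ?b (Suc r + i)" by (rule mono) simp
    moreover have "(3 / 2) ^ i \<le> ?b (Suc r + i)" using Suc by simp
    ultimately show ?case using grow[of "Suc r + i"] Suc.prems start small by simp
  qed
  from this[of l] have "(3 / 2) ^ l \<le> ?b (Suc r + l)" by simp
  also have "\<dots> \<le> card V" using fin sub by (simp add: card_mono)
  finally show False using l by simp
qed

section \<open>Detachable edge sets\<close>

text \<open>The situation after a switching of excess edges of \<open>u\<close>: \<open>E\<close> is the switched graph and \<open>D\<close> the set of its
added edges. Without them the ball has its old volume, and each of them touches this ball. The degrees
\<open>d\<close> are a parameter since they differ from those in \<open>E - D\<close>.\<close>

definition detachable :: "('a \<Rightarrow> nat) \<Rightarrow> 'a \<Rightarrow> nat \<Rightarrow> real \<Rightarrow> 'a set set \<Rightarrow> 'a set set \<Rightarrow> bool" where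
  "detachable d u r K E D \<longleftrightarrow> D \<subseteq> E \<and> real (sum d (gball (E - D) u r)) \<le> K \<and>
     (\<forall>e\<in>D. e \<inter> gball (E - D) u r \<noteq> {})"

lemma card_touching_le:
  assumes W: "finite W" and E: "finite E" and deg: "\<And>v. v \<in> W \<Longrightarrow> card {e \<in> E. v \<in> e} \<le> d v"
  shows "card {e \<in> E. e \<inter> W \<noteq> {}} \<le> sum d W"
proof -
  have "{e \<in> E. e \<inter> W \<noteq> {}} = (\<Union>v\<in>W. {e \<in> E. v \<in> e})" by auto
  then have "card {e \<in> E. e \<inter> W \<noteq> {}} \<le> (\<Sum>v\<in>W. card {e \<in> E. v \<in> e})"
    using card_UN_le[OF W] by simp
  also have "\<dots> \<le> sum d W" using deg by (rule sum_mono)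
  finally show ?thesis .
qed

text \<open>The set \<open>Z\<close> does not depend on \<open>D\<close>. If the ball of \<open>E\<close> itself is small, all edges that touch it will do.
Otherwise take a maximal set \<open>Q\<close> of volume at most \<open>K\<close> in the ball that contains \<open>u\<close> and the parents of
its elements, and let \<open>Z\<close> be the set of edges touching \<open>Q\<close>. If \<open>D\<close> avoids \<open>Z\<close>, then \<open>Q\<close> and one further vertex
stay in the ball after the removal of \<open>D\<close>, which makes its volume exceed \<open>K\<close>.\<close>

lemma detachable_hitting_set:
  fixes K :: real
  assumes fin: "finite V" and E: "E \<subseteq> simple_edges V" and u: "u \<in> V"
    and deg: "\<And>v. v \<in> V \<Longrightarrow> card {e \<in> E. v \<in> e} \<le> d v" and K: "0 \<le> K"
  shows "\<exists>Z. finite Z \<and> card Z \<le> K \<and> (\<forall>D. detachable d u r K E D \<longrightarrow> D \<noteq> {} \<longrightarrow> D \<inter> Z \<noteq> {})"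
proof -
  have finE: "finite E" using finite_subset[OF E finite_simple_edges[OF fin]] .
  have sub: "gball F u s \<subseteq> V" if "F \<subseteq> E" for F s using gball_subset[of F V u s] that E u by auto
  have touch: "card {e \<in> E. e \<inter> W \<noteq> {}} \<le> sum d W" if "W \<subseteq> V" for W
    using that finE fin by (intro card_touching_le deg) (auto intro: finite_subset)
  consider "real (sum d (gball E u r)) \<le> K" | "K < real (d u)" | "K < real (sum d (gball E u r))" "real (d u) \<le> K" by linarith
  then show ?thesis
  proof cases
    case 1
    let ?Z = "{e \<in> E. e \<inter> gball E u r \<noteq> {}}"
    have "D \<inter> ?Z \<noteq> {}" if D: "detachable d u r K E D" "D \<noteq> {}" for D
    proof -
      obtain e where e: "e \<in> D" using D(2) by auto
      then have "e \<in> E" "e \<inter> gball (E - D) u r \<noteq> {}" using D(1) by (auto simp: detachable_def)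
      then have "e \<in> ?Z" using gball_mono_edges[of "E - D" E u r] by auto
      then show ?thesis using e by auto
    qed
    moreover have "card ?Z \<le> K" using touch[OF sub[of E r, OF subset_refl]] 1 by linarith
    ultimately show ?thesis using finE by (intro exI[of _ ?Z]) auto
  next
    case 2
    have "\<not> detachable d u r K E D" for D
    proof
      assume D: "detachable d u r K E D"
      have "d u \<le> sum d (gball (E - D) u r)"
        using fin sub[of "E - D" r] gball_self by (intro member_le_sum) (auto intro: finite_subset)
      then show False using D 2 unfolding detachable_def by linarith
    qed
    then show ?thesis using K by (intro exI[of _ "{}"]) auto
  next
    case 3
    let ?B = "gball E u r"
    have finB: "finite ?B" using fin sub[of E r] by (auto intro: finite_subset)
    define closed where "closed Q \<longleftrightarrow> Q \<subseteq> ?B \<and> (\<forall>w\<in>Q. w \<noteq> u \<longrightarrow> parent E u w \<in> Q)" for Q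
    define good where "good Q \<longleftrightarrow> closed Q \<and> u \<in> Q \<and> real (sum d Q) \<le> K" for Q
    have "good {u}" using 3 gball_self by (auto simp: good_def closed_def)
    moreover have "\<forall>Q. good Q \<longrightarrow> card Q < Suc (card ?B)"
      using finB by (auto simp: good_def closed_def less_Suc_eq_le intro: card_mono)
    ultimately obtain Q where Q: "good Q" and Qmax: "\<And>Q'. good Q' \<Longrightarrow> card Q' \<le> card Q"
      using ex_has_greatest_nat[of good "{u}" card "Suc (card ?B)"] by blast
    have QB: "Q \<subseteq> ?B" using Q by (auto simp: good_def closed_def)
    moreover have "Q \<noteq> ?B" using Q 3 by (auto simp: good_def)
    ultimately have "\<exists>q. q \<in> ?B - Q" by auto
    then obtain q where q: "q \<in> ?B - Q" and qmin: "\<And>y. y \<in> ?B - Q \<Longrightarrow> level E u q \<le> level E u y"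
      using ex_has_least_nat[of "\<lambda>q. q \<in> ?B - Q" _ "level E u"] by blast
    have qu: "q \<noteq> u" using q Q by (auto simp: good_def)
    have qB: "q \<in> ?B" using q by auto
    define p where "p = parent E u q"
    have p: "p \<in> gball E u (level E u q - 1)" "0 < level E u q"
      using parent_edge[OF qB qu] p_def by auto
    then have "level E u p < level E u q" using level_le[OF p(1)] by linarith
    moreover have "p \<in> ?B" using gball_monoD[OF p(1), of r] level_le[OF qB] by auto
    ultimately have pQ: "p \<in> Q" using qmin[of p] by auto
    let ?Q = "insert q Q"
    have clQ: "closed ?Q" using Q pQ qB by (auto simp: good_def closed_def p_def)
    have "card Q < card ?Q" using q finite_subset[OF QB finB] by auto
    then have "\<not> good ?Q" using Qmax[of ?Q] by auto
    then have volQ: "K < real (sum d ?Q)" using clQ Q by (auto simp: good_def)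
    let ?Z = "{e \<in> E. e \<inter> Q \<noteq> {}}"
    have "D \<inter> ?Z \<noteq> {}" if D: "detachable d u r K E D" for D
    proof
      assume disj: "D \<inter> ?Z = {}"
      have DE: "D \<subseteq> E" using D by (simp add: detachable_def)
      have tree: "parent E u w \<in> ?Q \<and> {parent E u w, w} \<in> E - D" if w: "w \<in> ?Q" "w \<noteq> u" for w
      proof -
        have wB: "w \<in> ?B" using w qB QB by auto
        have "parent E u w \<in> Q" using w pQ Q by (auto simp: good_def closed_def p_def)
        moreover have "{parent E u w, w} \<in> E" using parent_edge(3)[OF wB w(2)] .
        ultimately show ?thesis using disj by blast
      qed
      have QB': "?Q \<subseteq> ?B" using QB qB by auto
      have "?Q \<subseteq> gball (E - D) u r"
      proof
        fix w assume w: "w \<in> ?Q"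
        then have "w \<in> gball (E - D) u (level E u w)"
          by (intro in_gball_of_tree_path[of ?Q u E "E - D" r] tree QB')
        then show "w \<in> gball (E - D) u r"
          using gball_mono[of "level E u w" r "E - D" u] level_le[of w E u r] w QB' by blast
      qed
      then have "sum d ?Q \<le> sum d (gball (E - D) u r)"
        using fin sub[of "E - D" r] by (intro sum_mono2) (auto intro: finite_subset)
      then show False using volQ D unfolding detachable_def by linarith
    qed
    moreover have "card ?Z \<le> K"
    proof -
      have "card ?Z \<le> sum d Q" using touch[of Q] QB sub[of E r] by auto
      then show ?thesis using Q unfolding good_def by linarith
    qed
    ultimately show ?thesis using finE by (intro exI[of _ ?Z]) auto
  qed
qed

text \<open>Each detachable set contains one of the at most \<open>K\<close> edges of a hitting set. Deleting this edge from both
sets leaves a detachable set, so the bound follows by induction.\<close>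

lemma card_detachable_le:
  fixes K :: real
  assumes fin: "finite V" and E: "E \<subseteq> simple_edges V" and u: "u \<in> V"
    and deg: "\<And>v. v \<in> V \<Longrightarrow> card {e \<in> E. v \<in> e} \<le> d v" and K: "0 \<le> K"
  shows "card {D. card D = k \<and> detachable d u r K E D} \<le> K ^ k"
  using E deg
proof (induction k arbitrary: E)
  case 0
  have finE: "finite E" using finite_subset[OF 0(1) finite_simple_edges[OF fin]] .
  have "{D. card D = 0 \<and> detachable d u r K E D} \<subseteq> {{}}"
    using finE by (auto simp: detachable_def dest: finite_subset)
  then have "card {D. card D = 0 \<and> detachable d u r K E D} \<le> card {{} :: 'a set set}"
    by (intro card_mono) auto
  then show ?case by simp
next
  case (Suc k)
  have finE: "finite E" using finite_subset[OF Suc(2) finite_simple_edges[OF fin]] .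
  let ?S = "\<lambda>k E. {D. card D = k \<and> detachable d u r K E D}"
  obtain Z where Z: "finite Z" "card Z \<le> K"
    and hit: "\<And>D. detachable d u r K E D \<Longrightarrow> D \<noteq> {} \<Longrightarrow> D \<inter> Z \<noteq> {}"
    using detachable_hitting_set[OF fin Suc(2) u Suc(3) K] by blast
  have finS: "finite (?S k F)" if "F \<subseteq> E" for k F
    by (rule finite_subset[of _ "Pow E"]) (use that finE in \<open>auto simp: detachable_def\<close>)
  have "?S (Suc k) E \<subseteq> (\<Union>z\<in>Z. insert z ` ?S k (E - {z}))"
  proof
    fix D assume D: "D \<in> ?S (Suc k) E"
    then obtain z where z: "z \<in> D" "z \<in> Z" using hit[of D] by fastforce
    have "E - {z} - (D - {z}) = E - D" using z by auto
    then have "D - {z} \<in> ?S k (E - {z})" using D z by (auto simp: detachable_def)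
    then show "D \<in> (\<Union>z\<in>Z. insert z ` ?S k (E - {z}))"
      using z by (intro UN_I[of z] image_eqI[of _ _ "D - {z}"]) auto
  qed
  then have "card (?S (Suc k) E) \<le> card (\<Union>z\<in>Z. insert z ` ?S k (E - {z}))"
    using Z finS by (intro card_mono) auto
  also have "\<dots> \<le> (\<Sum>z\<in>Z. card (insert z ` ?S k (E - {z})))" using Z(1) by (rule card_UN_le)
  also have "\<dots> \<le> (\<Sum>z\<in>Z. card (?S k (E - {z})))"
    using finS by (intro sum_mono card_image_le) auto
  finally have "real (card (?S (Suc k) E)) \<le> real (\<Sum>z\<in>Z. card (?S k (E - {z})))" by linarith
  also have "\<dots> = (\<Sum>z\<in>Z. real (card (?S k (E - {z}))))" by simp
  also have "\<dots> \<le> (\<Sum>z\<in>Z. K ^ k)"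
  proof (intro sum_mono Suc.IH)
    fix z v assume "v \<in> V"
    have "card {e \<in> E - {z}. v \<in> e} \<le> card {e \<in> E. v \<in> e}" using finE by (intro card_mono) auto
    then show "card {e \<in> E - {z}. v \<in> e} \<le> d v" using Suc.prems(2)[OF \<open>v \<in> V\<close>] by simp
  qed (use Suc.prems in auto)
  also have "\<dots> \<le> K * K ^ k" using Z K by (simp add: mult_right_mono)
  finally show ?case by simp
qed

section \<open>Switching excess edges\<close>

text \<open>Oriented edges with distinct heads. A high-degree vertex may be the only possible end \<open>b\<close> of the edges \<open>ab\<close>
that an edge \<open>xz\<close> can be switched with; the new edges \<open>zb\<close> are then distinct only if the heads \<open>z\<close> are.\<close>

definition head_lists :: "'a set set \<Rightarrow> nat \<Rightarrow> ('a \<times> 'a) list set" where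
  "head_lists X j = {l. length l = j \<and> distinct (map snd l) \<and> distinct (map (\<lambda>(x, z). {x, z}) l) \<and>
     (\<forall>(x, z)\<in>set l. {x, z} \<in> X)}"

lemma distinct_map_refine:
  assumes "distinct (map g c)" "\<And>p q. p \<in> set c \<Longrightarrow> q \<in> set c \<Longrightarrow> f p = f q \<Longrightarrow> g p = g q"
  shows "distinct (map f c)"
  using assms(1) unfolding distinct_map inj_on_def by (meson assms(2))

lemma distinct_map_quads:
  assumes "distinct (map (\<lambda>(x, z, a, b). g x z a b) c)"
    and "\<And>x z a b x' z' a' b'. (x, z, a, b) \<in> set c \<Longrightarrow> (x', z', a', b') \<in> set c \<Longrightarrow>
      f x z a b = f x' z' a' b' \<Longrightarrow> g x z a b = g x' z' a' b'"
  shows "distinct (map (\<lambda>(x, z, a, b). f x z a b) c)"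
proof (rule distinct_map_refine[OF assms(1)])
  fix p q assume pq: "p \<in> set c" "q \<in> set c"
    "(case p of (x, z, a, b) \<Rightarrow> f x z a b) = (case q of (x, z, a, b) \<Rightarrow> f x z a b)"
  obtain x z a b x' z' a' b' where eq: "p = (x, z, a, b)" "q = (x', z', a', b')"
    by (cases p; cases q)
  show "(case p of (x, z, a, b) \<Rightarrow> g x z a b) = (case q of (x, z, a, b) \<Rightarrow> g x z a b)"
    using assms(2)[of x z a b x' z' a' b'] pq unfolding eq by simp
qed

lemma distinct_concat_pairs:
  assumes "distinct (map f c)" "distinct (map g c)" "f ` set c \<inter> g ` set c = {}"
  shows "distinct (concat (map (\<lambda>q. [f q, g q]) c))"
  using assms
proof (induction c)
  case (Cons q c)
  have "set (concat (map (\<lambda>q. [f q, g q]) c)) = f ` set c \<union> g ` set c" by auto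
  then show ?case using Cons by auto
qed simp

lemma switchableI:
  assumes "distinct (map (\<lambda>(x, z, a, b). {x, z}) c)" "distinct (map (\<lambda>(x, z, a, b). {a, b}) c)"
    and "distinct (map (\<lambda>(x, z, a, b). {x, a}) c)" "distinct (map (\<lambda>(x, z, a, b). {z, b}) c)"
    and cross: "\<And>x z a b x' z' a' b'. (x, z, a, b) \<in> set c \<Longrightarrow> (x', z', a', b') \<in> set c \<Longrightarrow>
      {x, z} \<noteq> {a', b'} \<and> {x, a} \<noteq> {z', b'}"
    and edges: "\<And>x z a b. (x, z, a, b) \<in> set c \<Longrightarrow>
      {x, z} \<in> E \<and> {a, b} \<in> E \<and> {x, a} \<notin> E \<and> {z, b} \<notin> E \<and> x \<noteq> a \<and> z \<noteq> b"
  shows "switchable E c"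
proof -
  have R: "removed_edges c = concat (map (\<lambda>q. [(\<lambda>(x, z, a, b). {x, z}) q, (\<lambda>(x, z, a, b). {a, b}) q]) c)"
    and A: "added_edges c = concat (map (\<lambda>q. [(\<lambda>(x, z, a, b). {x, a}) q, (\<lambda>(x, z, a, b). {z, b}) q]) c)"
    unfolding removed_edges_def added_edges_def by (simp_all add: case_prod_unfold)
  have "(\<lambda>(x, z, a, b). {x, z}) ` set c \<inter> (\<lambda>(x, z, a, b). {a, b}) ` set c = {}"
    and "(\<lambda>(x, z, a, b). {x, a}) ` set c \<inter> (\<lambda>(x, z, a, b). {z, b}) ` set c = {}"
    using cross by (force simp: set_eq_iff[of "_ \<inter> _" "{}"])+
  then have "distinct (removed_edges c)" "distinct (added_edges c)"
    unfolding R A using assms(1-4) by (auto intro!: distinct_concat_pairs)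
  moreover have "set (removed_edges c) \<subseteq> E" "set (added_edges c) \<inter> E = {}"
    using edges by (auto simp: set_removed_edges set_added_edges)
  moreover have "\<forall>(x, z, a, b)\<in>set c. x \<noteq> a \<and> z \<noteq> b" using edges by auto
  ultimately show ?thesis by (simp add: switchable_def)
qed

lemma card_edges_inside_le:
  assumes "finite U" "X \<subseteq> simple_edges V"
  shows "card {e \<in> X. e \<subseteq> U} \<le> card U * card U"
proof -
  have "{e \<in> X. e \<subseteq> U} \<subseteq> (\<lambda>(x, y). {x, y}) ` (U \<times> U)"
  proof
    fix e assume e: "e \<in> {e \<in> X. e \<subseteq> U}"
    then have "e \<in> simple_edges V" using assms(2) by auto
    then obtain x y where "e = {x, y}" by (rule simple_edgesE)
    then show "e \<in> (\<lambda>(x, y). {x, y}) ` (U \<times> U)" using e by auto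
  qed
  then have "card {e \<in> X. e \<subseteq> U} \<le> card (U \<times> U)"
    using assms(1) by (meson card_image_le card_mono finite_SigmaI finite_imageI le_trans)
  then show ?thesis by (simp add: card_cartesian_product)
qed

lemma finite_head_lists:
  assumes "finite V" "X \<subseteq> simple_edges V"
  shows "finite (head_lists X j)"
proof (rule finite_subset)
  show "head_lists X j \<subseteq> {l. set l \<subseteq> V \<times> V \<and> length l = j}"
    using assms(2) unfolding head_lists_def by (fastforce simp: doubleton_simple_iff)
  show "finite {l. set l \<subseteq> V \<times> V \<and> length l = j}"
    using assms(1) by (intro finite_lists_length_eq) simp
qed

text \<open>At most \<open>4 j\<^sup>2\<close> edges lie inside the set of at most \<open>2 j\<close> ends chosen before. Any other edge has an end
outside this set, which serves as a new head.\<close>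

lemma card_head_lists_ge:
  assumes fin: "finite V" and X: "X \<subseteq> simple_edges V"
    and L: "L \<le> real (card X)" "8 * (real j)\<^sup>2 \<le> L"
  shows "(L / 2) ^ j \<le> real (card (head_lists X j))"
proof -
  define P :: "('a \<times> 'a) list \<Rightarrow> bool" where
    "P l \<longleftrightarrow> distinct (map snd l) \<and> distinct (map (\<lambda>(x, z). {x, z}) l) \<and> (\<forall>(x, z)\<in>set l. {x, z} \<in> X)" for l
  have finX: "finite X" using finite_subset[OF X finite_simple_edges[OF fin]] .
  have "L \<ge> 0" using L(2) zero_le_power2[of "real j"] by linarith
  have finP: "finite {x. P (x # xs)}" for xs
    by (rule finite_subset[of _ "V \<times> V"]) (use fin X in \<open>auto simp: P_def doubleton_simple_iff subset_iff\<close>)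
  have "L / 2 \<le> real (card {x. P (x # xs)})" if xs: "P xs" "length xs < j" for xs
  proof -
    define U where "U = fst ` set xs \<union> snd ` set xs"
    have finU: "finite U" by (simp add: U_def)
    have "card U \<le> card (fst ` set xs) + card (snd ` set xs)" unfolding U_def by (rule card_Un_le)
    also have "\<dots> \<le> length xs + length xs" by (meson add_mono card_image_le card_length finite_set le_trans)
    finally have "card U \<le> 2 * j" using xs by simp
    then have "card U * card U \<le> (2 * j) * (2 * j)" by (rule mult_le_mono) fact
    then have inU: "card {e \<in> X. e \<subseteq> U} \<le> 4 * j\<^sup>2"
      using card_edges_inside_le[OF finU X] by (simp add: power2_eq_square)
    have "X - {e \<in> X. e \<subseteq> U} \<subseteq> (\<lambda>(x, z). {x, z}) ` {x. P (x # xs)}"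
    proof
      fix e assume e: "e \<in> X - {e \<in> X. e \<subseteq> U}"
      then obtain z where z: "z \<in> e" "z \<notin> U" by auto
      have eX: "e \<in> X" using e by auto
      then have "e \<in> simple_edges V" using X by auto
      then obtain x where x: "e = {z, x}" using z(1) by (rule simple_edges_other_end)
      have "z \<notin> snd ` set xs" using z by (auto simp: U_def)
      moreover have "{x, z} \<notin> (\<lambda>(x, z). {x, z}) ` set xs"
      proof
        assume "{x, z} \<in> (\<lambda>(x, z). {x, z}) ` set xs"
        then obtain x' z' where "(x', z') \<in> set xs" "{x, z} = {x', z'}" by auto
        then have "z \<in> U" by (force simp: U_def doubleton_eq_iff)
        then show False using z by simp
      qed
      ultimately have "P ((x, z) # xs)"
        using xs(1) eX x by (auto simp: P_def insert_commute)
      then show "e \<in> (\<lambda>(x, z). {x, z}) ` {x. P (x # xs)}" using x by (force simp: insert_commute)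
    qed
    then have "card (X - {e \<in> X. e \<subseteq> U}) \<le> card {x. P (x # xs)}"
      using finP by (meson card_image_le card_mono finite_imageI le_trans)
    moreover have "card (X - {e \<in> X. e \<subseteq> U}) = card X - card {e \<in> X. e \<subseteq> U}"
      using finX by (intro card_Diff_subset) auto
    ultimately have "card X \<le> card {x. P (x # xs)} + 4 * j\<^sup>2" using inU by linarith
    from of_nat_mono[OF this]
    have "real (card X) \<le> real (card {x. P (x # xs)}) + 4 * (real j)\<^sup>2" by simp
    then show ?thesis using L by linarith
  qed
  then have "(L / 2) ^ j \<le> real (card {l. length l = j \<and> P l})"
    using greedy_lists[of P "L / 2" j] finP \<open>L \<ge> 0\<close> by (auto simp: P_def)
  moreover have "{l. length l = j \<and> P l} = head_lists X j" by (auto simp: P_def head_lists_def)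
  ultimately show ?thesis by simp
qed

text \<open>Any three distinct edges have a system of distinct representatives: fix an end \<open>x3\<close> of the third one.
If the other two could not be represented by distinct vertices other than \<open>x3\<close>, they would both
consist of \<open>x3\<close> and the same second vertex.\<close>

lemma head_lists_three:
  assumes fin: "finite V" and X: "X \<subseteq> simple_edges V" and three: "3 \<le> card X"
  shows "1 \<le> real (card (head_lists X 3))"
proof -
  have finX: "finite X" using finite_subset[OF X finite_simple_edges[OF fin]] .
  from obtain_subset_with_card_n[OF three]
  obtain Y where Y: "Y \<subseteq> X" "card Y = 3" by metis
  then obtain e1 e2 e3 where e: "e1 \<in> X" "e2 \<in> X" "e3 \<in> X" "e1 \<noteq> e2" "e1 \<noteq> e3" "e2 \<noteq> e3"
    unfolding card_3_iff by (metis insertCI subsetD)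
  obtain x1 y1 where 1: "e1 = {x1, y1}" "x1 \<noteq> y1" using simple_edgesE[of e1 V] e X by (metis subsetD)
  obtain x2 y2 where 2: "e2 = {x2, y2}" "x2 \<noteq> y2" using simple_edgesE[of e2 V] e X by (metis subsetD)
  obtain x3 y3 where 3: "e3 = {x3, y3}" "x3 \<noteq> y3" using simple_edgesE[of e3 V] e X by (metis subsetD)
  have "\<exists>a1 b1 a2 b2 a3 b3. {a1, b1} = e1 \<and> {a2, b2} = e2 \<and> {a3, b3} = e3 \<and>
      b1 \<noteq> b2 \<and> b1 \<noteq> b3 \<and> b2 \<noteq> b3"
  proof -
    have "\<exists>a1 b1 a2 b2. {a1, b1} = e1 \<and> {a2, b2} = e2 \<and> b1 \<noteq> b2 \<and> b1 \<noteq> x3 \<and> b2 \<noteq> x3"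
    proof (rule ccontr)
      assume *: "\<not> ?thesis"
      have no: "\<not> (b1 \<noteq> b2 \<and> b1 \<noteq> x3 \<and> b2 \<noteq> x3)" if "{a1, b1} = e1" "{a2, b2} = e2" for a1 b1 a2 b2
        using * that by blast
      have "\<not> (y1 \<noteq> y2 \<and> y1 \<noteq> x3 \<and> y2 \<noteq> x3)" "\<not> (x1 \<noteq> y2 \<and> x1 \<noteq> x3 \<and> y2 \<noteq> x3)"
        "\<not> (y1 \<noteq> x2 \<and> y1 \<noteq> x3 \<and> x2 \<noteq> x3)" "\<not> (x1 \<noteq> x2 \<and> x1 \<noteq> x3 \<and> x2 \<noteq> x3)"
        using no[of x1 y1 x2 y2] no[of y1 x1 x2 y2] no[of x1 y1 y2 x2] no[of y1 x1 y2 x2] 1 2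
        by (simp_all add: insert_commute)
      then show False using e(4) 1 2 by auto
    qed
    moreover have "{y3, x3} = e3" using 3 by auto
    ultimately show ?thesis by blast
  qed
  then obtain a1 b1 a2 b2 a3 b3 where ab: "{a1, b1} = e1" "{a2, b2} = e2" "{a3, b3} = e3"
    "b1 \<noteq> b2" "b1 \<noteq> b3" "b2 \<noteq> b3" by blast
  then have "[(a1, b1), (a2, b2), (a3, b3)] \<in> head_lists X 3"
    using e by (simp add: head_lists_def)
  then have "card (head_lists X 3) > 0"
    using finite_head_lists[OF fin X] by (auto simp: card_gt_0_iff)
  then show ?thesis by simp
qed

text \<open>The edges \<open>ab\<close> outside the ball \<open>W\<close> with which excess edges are switched. The ends \<open>a\<close> have degree at most
\<open>s\<close> because choosing one such end may exclude all edges at this vertex from later choices, while most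
edges may be incident with a few vertices of huge degree, which have to be admitted as \<open>b\<close>.\<close>

definition far_lists :: "('a \<Rightarrow> nat) \<Rightarrow> 'a set \<Rightarrow> real \<Rightarrow> 'a set set \<Rightarrow> nat \<Rightarrow> ('a \<times> 'a) list set" where
  "far_lists d W s E j = {l. length l = j \<and> distinct (map fst l) \<and> fst ` set l \<inter> snd ` set l = {} \<and>
     (\<forall>(a, b)\<in>set l. {a, b} \<in> E \<and> a \<notin> W \<and> b \<notin> W \<and> real (d a) \<le> s)}"

lemma volume_whole:
  assumes "finite V" "E \<in> realizations V d"
  shows "sum d V = 2 * card E"
proof -
  have "E \<subseteq> simple_edges V" using assms by (auto simp: realizations_def)
  then have "{e \<in> E. e \<inter> V \<noteq> {}} = E" "{e \<in> E. e \<subseteq> V} = E"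
    by (auto simp: simple_edges_def subset_iff) (metis Int_absorb2 card.empty subsetI zero_neq_numeral)
  then show ?thesis using volume_eq_edge_count[OF assms subset_refl] by simp
qed

text \<open>There are at most \<open>\<surd>m / 2\<close> vertices of degree above \<open>4 \<surd>m\<close>, so at most \<open>m / 4\<close> edges have no end of lower
degree. At most \<open>K\<close> edges touch \<open>W\<close>, and at most \<open>2 j * 4 \<surd>m\<close> edges contain a vertex of low degree that
has been used before.\<close>

lemma card_far_lists_ge:
  fixes m :: real
  assumes fin: "finite V" and E: "E \<in> realizations V d" and m: "m = card E"
    and W: "W \<subseteq> V" "real (sum d W) \<le> K"
    and size: "K + m / 4 + 8 * real j * sqrt m \<le> m / 2"
  shows "(m / 2) ^ j \<le> real (card (far_lists d W (4 * sqrt m) E j))"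
proof -
  let ?s = "4 * sqrt m"
  define P :: "('a \<times> 'a) list \<Rightarrow> bool" where
    "P l \<longleftrightarrow> distinct (map fst l) \<and> fst ` set l \<inter> snd ` set l = {} \<and>
      (\<forall>(a, b)\<in>set l. {a, b} \<in> E \<and> a \<notin> W \<and> b \<notin> W \<and> real (d a) \<le> ?s)" for l
  have simp: "E \<subseteq> simple_edges V" using E by (rule realizations_simple)
  have finE: "finite E" using finite_subset[OF simp finite_simple_edges[OF fin]] .
  have m0: "m \<ge> 0" by (simp add: m)
  have finP: "finite {x. P (x # xs)}" for xs
    by (rule finite_subset[of _ "V \<times> V"]) (use fin simp in \<open>auto simp: P_def doubleton_simple_iff subset_iff\<close>)
  have touch: "card {e \<in> E. e \<inter> W \<noteq> {}} \<le> sum d W" if "W \<subseteq> V" for W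
    using volume_eq_edge_count[OF fin E that] by simp
  \<comment> \<open>edges without an end of low degree\<close>
  have heavy: "real (card {e \<in> E. e \<subseteq> {v \<in> V. ?s < real (d v)}}) \<le> m / 4"
  proof -
    let ?H = "{v \<in> V. ?s < real (d v)}"
    have "?s * card ?H \<le> (\<Sum>v\<in>?H. real (d v))"
      using sum_bounded_below[of ?H ?s "\<lambda>v. real (d v)"] by (simp add: mult.commute)
    also have "\<dots> \<le> (\<Sum>v\<in>V. real (d v))" using fin by (intro sum_mono2) auto
    also have "\<dots> = 2 * m" using volume_whole[OF fin E] by (simp add: m flip: of_nat_sum)
    finally have "4 * (sqrt m * card ?H) \<le> 2 * (sqrt m * sqrt m)" using m0 by simp
    then have "2 * (sqrt m * card ?H) \<le> sqrt m * sqrt m" by linarith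
    then have "sqrt m * (2 * real (card ?H)) \<le> sqrt m * sqrt m" by (simp only: mult.left_commute)
    then have "2 * real (card ?H) \<le> sqrt m \<or> m = 0"
      using m0 mult_le_cancel_left_pos[of "sqrt m" "2 * real (card ?H)" "sqrt m"] real_sqrt_gt_zero[of m]
      by linarith
    moreover have "card {e \<in> E. e \<subseteq> ?H} \<le> m" using finE by (auto simp: m intro!: card_mono)
    moreover have "real (card ?H) * real (card ?H) \<le> m / 4" if "2 * real (card ?H) \<le> sqrt m"
    proof -
      have "(2 * real (card ?H)) * (2 * real (card ?H)) \<le> sqrt m * sqrt m"
        using that by (intro mult_mono) (auto simp: m0)
      then show ?thesis using m0 by simp
    qed
    moreover have "real (card {e \<in> E. e \<subseteq> ?H}) \<le> real (card ?H) * real (card ?H)"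
      using card_edges_inside_le[of ?H E V] fin simp by (simp flip: of_nat_mult)
    ultimately show ?thesis by force
  qed
  have "m / 2 \<le> real (card {x. P (x # xs)})" if xs: "P xs" "length xs < j" for xs
  proof -
    \<comment> \<open>the edges at these vertices are no longer available\<close>
    define L where "L = {v \<in> fst ` set xs \<union> snd ` set xs. real (d v) \<le> ?s}"
    have finL: "finite L" by (simp add: L_def)
    have LV: "L \<subseteq> V"
      using xs(1) simp by (fastforce simp: L_def P_def doubleton_simple_iff)
    have "card L \<le> card (fst ` set xs \<union> snd ` set xs)" unfolding L_def by (intro card_mono) auto
    also have "\<dots> \<le> card (fst ` set xs) + card (snd ` set xs)" by (rule card_Un_le)
    also have "\<dots> \<le> length xs + length xs" by (meson add_mono card_image_le card_length finite_set le_trans)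
    finally have cL: "real (card L) \<le> 2 * real j" using xs(2) by linarith
    have "(\<Sum>v\<in>L. real (d v)) \<le> card L * ?s"
      using sum_bounded_above[of L "\<lambda>v. real (d v)" ?s] by (auto simp: L_def)
    also have "\<dots> \<le> (2 * real j) * ?s" using cL m0 by (intro mult_right_mono) auto
    finally have volL: "real (sum d L) \<le> 8 * real j * sqrt m" by simp
    let ?A = "{e \<in> E. e \<inter> W \<noteq> {}}" and ?B = "{e \<in> E. e \<subseteq> {v \<in> V. ?s < real (d v)}}"
      and ?C = "{e \<in> E. e \<inter> L \<noteq> {}}"
    have "E - (?A \<union> ?B \<union> ?C) \<subseteq> (\<lambda>(a, b). {a, b}) ` {x. P (x # xs)}"
    proof
      fix e assume e: "e \<in> E - (?A \<union> ?B \<union> ?C)"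
      then have "e \<subseteq> V" using simp by (auto simp: simple_edges_def)
      then obtain a where a: "a \<in> e" "real (d a) \<le> ?s" using e by force
      have "e \<in> simple_edges V" using e simp by auto
      then obtain b where b: "e = {a, b}" "b \<noteq> a" using a(1) by (rule simple_edges_other_end)
      have "a \<notin> fst ` set xs \<union> snd ` set xs" using a e by (auto simp: L_def)
      moreover have "b \<notin> fst ` set xs"
      proof
        assume "b \<in> fst ` set xs"
        then have "b \<in> L" using xs(1) by (auto simp: L_def P_def)
        then show False using e b by auto
      qed
      ultimately have "P ((a, b) # xs)" using xs e a b by (auto simp: P_def)
      then show "e \<in> (\<lambda>(a, b). {a, b}) ` {x. P (x # xs)}" using b by force
    qed
    then have "card (E - (?A \<union> ?B \<union> ?C)) \<le> card {x. P (x # xs)}"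
      using finP by (meson card_image_le card_mono finite_imageI le_trans)
    moreover have "card (E - (?A \<union> ?B \<union> ?C)) = card E - card (?A \<union> ?B \<union> ?C)"
      using finE by (intro card_Diff_subset) auto
    moreover have "card (?A \<union> ?B \<union> ?C) \<le> card ?A + card ?B + card ?C"
      by (meson add_right_mono card_Un_le le_trans)
    moreover have "card ?C \<le> sum d L" "card ?A \<le> sum d W" using touch LV W by auto
    ultimately show ?thesis using heavy volL W(2) size unfolding m by linarith
  qed
  then have "(m / 2) ^ j \<le> real (card {l. length l = j \<and> P l})"
    using greedy_lists[of P "m / 2" j] finP m0 by (auto simp: P_def)
  moreover have "{l. length l = j \<and> P l} = far_lists d W ?s E j" by (auto simp: P_def far_lists_def)
  ultimately show ?thesis by simp
qed

lemma card_ordered_pairs_le: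
  assumes "finite D" "D \<subseteq> simple_edges V"
  shows "finite {(x, a). {x, a} \<in> D} \<and> card {(x, a). {x, a} \<in> D} \<le> 2 * card D"
proof -
  have each: "finite {(x, a). {x, a} = e} \<and> card {(x, a). {x, a} = e} \<le> 2" if "e \<in> D" for e
  proof -
    have "e \<in> simple_edges V" using that assms(2) by auto
    then obtain p q where "e = {p, q}" by (rule simple_edgesE)
    then have sub: "{(x, a). {x, a} = e} \<subseteq> {(p, q), (q, p)}" by (auto simp: doubleton_eq_iff)
    have "card {(x, a). {x, a} = e} \<le> card {(p, q), (q, p)}" using sub by (intro card_mono) auto
    also have "\<dots> \<le> 2" by (rule card_insert_le_m1) auto
    finally show ?thesis using finite_subset[OF sub] by simp
  qed
  have eq: "{(x, a). {x, a} \<in> D} = (\<Union>e\<in>D. {(x, a). {x, a} = e})" by auto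
  have "card (\<Union>e\<in>D. {(x, a). {x, a} = e}) \<le> (\<Sum>e\<in>D. card {(x, a). {x, a} = e})"
    using assms(1) by (rule card_UN_le)
  also have "\<dots> \<le> (\<Sum>e\<in>D. 2)" using each by (intro sum_mono) auto
  finally show ?thesis unfolding eq using assms(1) each by (auto simp: mult.commute)
qed

text \<open>The two halves of a code are chosen independently of each other.\<close>

definition excess_codes ::
    "('a \<Rightarrow> nat) \<Rightarrow> 'a \<Rightarrow> nat \<Rightarrow> real \<Rightarrow> nat \<Rightarrow> 'a set set \<Rightarrow> ('a \<times> 'a \<times> 'a \<times> 'a) list set" where
  "excess_codes d u R s j E =
     {c. map (\<lambda>(x, z, a, b). (x, z)) c \<in> head_lists (excess E u R) j \<and>
         map (\<lambda>(x, z, a, b). (a, b)) c \<in> far_lists d (gball E u (Suc R)) s E j}"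

lemma excess_codes_facts:
  assumes c: "c \<in> excess_codes d u R s j E"
  shows "length c = j"
    and "distinct (map (\<lambda>(x, z, a, b). z) c)"
    and "distinct (map (\<lambda>(x, z, a, b). {x, z}) c)"
    and "distinct (map (\<lambda>(x, z, a, b). a) c)"
    and "\<And>x z a b x' z' a' b'. (x, z, a, b) \<in> set c \<Longrightarrow> (x', z', a', b') \<in> set c \<Longrightarrow> a \<noteq> b'"
    and "\<And>x z a b. (x, z, a, b) \<in> set c \<Longrightarrow> {x, z} \<in> excess E u R \<and> {a, b} \<in> E \<and>
      a \<notin> gball E u (Suc R) \<and> b \<notin> gball E u (Suc R) \<and> x \<in> gball E u R \<and> z \<in> gball E u R"
proof -
  have h: "map (\<lambda>(x, z, a, b). (x, z)) c \<in> head_lists (excess E u R) j"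
    and f: "map (\<lambda>(x, z, a, b). (a, b)) c \<in> far_lists d (gball E u (Suc R)) s E j"
    using c by (auto simp: excess_codes_def)
  show "length c = j" using h by (simp add: head_lists_def)
  show "distinct (map (\<lambda>(x, z, a, b). z) c)" "distinct (map (\<lambda>(x, z, a, b). {x, z}) c)"
    using h by (simp_all add: head_lists_def comp_def case_prod_unfold)
  show "distinct (map (\<lambda>(x, z, a, b). a) c)"
    using f by (simp add: far_lists_def comp_def case_prod_unfold)
  show "a \<noteq> b'" if "(x, z, a, b) \<in> set c" "(x', z', a', b') \<in> set c" for x z a b x' z' a' b'
  proof
    assume "a = b'"
    have "a \<in> fst ` set (map (\<lambda>(x, z, a, b). (a, b)) c)" "b' \<in> snd ` set (map (\<lambda>(x, z, a, b). (a, b)) c)"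
      using that by force+
    moreover have "fst ` set (map (\<lambda>(x, z, a, b). (a, b)) c) \<inter> snd ` set (map (\<lambda>(x, z, a, b). (a, b)) c) = {}"
      using f unfolding far_lists_def mem_Collect_eq by blast
    ultimately show False unfolding \<open>a = b'\<close> by blast
  qed
  show "{x, z} \<in> excess E u R \<and> {a, b} \<in> E \<and> a \<notin> gball E u (Suc R) \<and> b \<notin> gball E u (Suc R) \<and>
      x \<in> gball E u R \<and> z \<in> gball E u R" if q: "(x, z, a, b) \<in> set c" for x z a b
  proof -
    have "{x, z} \<in> excess E u R" using h q by (fastforce simp: head_lists_def)
    moreover have "{a, b} \<in> E \<and> a \<notin> gball E u (Suc R) \<and> b \<notin> gball E u (Suc R)"
      using f q by (fastforce simp: far_lists_def)
    ultimately show ?thesis by (auto simp: excess_def)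
  qed
qed

lemma excess_codes_switchable:
  assumes c: "c \<in> excess_codes d u R s j E"
  shows "switchable E c"
proof (rule switchableI)
  note facts = excess_codes_facts[OF c]
  have in_out: "p \<noteq> q" if "p \<in> gball E u R" "q \<notin> gball E u (Suc R)" for p q
    using that gball_monoD[of p E u R "Suc R"] by auto
  show "distinct (map (\<lambda>(x, z, a, b). {x, z}) c)" by (rule facts(3))
  show "distinct (map (\<lambda>(x, z, a, b). {a, b}) c)"
  proof (rule distinct_map_quads[OF facts(4)])
    fix x z a b x' z' a' b'
    assume q: "(x, z, a, b) \<in> set c" "(x', z', a', b') \<in> set c" "{a, b} = {a', b'}"
    show "a = a'" using facts(5)[OF q(1,2)] q(3) by (auto simp: doubleton_eq_iff)
  qed
  show "distinct (map (\<lambda>(x, z, a, b). {x, a}) c)"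
  proof (rule distinct_map_quads[OF facts(4)])
    fix x z a b x' z' a' b'
    assume q: "(x, z, a, b) \<in> set c" "(x', z', a', b') \<in> set c" "{x, a} = {x', a'}"
    have "x \<noteq> a'" using facts(6)[OF q(1)] facts(6)[OF q(2)] in_out[of x a'] by auto
    then show "a = a'" using q(3) by (auto simp: doubleton_eq_iff)
  qed
  show "distinct (map (\<lambda>(x, z, a, b). {z, b}) c)"
  proof (rule distinct_map_quads[OF facts(2)])
    fix x z a b x' z' a' b'
    assume q: "(x, z, a, b) \<in> set c" "(x', z', a', b') \<in> set c" "{z, b} = {z', b'}"
    have "z \<noteq> b'" using facts(6)[OF q(1)] facts(6)[OF q(2)] in_out[of z b'] by auto
    then show "z = z'" using q(3) by (auto simp: doubleton_eq_iff)
  qed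
  show "{x, z} \<noteq> {a', b'} \<and> {x, a} \<noteq> {z', b'}"
    if q: "(x, z, a, b) \<in> set c" "(x', z', a', b') \<in> set c" for x z a b x' z' a' b'
  proof -
    have "x \<noteq> a'" "x \<noteq> b'" "a \<noteq> z'" "a \<noteq> b'"
      using facts(5)[OF q] facts(6)[OF q(1)] facts(6)[OF q(2)] in_out by metis+
    then show ?thesis by (auto simp: doubleton_eq_iff)
  qed
  show "{x, z} \<in> E \<and> {a, b} \<in> E \<and> {x, a} \<notin> E \<and> {z, b} \<notin> E \<and> x \<noteq> a \<and> z \<noteq> b"
    if q: "(x, z, a, b) \<in> set c" for x z a b
  proof -
    note f = facts(6)[OF q]
    have "{x, z} \<in> E" using f by (auto simp: excess_def)
    moreover have "{x, a} \<notin> E" "{z, b} \<notin> E"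
      using f gball_step[of x E u R a] gball_step[of z E u R b] by auto
    moreover have "x \<noteq> a" "z \<noteq> b" using f in_out by metis+
    ultimately show ?thesis using f by blast
  qed
qed

text \<open>
None of the removed edges is a tree edge of the ball: excess edges are not by definition, and the
other removed edges lie outside the ball. So the ball of the switched graph without the added edges
is the ball of the original graph.\<close>

lemma excess_codes_detachable:
  assumes c: "c \<in> excess_codes d u R s j E"
    and vol: "real (sum d (gball E u (Suc R))) \<le> K"
  shows "detachable d u (Suc R) K (switch E c) (set (added_edges c))"
    and "card (set (added_edges c)) = 2 * j"
proof -
  note facts = excess_codes_facts[OF c]
  have sw: "switchable E c" using excess_codes_switchable[OF c] .
  show "card (set (added_edges c)) = 2 * j"
    using distinct_card[OF switchableD(2)[OF sw]] by (simp add: length_added_edges facts(1))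
  have "{e \<in> bfs_tree E u. e \<subseteq> gball E u (Suc R)} \<subseteq> E - set (removed_edges c)"
  proof
    fix e assume e: "e \<in> {e \<in> bfs_tree E u. e \<subseteq> gball E u (Suc R)}"
    have "e \<notin> set (removed_edges c)"
    proof
      assume "e \<in> set (removed_edges c)"
      then obtain x z a b where q: "(x, z, a, b) \<in> set c" "e = {x, z} \<or> e = {a, b}"
        by (auto simp: set_removed_edges)
      then show False using e facts(6)[OF q(1)] by (auto simp: excess_def)
    qed
    then show "e \<in> E - set (removed_edges c)" using e bfs_tree_subset[of E u] by auto
  qed
  then have ball: "gball (E - set (removed_edges c)) u (Suc R) = gball E u (Suc R)"
    by (rule gball_keep_tree) auto
  have "e \<inter> gball E u (Suc R) \<noteq> {}" if e: "e \<in> set (added_edges c)" for e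
  proof -
    obtain x z a b where q: "(x, z, a, b) \<in> set c" "e = {x, a} \<or> e = {z, b}"
      using e by (auto simp: set_added_edges)
    then show ?thesis
      using facts(6)[OF q(1)] gball_monoD[of x E u R "Suc R"] gball_monoD[of z E u R "Suc R"] by auto
  qed
  then show "detachable d u (Suc R) K (switch E c) (set (added_edges c))"
    using vol ball switch_minus_added[OF sw] by (auto simp: detachable_def switch_def)
qed

text \<open>Zipping the two lists is injective.\<close>

lemma card_excess_codes_ge:
  assumes fin: "finite V" and simp: "E \<subseteq> simple_edges V"
  shows "finite (excess_codes d u R s j E)"
    and "card (head_lists (excess E u R) j) * card (far_lists d (gball E u (Suc R)) s E j)
      \<le> card (excess_codes d u R s j E)"
proof -
  let ?H = "head_lists (excess E u R) j" and ?F = "far_lists d (gball E u (Suc R)) s E j"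
  let ?z = "\<lambda>(l, l'). map (\<lambda>((x, z), (a, b)). (x, z, a, b)) (zip l l')"
  show finC: "finite (excess_codes d u R s j E)"
  proof (rule finite_subset)
    show "excess_codes d u R s j E \<subseteq> {c. set c \<subseteq> V \<times> V \<times> V \<times> V \<and> length c = j}"
    proof
      fix c assume c: "c \<in> excess_codes d u R s j E"
      have "x \<in> V \<and> z \<in> V \<and> a \<in> V \<and> b \<in> V" if "(x, z, a, b) \<in> set c" for x z a b
      proof -
        have "{x, z} \<in> simple_edges V" "{a, b} \<in> simple_edges V"
          using excess_codes_facts(6)[OF c that] simp by (auto simp: excess_def)
        then show ?thesis by (simp add: doubleton_simple_iff)
      qed
      then show "c \<in> {c. set c \<subseteq> V \<times> V \<times> V \<times> V \<and> length c = j}"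
        using excess_codes_facts(1)[OF c] by auto
    qed
    show "finite {c. set c \<subseteq> V \<times> V \<times> V \<times> V \<and> length c = j}"
      using fin by (intro finite_lists_length_eq) simp
  qed
  have proj: "map (\<lambda>(x, z, a, b). (x, z)) (?z (l, l')) = l \<and> map (\<lambda>(x, z, a, b). (a, b)) (?z (l, l')) = l'"
    if "length l = length l'" for l l' :: "('a \<times> 'a) list"
    using that by (induction l l' rule: list_induct2) auto
  have len: "length l = j" "length l' = j" if "l \<in> ?H" "l' \<in> ?F" for l l'
    using that by (auto simp: head_lists_def far_lists_def)
  have "card (?H \<times> ?F) \<le> card (excess_codes d u R s j E)"
  proof (rule card_inj_on_le[OF _ _ finC])
    show "inj_on ?z (?H \<times> ?F)"
    proof (rule inj_on_inverseI)
      fix p assume p: "p \<in> ?H \<times> ?F"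
      obtain l l' where eq: "p = (l, l')" by (cases p)
      then have "length l = length l'" using p len by auto
      from proj[OF this] show "(\<lambda>c. (map (\<lambda>(x, z, a, b). (x, z)) c, map (\<lambda>(x, z, a, b). (a, b)) c)) (?z p) = p"
        by (simp only: eq)
    qed
    show "?z ` (?H \<times> ?F) \<subseteq> excess_codes d u R s j E"
    proof
      fix c assume "c \<in> ?z ` (?H \<times> ?F)"
      then obtain l l' where c: "c = ?z (l, l')" "l \<in> ?H" "l' \<in> ?F" by blast
      then have "length l = length l'" using len by simp
      from proj[OF this] show "c \<in> excess_codes d u R s j E"
        using c unfolding excess_codes_def by (simp only: mem_Collect_eq)
    qed
  qed
  then show "card ?H * card ?F \<le> card (excess_codes d u R s j E)"
    by (simp only: card_cartesian_product)
qed

text \<open>The heart of the growth argument. A graph in \<open>\<Omega>\<close> has at least \<open>A * (m / 2) ^ j\<close> codes. Given the switched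
graph, the set of \<open>2 j\<close> added edges is detachable, which leaves \<open>K ^ (2 * j)\<close> possibilities, and each entry
of the code is made of two of these edges in one of \<open>(4 * j)\<^sup>2\<close> ways.\<close>

lemma excess_switching:
  fixes m K A :: real
  assumes fin: "finite V" and u: "u \<in> V" and \<Omega>: "\<Omega> \<subseteq> realizations V d"
    and m: "real (sum d V) = 2 * m"
    and vol: "\<And>E. E \<in> \<Omega> \<Longrightarrow> real (sum d (gball E u (Suc R))) \<le> K"
    and many: "\<And>E. E \<in> \<Omega> \<Longrightarrow> A \<le> real (card (head_lists (excess E u R) j))"
    and size: "K + m / 4 + 8 * real j * sqrt m \<le> m / 2" and A: "0 \<le> A" and K: "0 \<le> K"
  shows "A * (m / 2) ^ j * card \<Omega> \<le> (16 * (real j)\<^sup>2 * K\<^sup>2) ^ j * card (realizations V d)"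
proof (rule switching_bound[OF fin \<Omega>, where C = "excess_codes d u R (4 * sqrt m) j"])
  let ?C = "excess_codes d u R (4 * sqrt m) j"
  have real: "E \<in> realizations V d" and simp: "E \<subseteq> simple_edges V" if "E \<in> \<Omega>" for E
    using that \<Omega> by (auto simp: realizations_def)
  show "switchable E c" if "E \<in> \<Omega>" "c \<in> ?C E" for E c
    by (rule excess_codes_switchable[OF that(2)])
  show "finite (?C E)" if "E \<in> \<Omega>" for E
    using card_excess_codes_ge(1)[OF fin simp[OF that]] .
  show "A * (m / 2) ^ j \<le> real (card (?C E))" if E: "E \<in> \<Omega>" for E
  proof -
    have mE: "m = card E" using volume_whole[OF fin real[OF E]] m by simp
    have "(m / 2) ^ j \<le> card (far_lists d (gball E u (Suc R)) (4 * sqrt m) E j)"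
      using gball_subset[OF simp[OF E] u] by (intro card_far_lists_ge[OF fin real[OF E] mE _ vol[OF E] size])
    then have "A * (m / 2) ^ j \<le> real (card (head_lists (excess E u R) j)) *
        real (card (far_lists d (gball E u (Suc R)) (4 * sqrt m) E j))"
      using many[OF E] A mE by (intro mult_mono) auto
    also have "\<dots> \<le> real (card (?C E))"
      using card_excess_codes_ge(2)[OF fin simp[OF E], of u R j d "4 * sqrt m"]
      by (simp only: of_nat_mult[symmetric] of_nat_le_iff)
    finally show ?thesis .
  qed
  show "real (card {c. \<exists>E\<in>\<Omega>. c \<in> ?C E \<and> switch E c = E'}) \<le> (16 * (real j)\<^sup>2 * K\<^sup>2) ^ j"
    if E': "E' \<in> realizations V d" for E'
  proof -
    have simpE': "E' \<subseteq> simple_edges V" using E' by (rule realizations_simple)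
    have finE': "finite E'" using finite_subset[OF simpE' finite_simple_edges[OF fin]] .
    let ?D = "{D. card D = 2 * j \<and> detachable d u (Suc R) K E' D}"
    let ?P = "\<lambda>D. {(x, a). {x, a} \<in> D}"
    let ?Q = "\<lambda>D. {(x, z, a, b). {x, a} \<in> D \<and> {z, b} \<in> D}"
    let ?L = "\<lambda>D. {c. set c \<subseteq> ?Q D \<and> length c = j}"
    have finD: "finite ?D"
      by (rule finite_subset[of _ "Pow E'"]) (use finE' in \<open>auto simp: detachable_def\<close>)
    have Q: "finite (?Q D) \<and> real (card (?Q D)) \<le> 16 * (real j)\<^sup>2" if D: "D \<in> ?D" for D
    proof -
      have D': "D \<subseteq> simple_edges V" "finite D" "card D = 2 * j"
        using D simpE' finE' by (auto simp: detachable_def intro: finite_subset)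
      have P: "finite (?P D)" "card (?P D) \<le> 4 * j" using card_ordered_pairs_le[OF D'(2,1)] D'(3) by auto
      have eq: "?Q D = (\<lambda>((x, a), (z, b)). (x, z, a, b)) ` (?P D \<times> ?P D)" by force
      have "card (?Q D) \<le> card (?P D \<times> ?P D)" unfolding eq using P by (intro card_image_le) simp
      also have "\<dots> \<le> (4 * j) * (4 * j)" unfolding card_cartesian_product by (intro mult_le_mono P)
      finally have "real (card (?Q D)) \<le> real ((4 * j) * (4 * j))" by (rule of_nat_mono)
      then show ?thesis using P unfolding eq by (simp add: power2_eq_square)
    qed
    have sub: "{c. \<exists>E\<in>\<Omega>. c \<in> ?C E \<and> switch E c = E'} \<subseteq> (\<Union>D\<in>?D. ?L D)"
    proof
      fix c assume "c \<in> {c. \<exists>E\<in>\<Omega>. c \<in> ?C E \<and> switch E c = E'}"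
      then obtain E where E: "E \<in> \<Omega>" "c \<in> ?C E" "switch E c = E'" by auto
      have "set (added_edges c) \<in> ?D"
        using excess_codes_detachable[OF E(2) vol[OF E(1)]] E(3) by simp
      moreover have "c \<in> ?L (set (added_edges c))"
        using excess_codes_facts(1)[OF E(2)] by (fastforce simp: set_added_edges)
      ultimately show "c \<in> (\<Union>D\<in>?D. ?L D)" by blast
    qed
    have finL: "finite (?L D)" if "D \<in> ?D" for D using Q[OF that] by (intro finite_lists_length_eq) simp
    have "card {c. \<exists>E\<in>\<Omega>. c \<in> ?C E \<and> switch E c = E'} \<le> card (\<Union>D\<in>?D. ?L D)"
      using finD finL by (intro card_mono[OF _ sub]) auto
    also have "\<dots> \<le> (\<Sum>D\<in>?D. card (?L D))" using finD by (rule card_UN_le)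
    finally have "real (card {c. \<exists>E\<in>\<Omega>. c \<in> ?C E \<and> switch E c = E'}) \<le> real (\<Sum>D\<in>?D. card (?L D))"
      by (rule of_nat_mono)
    also have "\<dots> = (\<Sum>D\<in>?D. real (card (?L D)))" by simp
    also have "\<dots> \<le> (\<Sum>D\<in>?D. (16 * (real j)\<^sup>2) ^ j)"
      using Q by (intro sum_mono card_lists_over[OF _ subset_refl]) auto
    also have "\<dots> = real (card ?D) * (16 * (real j)\<^sup>2) ^ j" by simp
    also have "\<dots> \<le> K ^ (2 * j) * (16 * (real j)\<^sup>2) ^ j"
      using realizations_degree[OF E']
      by (intro mult_right_mono card_detachable_le[OF fin simpE' u _ K]) auto
    also have "\<dots> = (16 * (real j)\<^sup>2 * K\<^sup>2) ^ j" 
      unfolding power_mult[of K 2 j] by (simp only: power_mult_distrib mult_ac)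
    finally show ?thesis .
  qed
qed

section \<open>Joining two distant shells\<close>

text \<open>The ball of radius \<open>r - 1\<close>, with the empty set as the ball of radius \<open>-1\<close>: the shell of radius \<open>0\<close>
consists of the edges at \<open>u\<close>.\<close>

primrec inner_ball :: "'a set set \<Rightarrow> 'a \<Rightarrow> nat \<Rightarrow> 'a set" where
  "inner_ball E u 0 = {}"
| "inner_ball E u (Suc r) = gball E u r"

definition shell_edges :: "'a set set \<Rightarrow> 'a \<Rightarrow> nat \<Rightarrow> 'a set set" where
  "shell_edges E u r = {e \<in> E. e \<inter> gball E u r \<noteq> {} \<and> e \<inter> inner_ball E u r = {}}"

lemma inner_ball_subset: "inner_ball E u r \<subseteq> gball E u r"
  by (cases r) (auto intro: gball_monoD)

lemma gball_same:
  assumes "\<And>e. e \<inter> inner_ball E u r \<noteq> {} \<Longrightarrow> e \<in> E' \<longleftrightarrow> e \<in> E"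
  shows "gball E' u r = gball E u r" "inner_ball E' u r = inner_ball E u r"
proof -
  have "gball E' u r = gball E u r \<and> inner_ball E' u r = inner_ball E u r"
  proof (cases r)
    case (Suc t)
    have "gball E' u s = gball E u s" if "s \<le> Suc t" for s
      by (rule gball_local[OF _ that]) (use assms Suc in auto)
    then show ?thesis using Suc by simp
  qed simp
  then show "gball E' u r = gball E u r" "inner_ball E' u r = inner_ball E u r" by auto
qed

lemma shell_edge_ball:
  assumes "{x, z} \<in> shell_edges E u r"
  shows "x \<in> gball E u (Suc r)" "x \<notin> inner_ball E u r"
  using assms gball_step[of z E u r x] gball_monoD[of x E u r "Suc r"]
  by (auto simp: shell_edges_def insert_commute)

text \<open>Here \<open>xz\<close> is an edge of the shell around \<open>u\<close>, with \<open>x\<close> on the sphere, and \<open>ab\<close> is one of the shell around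
\<open>v\<close>, with \<open>a\<close> on the sphere; the added edge \<open>xa\<close> joins the two spheres. It is enough that the edges on
the side of \<open>u\<close> are pairwise disjoint to keep the added edges distinct.\<close>

definition parallel_codes ::
    "'a \<Rightarrow> nat \<Rightarrow> 'a \<Rightarrow> nat \<Rightarrow> nat \<Rightarrow> 'a set set \<Rightarrow> ('a \<times> 'a \<times> 'a \<times> 'a) list set" where
  "parallel_codes u r v r' j E = {c. length c = j \<and>
     (\<forall>(x, z, a, b)\<in>set c. x \<in> gball E u r \<and> {x, z} \<in> shell_edges E u r \<and>
        a \<in> gball E v r' \<and> {a, b} \<in> shell_edges E v r') \<and>
     distinct (map (\<lambda>(x, z, a, b). {x, z}) c) \<and> distinct (map (\<lambda>(x, z, a, b). {a, b}) c) \<and>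
     pairwise disjnt ((\<lambda>(x, z, a, b). {x, z}) ` set c)}"

context
  fixes u :: 'a and r :: nat and v :: 'a and r' j :: nat and E :: "'a set set" and V :: "'a set"
    and c :: "('a \<times> 'a \<times> 'a \<times> 'a) list"
  assumes c: "c \<in> parallel_codes u r v r' j E" and simp: "E \<subseteq> simple_edges V"
    and far: "gball E u (r + 2) \<inter> gball E v (r' + 1) = {}"
begin

lemma parallel_codes_entry:
  assumes "(x, z, a, b) \<in> set c"
  shows "x \<in> gball E u r" "{x, z} \<in> shell_edges E u r" "a \<in> gball E v r'" "{a, b} \<in> shell_edges E v r'"
    "x \<in> gball E u (Suc r)" "z \<in> gball E u (Suc r)" "a \<in> gball E v (Suc r')" "b \<in> gball E v (Suc r')"
    "x \<notin> inner_ball E u r" "z \<notin> inner_ball E u r" "a \<notin> inner_ball E v r'" "b \<notin> inner_ball E v r'"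
    "x \<noteq> z"
proof -
  show *: "x \<in> gball E u r" "{x, z} \<in> shell_edges E u r" "a \<in> gball E v r'" "{a, b} \<in> shell_edges E v r'"
    using c assms by (auto simp: parallel_codes_def)
  show "x \<in> gball E u (Suc r)" "z \<in> gball E u (Suc r)" "x \<notin> inner_ball E u r" "z \<notin> inner_ball E u r"
    using shell_edge_ball[of x z E u r] shell_edge_ball[of z x E u r] *(2) by (auto simp: insert_commute)
  show "a \<in> gball E v (Suc r')" "b \<in> gball E v (Suc r')" "a \<notin> inner_ball E v r'" "b \<notin> inner_ball E v r'"
    using shell_edge_ball[of a b E v r'] shell_edge_ball[of b a E v r'] *(4) by (auto simp: insert_commute)
  show "x \<noteq> z" using *(2) simp doubleton_simple_iff[of x z V] by (auto simp: shell_edges_def)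
qed

lemma parallel_sides_distinct:
  assumes "p \<in> gball E u (Suc r)" "q \<in> gball E v (Suc r')"
  shows "p \<noteq> q" "{p, q} \<notin> E"
  using assms far gball_monoD[of p E u "Suc r" "r + 2"] gball_step[of p E u "Suc r" q] by auto

lemma parallel_edges_meet:
  assumes "(x, z, a, b) \<in> set c" "(x', z', a', b') \<in> set c" "{x, z} \<inter> {x', z'} \<noteq> {}"
  shows "(x, z, a, b) = (x', z', a', b')"
proof -
  have "{x, z} \<in> (\<lambda>(x, z, a, b). {x, z}) ` set c" "{x', z'} \<in> (\<lambda>(x, z, a, b). {x, z}) ` set c"
    using assms by force+
  moreover have "pairwise disjnt ((\<lambda>(x, z, a, b). {x, z}) ` set c)"
    using c by (simp add: parallel_codes_def)
  ultimately have "{x, z} = {x', z'}"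
    using assms(3) pairwiseD[of disjnt _ "{x, z}" "{x', z'}"] unfolding disjnt_def by metis
  moreover have "inj_on (\<lambda>(x, z, a, b). {x, z}) (set c)"
    using c by (auto simp: parallel_codes_def distinct_map)
  ultimately show ?thesis
    using inj_onD[of "\<lambda>(x, z, a, b). {x, z}" "set c" "(x, z, a, b)" "(x', z', a', b')"] assms by simp
qed

lemma parallel_codes_switchable: "switchable E c"
proof (rule switchableI)
  show d1: "distinct (map (\<lambda>(x, z, a, b). {x, z}) c)" and "distinct (map (\<lambda>(x, z, a, b). {a, b}) c)"
    using c by (auto simp: parallel_codes_def)
  show "distinct (map (\<lambda>(x, z, a, b). {x, a}) c)"
  proof (rule distinct_map_quads[OF d1])
    fix x z a b x' z' a' b'
    assume q: "(x, z, a, b) \<in> set c" "(x', z', a', b') \<in> set c" "{x, a} = {x', a'}"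
    have "x \<noteq> a'"
      using parallel_sides_distinct(1) parallel_codes_entry[OF q(1)] parallel_codes_entry[OF q(2)] by blast
    then have "x = x'" using q(3) by (auto simp: doubleton_eq_iff)
    then show "{x, z} = {x', z'}" using parallel_edges_meet[OF q(1,2)] by simp
  qed
  show "distinct (map (\<lambda>(x, z, a, b). {z, b}) c)"
  proof (rule distinct_map_quads[OF d1])
    fix x z a b x' z' a' b'
    assume q: "(x, z, a, b) \<in> set c" "(x', z', a', b') \<in> set c" "{z, b} = {z', b'}"
    have "z \<noteq> b'"
      using parallel_sides_distinct(1) parallel_codes_entry[OF q(1)] parallel_codes_entry[OF q(2)] by blast
    then have "z = z'" using q(3) by (auto simp: doubleton_eq_iff)
    then show "{x, z} = {x', z'}" using parallel_edges_meet[OF q(1,2)] by simp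
  qed
  show "{x, z} \<noteq> {a', b'} \<and> {x, a} \<noteq> {z', b'}"
    if q: "(x, z, a, b) \<in> set c" "(x', z', a', b') \<in> set c" for x z a b x' z' a' b'
  proof -
    note e = parallel_codes_entry[OF q(1)] and e' = parallel_codes_entry[OF q(2)]
    have "x \<noteq> a'" "x \<noteq> b'" using parallel_sides_distinct(1) e e' by blast+
    moreover have "x \<noteq> z'"
    proof
      assume "x = z'"
      then have "(x, z, a, b) = (x', z', a', b')" using parallel_edges_meet[OF q] by blast
      then show False using \<open>x = z'\<close> e(13) by simp
    qed
    ultimately show ?thesis by (auto simp: doubleton_eq_iff)
  qed
  show "{x, z} \<in> E \<and> {a, b} \<in> E \<and> {x, a} \<notin> E \<and> {z, b} \<notin> E \<and> x \<noteq> a \<and> z \<noteq> b"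
    if q: "(x, z, a, b) \<in> set c" for x z a b
    using parallel_codes_entry[OF q] parallel_sides_distinct[of x a] parallel_sides_distinct[of z b]
    by (auto simp: shell_edges_def)
qed

text \<open>No edge of a shell touches the inner ball, so the breadth-first searches from \<open>u\<close> and \<open>v\<close> find the same
spheres as before.\<close>

lemma parallel_codes_same_balls:
  "gball (switch E c) u r = gball E u r" "inner_ball (switch E c) u r = inner_ball E u r"
  "gball (switch E c) v r' = gball E v r'" "inner_ball (switch E c) v r' = inner_ball E v r'"
proof -
  \<comment> \<open>an edge of one shell cannot touch the inner ball of the other one, as the balls are far apart\<close>
  have untouched: "e \<inter> inner_ball E u r = {} \<and> e \<inter> inner_ball E v r' = {}"
    if "e \<in> set (removed_edges c) \<union> set (added_edges c)" for e
  proof -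
    from that obtain x z a b where q: "(x, z, a, b) \<in> set c" "e \<subseteq> {x, z, a, b}"
      by (fastforce simp: set_removed_edges set_added_edges)
    note e = parallel_codes_entry[OF q(1)]
    have "p \<notin> inner_ball E v r'" if "p \<in> gball E u (Suc r)" for p
      using that parallel_sides_distinct(1)[of p p] inner_ball_subset[of E v r']
        gball_monoD[of p E v r' "Suc r'"] by auto
    moreover have "p \<notin> inner_ball E u r" if "p \<in> gball E v (Suc r')" for p
      using that parallel_sides_distinct(1)[of p p] inner_ball_subset[of E u r]
        gball_monoD[of p E u r "Suc r"] by auto
    ultimately show ?thesis using e q(2) by blast
  qed
  have keep: "e \<in> switch E c \<longleftrightarrow> e \<in> E"
    if "e \<inter> inner_ball E u r \<noteq> {} \<or> e \<inter> inner_ball E v r' \<noteq> {}" for e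
    using that untouched[of e] unfolding switch_def by blast
  show "gball (switch E c) u r = gball E u r" "inner_ball (switch E c) u r = inner_ball E u r"
    using keep by (intro gball_same; simp)+
  show "gball (switch E c) v r' = gball E v r'" "inner_ball (switch E c) v r' = inner_ball E v r'"
    using keep by (intro gball_same; simp)+
qed

text \<open>There was no edge between the two spheres, so all such edges of the switched graph have been added.
They may include edges \<open>zb\<close>, whence \<open>2 j\<close> instead of \<open>j\<close>.\<close>

lemma parallel_codes_joining_edges:
  "card {(x, a). x \<in> gball (switch E c) u r \<and> a \<in> gball (switch E c) v r' \<and> {x, a} \<in> switch E c} \<le> 2 * j"
    (is "card ?P \<le> _")
proof -
  have in_added: "{x, a} \<in> set (added_edges c) \<and> x \<in> gball E u (Suc r) \<and> a \<in> gball E v (Suc r')"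
    if "(x, a) \<in> ?P" for x a
  proof -
    have xa: "x \<in> gball E u (Suc r)" "a \<in> gball E v (Suc r')" "{x, a} \<in> switch E c"
      using that gball_monoD[of x E u r "Suc r"] gball_monoD[of a E v r' "Suc r'"]
      by (auto simp: parallel_codes_same_balls)
    then show ?thesis using parallel_sides_distinct(2)[OF xa(1,2)] by (auto simp: switch_def)
  qed
  have "inj_on (\<lambda>(x, a). {x, a}) ?P"
  proof (rule inj_onI)
    fix p q assume pq: "p \<in> ?P" "q \<in> ?P" "(\<lambda>(x, a). {x, a}) p = (\<lambda>(x, a). {x, a}) q"
    obtain x a x' a' where eq: "p = (x, a)" "q = (x', a')" by (cases p; cases q)
    then have "{x, a} = {x', a'}" "x \<noteq> a'"
      using pq in_added[of x a] in_added[of x' a'] parallel_sides_distinct(1)[of x a'] by auto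
    then show "p = q" by (auto simp: eq doubleton_eq_iff)
  qed
  then have "card ?P \<le> card (set (added_edges c))"
    using in_added by (intro card_inj_on_le[of "\<lambda>(x, a). {x, a}"]) auto
  also have "\<dots> \<le> 2 * j" using card_length[of "added_edges c"] c
    by (simp add: length_added_edges parallel_codes_def)
  finally show ?thesis .
qed

end

lemma card_edge_pairs_le:
  fixes S :: "('a \<times> 'b \<times> 'c \<times> 'd) set"
  assumes "finite S" "X \<times> Y \<subseteq> (\<lambda>(x, z, a, b). (f x z, g a b)) ` S"
  shows "card X * card Y \<le> card S"
proof -
  have "card (X \<times> Y) \<le> card ((\<lambda>(x, z, a, b). (f x z, g a b)) ` S)"
    using assms by (intro card_mono) auto
  also have "\<dots> \<le> card S" using assms(1) by (rule card_image_le)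
  finally show ?thesis by (simp add: card_cartesian_product)
qed

lemma shell_edge_orient:
  assumes "e \<in> shell_edges E u r" "E \<subseteq> simple_edges V"
  obtains x z where "e = {x, z}" "x \<in> gball E u r"
proof -
  obtain x where x: "x \<in> e" "x \<in> gball E u r" using assms(1) by (auto simp: shell_edges_def)
  have "e \<in> simple_edges V" using assms by (auto simp: shell_edges_def)
  then obtain z where "e = {x, z}" using x(1) by (rule simple_edges_other_end)
  then show ?thesis using that x by blast
qed

lemma card_minus_small_image:
  fixes A :: real
  assumes "finite X" "A \<le> real (card X)" "length xs \<le> j" "2 * real j \<le> A"
  shows "A / 2 \<le> real (card (X - f ` set xs))"
proof -
  have "card (f ` set xs) \<le> j" using card_image_le[of "set xs" f] card_length[of xs] assms(3) by simp
  moreover have "card X - card (f ` set xs) \<le> card (X - f ` set xs)" by (rule diff_card_le_card_Diff) simp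
  ultimately show ?thesis using assms(2,4) by linarith
qed

lemma card_parallel_codes_ge:
  fixes A B :: real
  assumes fin: "finite V" and simp: "E \<subseteq> simple_edges V"
    and M: "M \<subseteq> shell_edges E u r" "pairwise disjnt M" "A \<le> real (card M)" "2 * real j \<le> A"
    and B: "B \<le> real (card (shell_edges E v r'))" "2 * real j \<le> B"
  shows "finite (parallel_codes u r v r' j E)"
    and "((A / 2) * (B / 2)) ^ j \<le> real (card (parallel_codes u r v r' j E))"
proof -
  let ?S = "shell_edges E v r'"
  have finE: "finite E" using finite_subset[OF simp finite_simple_edges[OF fin]] .
  have finS: "finite ?S" "finite M"
    using finE finite_subset[OF M(1)] by (auto simp: shell_edges_def)
  have entry: "(x, z, a, b) \<in> V \<times> V \<times> V \<times> V"
    if "{x, z} \<in> shell_edges E u r" "{a, b} \<in> shell_edges E v r'" for x z a b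
    using that simp doubleton_simple_iff[of x z V] doubleton_simple_iff[of a b V]
    by (auto simp: shell_edges_def)
  show finC: "finite (parallel_codes u r v r' j E)"
  proof (rule finite_subset)
    show "parallel_codes u r v r' j E \<subseteq> {c. set c \<subseteq> V \<times> V \<times> V \<times> V \<and> length c = j}"
      using entry unfolding parallel_codes_def by fast
    show "finite {c. set c \<subseteq> V \<times> V \<times> V \<times> V \<and> length c = j}"
      using fin by (intro finite_lists_length_eq) simp
  qed
  define P where "P c \<longleftrightarrow>
     (\<forall>(x, z, a, b)\<in>set c. x \<in> gball E u r \<and> {x, z} \<in> M \<and> a \<in> gball E v r' \<and> {a, b} \<in> ?S) \<and>
     distinct (map (\<lambda>(x, z, a, b). {x, z}) c) \<and> distinct (map (\<lambda>(x, z, a, b). {a, b}) c)" for c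
  have finP: "finite {x. P (x # xs)}" for xs
    by (rule finite_subset[of _ "V \<times> V \<times> V \<times> V"]) (use fin M(1) entry in \<open>auto simp: P_def\<close>)
  have "(A / 2) * (B / 2) \<le> real (card {x. P (x # xs)})" if xs: "P xs" "length xs < j" for xs
  proof -
    let ?X = "M - (\<lambda>(x, z, a, b). {x, z}) ` set xs" and ?Y = "?S - (\<lambda>(x, z, a, b). {a, b}) ` set xs"
    have "?X \<times> ?Y \<subseteq> (\<lambda>(x, z, a, b). ({x, z}, {a, b})) ` {x. P (x # xs)}"
    proof
      fix p assume "p \<in> ?X \<times> ?Y"
      then obtain e f where p: "p = (e, f)" "e \<in> ?X" "f \<in> ?Y" by auto
      then have "e \<in> shell_edges E u r" "f \<in> ?S" using M(1) by auto
      then obtain x z a b where ef: "e = {x, z}" "x \<in> gball E u r" "f = {a, b}" "a \<in> gball E v r'"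
        using simp by (metis shell_edge_orient)
      then have "P ((x, z, a, b) # xs)" using xs p by (auto simp: P_def)
      then show "p \<in> (\<lambda>(x, z, a, b). ({x, z}, {a, b})) ` {x. P (x # xs)}"
        using p(1) ef by (intro image_eqI[of _ _ "(x, z, a, b)"]) auto
    qed
    from card_edge_pairs_le[OF finP this] have "card ?X * card ?Y \<le> card {x. P (x # xs)}" .
    then have "real (card ?X) * real (card ?Y) \<le> card {x. P (x # xs)}"
      by (simp only: of_nat_mult[symmetric] of_nat_le_iff)
    moreover have "A / 2 \<le> real (card ?X)"
      by (rule card_minus_small_image[OF finS(2) M(3) _ M(4)]) (use xs(2) in simp)
    moreover have "B / 2 \<le> real (card ?Y)"
      by (rule card_minus_small_image[OF finS(1) B(1) _ B(2)]) (use xs(2) in simp)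
    moreover have "0 \<le> A" "0 \<le> B" using M(4) B(2) of_nat_0_le_iff[of j] by linarith+
    ultimately show ?thesis using mult_mono[of "A / 2" "real (card ?X)" "B / 2" "real (card ?Y)"] by simp
  qed
  moreover have "0 \<le> A" "0 \<le> B" using M(4) B(2) of_nat_0_le_iff[of j] by linarith+
  ultimately have "((A / 2) * (B / 2)) ^ j \<le> real (card {c. length c = j \<and> P c})"
    using greedy_lists[of P "(A / 2) * (B / 2)" j] finP by (auto simp: P_def)
  also have "\<dots> \<le> real (card (parallel_codes u r v r' j E))"
  proof (intro of_nat_mono card_mono[OF finC] subsetI)
    fix c assume c: "c \<in> {c. length c = j \<and> P c}"
    then have "(\<lambda>(x, z, a, b). {x, z}) ` set c \<subseteq> M" by (auto simp: P_def)
    then have "pairwise disjnt ((\<lambda>(x, z, a, b). {x, z}) ` set c)" using M(2) by (rule pairwise_subset[rotated])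
    then show "c \<in> parallel_codes u r v r' j E"
      using c M(1) unfolding parallel_codes_def P_def by fast
  qed
  finally show "((A / 2) * (B / 2)) ^ j \<le> real (card (parallel_codes u r v r' j E))" .
qed

text \<open>A graph has about \<open>A * B\<close> choices for an entry of a code. In the switched graph \<open>xa\<close> is one of at most \<open>2 j\<close>
edges between the spheres, while \<open>zb\<close> can be any edge with any orientation.\<close>

lemma parallel_switching:
  fixes m A B :: real
  assumes fin: "finite V" and \<Omega>: "\<Omega> \<subseteq> realizations V d" and m: "real (sum d V) = 2 * m"
    and far: "\<And>E. E \<in> \<Omega> \<Longrightarrow> gball E u (r + 2) \<inter> gball E v (r' + 1) = {}"
    and match: "\<And>E. E \<in> \<Omega> \<Longrightarrow> \<exists>M\<subseteq>shell_edges E u r. pairwise disjnt M \<and> A \<le> real (card M)"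
    and many: "\<And>E. E \<in> \<Omega> \<Longrightarrow> B \<le> real (card (shell_edges E v r'))"
    and size: "2 * real j \<le> A" "2 * real j \<le> B"
  shows "((A / 2) * (B / 2)) ^ j * card \<Omega> \<le> (4 * real j * m) ^ j * card (realizations V d)"
proof (rule switching_bound[OF fin \<Omega>, where C = "parallel_codes u r v r' j"])
  let ?C = "parallel_codes u r v r' j"
  have simp: "E \<subseteq> simple_edges V" if "E \<in> \<Omega>" for E
    using that \<Omega> by (auto simp: realizations_def)
  show "switchable E c" if "E \<in> \<Omega>" "c \<in> ?C E" for E c
    by (rule parallel_codes_switchable[OF that(2) simp[OF that(1)] far[OF that(1)]])
  show "finite (?C E)" "((A / 2) * (B / 2)) ^ j \<le> real (card (?C E))" if "E \<in> \<Omega>" for E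
    using match[OF that] card_parallel_codes_ge[OF fin simp[OF that] _ _ _ size(1) many[OF that] size(2)]
    by blast+
  show "real (card {c. \<exists>E\<in>\<Omega>. c \<in> ?C E \<and> switch E c = E'}) \<le> (4 * real j * m) ^ j"
    if E': "E' \<in> realizations V d" for E'
  proof (cases "{c. \<exists>E\<in>\<Omega>. c \<in> ?C E \<and> switch E c = E'} = {}")
    case True
    have "0 \<le> m" using m of_nat_0_le_iff[of "sum d V"] by linarith
    then show ?thesis unfolding True by simp
  next
    case False
    have simpE': "E' \<subseteq> simple_edges V" using E' by (rule realizations_simple)
    have finE': "finite E'" using finite_subset[OF simpE' finite_simple_edges[OF fin]] .
    let ?P = "{(x, a). x \<in> gball E' u r \<and> a \<in> gball E' v r' \<and> {x, a} \<in> E'}" and ?R = "{(z, b). {z, b} \<in> E'}"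
    let ?Q = "(\<lambda>((x, a), (z, b)). (x, z, a, b)) ` (?P \<times> ?R)"
    obtain c0 E0 where "E0 \<in> \<Omega>" "c0 \<in> ?C E0" "switch E0 c0 = E'" using False by auto
    then have P: "card ?P \<le> 2 * j"
      using parallel_codes_joining_edges[of c0 u r v r' j E0 V] simp far by blast
    have R: "finite ?R" "card ?R \<le> 2 * card E'" using card_ordered_pairs_le[OF finE' simpE'] by auto
    have finP: "finite ?P" by (rule finite_subset[OF _ R(1)]) auto
    have "card ?Q \<le> card (?P \<times> ?R)" using finP R(1) by (intro card_image_le) simp
    also have "\<dots> \<le> (2 * j) * (2 * card E')" unfolding card_cartesian_product by (intro mult_le_mono P R)
    finally have "real (card ?Q) \<le> real ((2 * j) * (2 * card E'))" by (rule of_nat_mono)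
    also have "\<dots> = 4 * real j * m" using volume_whole[OF fin E'] m by simp
    finally have Q: "real (card ?Q) \<le> 4 * real j * m" .
    show ?thesis
    proof (rule card_lists_over[OF _ _ Q])
      show "finite ?Q" using finP R(1) by simp
      show "{c. \<exists>E\<in>\<Omega>. c \<in> ?C E \<and> switch E c = E'} \<subseteq> {xs. set xs \<subseteq> ?Q \<and> length xs = j}"
      proof
        fix c assume "c \<in> {c. \<exists>E\<in>\<Omega>. c \<in> ?C E \<and> switch E c = E'}"
        then obtain E where E: "E \<in> \<Omega>" "c \<in> ?C E" "switch E c = E'" by auto
        have "(x, z, a, b) \<in> ?Q" if q: "(x, z, a, b) \<in> set c" for x z a b
        proof -
          have "{x, a} \<in> set (added_edges c)" "{z, b} \<in> set (added_edges c)"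
            using q by (auto simp: set_added_edges)
          then have "{x, a} \<in> E'" "{z, b} \<in> E'" using E(3) by (auto simp: switch_def)
          moreover have "x \<in> gball E' u r" "a \<in> gball E' v r'"
            using parallel_codes_entry[OF E(2) simp[OF E(1)] far[OF E(1)] q]
              parallel_codes_same_balls[OF E(2) simp[OF E(1)] far[OF E(1)]] E(3) by auto
          ultimately show ?thesis by force
        qed
        then show "c \<in> {xs. set xs \<subseteq> ?Q \<and> length xs = j}" using E(2) by (auto simp: parallel_codes_def)
      qed
    qed
  qed
qed

section \<open>Joining two distant hubs\<close>

definition common_nbrs :: "'a set set \<Rightarrow> 'a \<Rightarrow> 'a \<Rightarrow> 'a set" where
  "common_nbrs E w q = {l. {w, l} \<in> E \<and> {q, l} \<in> E}"

text \<open>Common neighbours \<open>z\<close> of \<open>w\<close> and \<open>q\<close> and common neighbours \<open>a\<close> of \<open>w'\<close> and \<open>q'\<close> are exchanged: \<open>qz\<close> and \<open>aq'\<close>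
become \<open>qa\<close> and \<open>zq'\<close>, while \<open>z\<close> stays adjacent to \<open>w\<close> and \<open>a\<close> to \<open>w'\<close>.\<close>

definition cross_codes ::
    "'a \<Rightarrow> 'a \<Rightarrow> 'a \<Rightarrow> 'a \<Rightarrow> nat \<Rightarrow> 'a set set \<Rightarrow> ('a \<times> 'a \<times> 'a \<times> 'a) list set" where
  "cross_codes w q w' q' j E = {c. length c = j \<and>
     (\<forall>(x, z, a, b)\<in>set c. x = q \<and> z \<in> common_nbrs E w q \<and> a \<in> common_nbrs E w' q' \<and> b = q') \<and>
     distinct (map (\<lambda>(x, z, a, b). z) c) \<and> distinct (map (\<lambda>(x, z, a, b). a) c)}"

context
  fixes w q w' q' :: 'a and j :: nat and E :: "'a set set" and V :: "'a set"
    and c :: "('a \<times> 'a \<times> 'a \<times> 'a) list"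
  assumes c: "c \<in> cross_codes w q w' q' j E" and simp: "E \<subseteq> simple_edges V"
    and apart: "\<And>p p'. p \<in> gball E w 2 \<Longrightarrow> p' \<in> gball E w' 2 \<Longrightarrow> p \<noteq> p' \<and> {p, p'} \<notin> E"
    and wq: "w \<noteq> q" "w' \<noteq> q'" and qw: "q \<in> gball E w 2" "q' \<in> gball E w' 2"
begin

lemma cross_codes_entry:
  assumes "(x, z, a, b) \<in> set c"
  shows "x = q" "b = q'" "{w, z} \<in> E" "{q, z} \<in> E" "{w', a} \<in> E" "{q', a} \<in> E"
    "z \<in> gball E w 1" "a \<in> gball E w' 1"
    "w \<noteq> z" "q \<noteq> z" "w' \<noteq> a" "q' \<noteq> a"
proof -
  show *: "x = q" "b = q'" "{w, z} \<in> E" "{q, z} \<in> E" "{w', a} \<in> E" "{q', a} \<in> E"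
    using assms c by (auto simp: cross_codes_def common_nbrs_def)
  show 1: "z \<in> gball E w 1" "a \<in> gball E w' 1"
    using *(3,5) gball_step[of w E w 0 z] gball_step[of w' E w' 0 a] by auto
  show "w \<noteq> z" "q \<noteq> z" "w' \<noteq> a" "q' \<noteq> a"
    using subsetD[OF simp *(3)] subsetD[OF simp *(4)] subsetD[OF simp *(5)] subsetD[OF simp *(6)]
    by (simp_all add: doubleton_simple_iff)
qed

lemma cross_sides_distinct:
  assumes "p \<in> gball E w 2" "p' \<in> gball E w' 2"
  shows "p \<noteq> p'" "{p, p'} \<notin> E"
  using apart[OF assms] by auto

lemma cross_codes_switchable: "switchable E c"
proof (rule switchableI)
  have d: "distinct (map (\<lambda>(x, z, a, b). z) c)" "distinct (map (\<lambda>(x, z, a, b). a) c)"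
    using c by (auto simp: cross_codes_def)
  have near: "z \<in> gball E w 2 \<and> x \<in> gball E w 2 \<and> a \<in> gball E w' 2 \<and> b \<in> gball E w' 2"
    if "(x, z, a, b) \<in> set c" for x z a b
    using cross_codes_entry[OF that] qw gball_monoD[of z E w 1 2] gball_monoD[of a E w' 1 2] by auto
  have ne: "x = q" "b = q'" "q \<noteq> z" "q \<noteq> a" "q' \<noteq> z" "q' \<noteq> a" if "(x, z, a, b) \<in> set c" for x z a b
    using cross_codes_entry[OF that] near[OF that] qw cross_sides_distinct(1)[of q a]
      cross_sides_distinct(1)[of z q'] by auto
  show "distinct (map (\<lambda>(x, z, a, b). {x, z}) c)"
  proof (rule distinct_map_quads[OF d(1)])
    fix x z a b x' z' a' b'
    assume p: "(x, z, a, b) \<in> set c" "(x', z', a', b') \<in> set c" "{x, z} = {x', z'}"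
    have "x \<noteq> z" "x' \<noteq> z'" "x = x'" using ne[OF p(1)] ne[OF p(2)] by auto
    then show "z = z'" using p(3) by (auto simp: doubleton_eq_iff)
  qed
  show "distinct (map (\<lambda>(x, z, a, b). {a, b}) c)"
  proof (rule distinct_map_quads[OF d(2)])
    fix x z a b x' z' a' b'
    assume p: "(x, z, a, b) \<in> set c" "(x', z', a', b') \<in> set c" "{a, b} = {a', b'}"
    have "a \<noteq> b" "a' \<noteq> b'" "b = b'" using ne[OF p(1)] ne[OF p(2)] by auto
    then show "a = a'" using p(3) by (auto simp: doubleton_eq_iff)
  qed
  show "distinct (map (\<lambda>(x, z, a, b). {x, a}) c)"
  proof (rule distinct_map_quads[OF d(2)])
    fix x z a b x' z' a' b'
    assume p: "(x, z, a, b) \<in> set c" "(x', z', a', b') \<in> set c" "{x, a} = {x', a'}"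
    have "x \<noteq> a" "x' \<noteq> a'" "x = x'" using ne[OF p(1)] ne[OF p(2)] by auto
    then show "a = a'" using p(3) by (auto simp: doubleton_eq_iff)
  qed
  show "distinct (map (\<lambda>(x, z, a, b). {z, b}) c)"
  proof (rule distinct_map_quads[OF d(1)])
    fix x z a b x' z' a' b'
    assume p: "(x, z, a, b) \<in> set c" "(x', z', a', b') \<in> set c" "{z, b} = {z', b'}"
    have "z \<noteq> b" "z' \<noteq> b'" "b = b'" using ne[OF p(1)] ne[OF p(2)] by auto
    then show "z = z'" using p(3) by (auto simp: doubleton_eq_iff)
  qed
  show "{x, z} \<noteq> {a', b'} \<and> {x, a} \<noteq> {z', b'}"
    if p: "(x, z, a, b) \<in> set c" "(x', z', a', b') \<in> set c" for x z a b x' z' a' b'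
  proof -
    have "x \<noteq> a'" "x \<noteq> b'" using near[OF p(1)] near[OF p(2)] cross_sides_distinct(1) by metis+
    moreover have "x \<noteq> z'" using cross_codes_entry[OF p(1)] cross_codes_entry[OF p(2)] by auto
    ultimately show ?thesis by (auto simp: doubleton_eq_iff)
  qed
  show "{x, z} \<in> E \<and> {a, b} \<in> E \<and> {x, a} \<notin> E \<and> {z, b} \<notin> E \<and> x \<noteq> a \<and> z \<noteq> b"
    if p: "(x, z, a, b) \<in> set c" for x z a b
    using cross_codes_entry[OF p] near[OF p] cross_sides_distinct[of x a] cross_sides_distinct[of z b]
    by (auto simp: insert_commute)
qed

text \<open>The vertices \<open>w\<close> and \<open>q'\<close> had no common neighbour, so the common neighbours in the switched graph reveal
the first half of the code.\<close>

lemma cross_codes_common_nbrs: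
  "common_nbrs (switch E c) w q' \<subseteq> (\<lambda>(x, z, a, b). z) ` set c"
proof -
  have added: "\<exists>z a. (q, z, a, q') \<in> set c \<and> (e = {q, a} \<or> e = {z, q'})" if "e \<in> set (added_edges c)" for e
    using that cross_codes_entry(1,2) by (fastforce simp: set_added_edges)
  show "common_nbrs (switch E c) w q' \<subseteq> (\<lambda>(x, z, a, b). z) ` set c"
  proof
    fix l assume "l \<in> common_nbrs (switch E c) w q'"
    then have l: "{w, l} \<in> switch E c" "{q', l} \<in> switch E c" by (auto simp: common_nbrs_def)
    have ww: "w \<in> gball E w 2" by (rule gball_self)
    have "{w, l} \<notin> set (added_edges c)"
    proof
      assume "{w, l} \<in> set (added_edges c)"
      then obtain z a where za: "(q, z, a, q') \<in> set c" "{w, l} = {q, a} \<or> {w, l} = {z, q'}"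
        using added by blast
      note e = cross_codes_entry[OF za(1)]
      have "w \<noteq> a" "w \<noteq> q'"
        using cross_sides_distinct(1)[OF ww] e qw gball_monoD[of a E w' 1 2] by auto
      then show False using za(2) e wq by (auto simp: doubleton_eq_iff)
    qed
    then have "{w, l} \<in> E" using l(1) by (auto simp: switch_def)
    then have l1: "l \<in> gball E w 1" using gball_step[of w E w 0 l] by auto
    show "l \<in> (\<lambda>(x, z, a, b). z) ` set c"
    proof (cases "{q', l} \<in> set (added_edges c)")
      case True
      then obtain z a where za: "(q, z, a, q') \<in> set c" "{q', l} = {q, a} \<or> {q', l} = {z, q'}"
        using added by blast
      note e = cross_codes_entry[OF za(1)]
      have "q \<noteq> q'" using cross_sides_distinct(1)[OF qw] .
      then have "l = z" using za(2) e by (auto simp: doubleton_eq_iff)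
      then show ?thesis using za(1) by force
    next
      case False
      then have "{l, q'} \<in> E" using l(2) by (auto simp: switch_def insert_commute)
      then show ?thesis
        using cross_sides_distinct(2)[of l q'] gball_monoD[OF l1, of 2] qw by auto
    qed
  qed
qed

end

text \<open>Exchanging the roles of the two sides gives the second half of the code.\<close>

lemma cross_codes_swap:
  assumes "c \<in> cross_codes w q w' q' j E"
  shows "map (\<lambda>(x, z, a, b). (b, a, z, x)) c \<in> cross_codes w' q' w q j E"
    and "switch E (map (\<lambda>(x, z, a, b). (b, a, z, x)) c) = switch E c"
proof -
  show "map (\<lambda>(x, z, a, b). (b, a, z, x)) c \<in> cross_codes w' q' w q j E"
    using assms by (auto simp: cross_codes_def comp_def case_prod_unfold)
  have "set (removed_edges (map (\<lambda>(x, z, a, b). (b, a, z, x)) c)) = set (removed_edges c)"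
    and "set (added_edges (map (\<lambda>(x, z, a, b). (b, a, z, x)) c)) = set (added_edges c)"
    by (simp_all add: set_removed_edges set_added_edges case_prod_unfold insert_commute)
  then show "switch E (map (\<lambda>(x, z, a, b). (b, a, z, x)) c) = switch E c"
    by (simp add: switch_def)
qed

text \<open>Both halves of the code can be read off the switched graph up to order, so the only loss is a constant
that depends on \<open>j\<close>.\<close>

lemma cross_switching:
  fixes A :: real
  assumes fin: "finite V" and \<Omega>: "\<Omega> \<subseteq> realizations V d"
    and far: "\<And>E. E \<in> \<Omega> \<Longrightarrow> gball E w 3 \<inter> gball E w' 2 = {}"
    and wq: "w \<noteq> q" "w' \<noteq> q'"
    and many: "\<And>E. E \<in> \<Omega> \<Longrightarrow> A \<le> real (card (common_nbrs E w q))"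
      "\<And>E. E \<in> \<Omega> \<Longrightarrow> A \<le> real (card (common_nbrs E w' q'))"
    and size: "2 * real j \<le> A" "0 < A"
  shows "((A / 2) * (A / 2)) ^ j * card \<Omega> \<le> ((real j)\<^sup>2) ^ j * card (realizations V d)"
proof (rule switching_bound[OF fin \<Omega>, where C = "cross_codes w q w' q' j"])
  let ?C = "cross_codes w q w' q' j"
  have simp: "E \<subseteq> simple_edges V" if "E \<in> \<Omega>" for E
    using that \<Omega> by (auto simp: realizations_def)
  have nbr: "q \<in> gball E w 2" if "A \<le> real (card (common_nbrs E w q))" for E w q
  proof -
    have "common_nbrs E w q \<noteq> {}" using that size(2) by auto
    then obtain l where "{w, l} \<in> E" "{l, q} \<in> E" by (auto simp: common_nbrs_def insert_commute)
    then show ?thesis using gball_step[of w E w 0 l] gball_step[of l E w "Suc 0" q]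
      by (auto simp: numeral_2_eq_2)
  qed
  have apart: "p \<noteq> p' \<and> {p, p'} \<notin> E" if "E \<in> \<Omega>" "p \<in> gball E w 2" "p' \<in> gball E w' 2" for E p p'
    using far[OF that(1)] that gball_monoD[of p E w 2 3] gball_step[of p E w 2 p']
    by (auto simp: numeral_3_eq_3)
  have apart': "p \<noteq> p' \<and> {p, p'} \<notin> E" if "E \<in> \<Omega>" "p \<in> gball E w' 2" "p' \<in> gball E w 2" for E p p'
    using apart[OF that(1,3,2)] by (auto simp: insert_commute)
  show "switchable E c" if "E \<in> \<Omega>" "c \<in> ?C E" for E c
    by (rule cross_codes_switchable[OF that(2) simp apart wq nbr nbr])
      (use that many in auto)
  have finN: "finite (common_nbrs E x y)" if "E \<subseteq> simple_edges V" for E x y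
    by (rule finite_subset[OF _ fin]) (use that in \<open>auto simp: common_nbrs_def doubleton_simple_iff subset_iff\<close>)
  define P where "P E c \<longleftrightarrow>
     (\<forall>(x, z, a, b)\<in>set c. x = q \<and> z \<in> common_nbrs E w q \<and> a \<in> common_nbrs E w' q' \<and> b = q') \<and>
     distinct (map (\<lambda>(x, z, a, b). z) c) \<and> distinct (map (\<lambda>(x, z, a, b). a) c)" for E c
  have C_eq: "?C E = {c. length c = j \<and> P E c}" for E by (auto simp: cross_codes_def P_def)
  have "finite {c. length c = j \<and> P E c} \<and> ((A / 2) * (A / 2)) ^ j \<le> card {c. length c = j \<and> P E c}"
    if E: "E \<in> \<Omega>" for E
  proof (rule greedy_lists)
    show fin1: "finite {x. P E (x # xs)}" for xs
      by (rule finite_subset[of _ "{q} \<times> common_nbrs E w q \<times> common_nbrs E w' q' \<times> {q'}"])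
        (use finN[OF simp[OF E]] in \<open>auto simp: P_def\<close>)
    show "A / 2 * (A / 2) \<le> real (card {x. P E (x # xs)})" if xs: "P E xs" "length xs < j" for xs
    proof -
      let ?X = "common_nbrs E w q - (\<lambda>(x, z, a, b). z) ` set xs"
        and ?Y = "common_nbrs E w' q' - (\<lambda>(x, z, a, b). a) ` set xs"
      have "?X \<times> ?Y \<subseteq> (\<lambda>(x, z, a, b). (z, a)) ` {x. P E (x # xs)}"
      proof
        fix p assume "p \<in> ?X \<times> ?Y"
        then obtain z a where p: "p = (z, a)" "z \<in> ?X" "a \<in> ?Y" by auto
        then have "P E ((q, z, a, q') # xs)" using xs by (auto simp: P_def)
        then show "p \<in> (\<lambda>(x, z, a, b). (z, a)) ` {x. P E (x # xs)}"
          using p(1) by (intro image_eqI[of _ _ "(q, z, a, q')"]) auto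
      qed
      from card_edge_pairs_le[OF fin1 this] have "card ?X * card ?Y \<le> card {x. P E (x # xs)}" .
      then have "real (card ?X) * real (card ?Y) \<le> card {x. P E (x # xs)}"
        by (simp only: of_nat_mult[symmetric] of_nat_le_iff)
      moreover have "A / 2 \<le> real (card ?X)"
        by (rule card_minus_small_image[OF finN[OF simp[OF E]] many(1)[OF E] _ size(1)]) (use xs(2) in simp)
      moreover have "A / 2 \<le> real (card ?Y)"
        by (rule card_minus_small_image[OF finN[OF simp[OF E]] many(2)[OF E] _ size(1)]) (use xs(2) in simp)
      ultimately show ?thesis using size(2) mult_mono[of "A / 2" "real (card ?X)" "A / 2" "real (card ?Y)"] by simp
    qed
  qed (auto simp: P_def)
  then show "finite (?C E)" "((A / 2) * (A / 2)) ^ j \<le> real (card (?C E))" if "E \<in> \<Omega>" for E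
    using that unfolding C_eq by blast+
  show "real (card {c. \<exists>E\<in>\<Omega>. c \<in> ?C E \<and> switch E c = E'}) \<le> ((real j)\<^sup>2) ^ j"
    if E': "E' \<in> realizations V d" for E'
  proof (cases "{c. \<exists>E\<in>\<Omega>. c \<in> ?C E \<and> switch E c = E'} = {}")
    case True
    then show ?thesis unfolding True by simp
  next
    case False
    let ?X = "common_nbrs E' w q'" and ?Y = "common_nbrs E' w' q"
    let ?Q = "{q} \<times> ?X \<times> ?Y \<times> {q'}"
    have simpE': "E' \<subseteq> simple_edges V" using E' by (rule realizations_simple)
    obtain c E where E: "E \<in> \<Omega>" and c: "c \<in> ?C E" and sw: "switch E c = E'" using False by auto
    let ?c = "map (\<lambda>(x, z, a, b). (b, a, z, x)) c"
    have len: "length c = j" using c by (simp add: cross_codes_def)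
    have "?X \<subseteq> (\<lambda>(x, z, a, b). z) ` set c"
      using cross_codes_common_nbrs[OF c simp[OF E] apart[OF E] wq nbr nbr] many[OF E] sw by auto
    from surj_card_le[OF _ this] have X: "card ?X \<le> j" using card_length[of c] len by simp
    have "?Y \<subseteq> (\<lambda>(x, z, a, b). z) ` set ?c"
      using cross_codes_common_nbrs[OF cross_codes_swap(1)[OF c] simp[OF E] apart'[OF E] wq(2,1) nbr nbr]
        many[OF E] sw cross_codes_swap(2)[OF c] by auto
    from surj_card_le[OF _ this] have Y: "card ?Y \<le> j" using card_length[of ?c] len by simp
    have "card ?Q = card ?X * card ?Y" by (simp add: card_cartesian_product)
    also have "\<dots> \<le> j * j" by (intro mult_le_mono X Y)
    finally have "real (card ?Q) \<le> real (j * j)" by (rule of_nat_mono)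
    then have Q: "real (card ?Q) \<le> (real j)\<^sup>2" by (simp add: power2_eq_square)
    show ?thesis
    proof (rule card_lists_over[OF _ _ Q])
      show "finite ?Q" using finN[OF simpE'] by simp
      show "{c. \<exists>E\<in>\<Omega>. c \<in> ?C E \<and> switch E c = E'} \<subseteq> {xs. set xs \<subseteq> ?Q \<and> length xs = j}"
      proof
        fix c assume "c \<in> {c. \<exists>E\<in>\<Omega>. c \<in> ?C E \<and> switch E c = E'}"
        then obtain E where E: "E \<in> \<Omega>" and c: "c \<in> ?C E" and sw: "switch E c = E'" by auto
        have qq: "q \<in> gball E w 2" "q' \<in> gball E w' 2" using nbr[OF many(1)[OF E]] nbr[OF many(2)[OF E]] by auto
        have "(x, z, a, b) \<in> ?Q" if p: "(x, z, a, b) \<in> set c" for x z a b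
        proof -
          note e = cross_codes_entry[OF c simp[OF E] apart[OF E] wq qq p]
          have "{w, l} \<notin> set (removed_edges c)" "{w', l} \<notin> set (removed_edges c)" for l
          proof -
            have "{w, l} \<noteq> {x, z} \<and> {w, l} \<noteq> {a, b} \<and> {w', l} \<noteq> {x, z} \<and> {w', l} \<noteq> {a, b}"
              if p: "(x, z, a, b) \<in> set c" for x z a b
            proof -
              note e = cross_codes_entry[OF c simp[OF E] apart[OF E] wq qq p]
              have "w \<noteq> a" "w \<noteq> q'"
                using apart[OF E, of w a] apart[OF E, of w q'] gball_self[of w E 2] qq e(8)
                  gball_monoD[of a E w' 1 2] by auto
              moreover have "w' \<noteq> z" "w' \<noteq> q"
                using apart'[OF E, of w' z] apart'[OF E, of w' q] gball_self[of w' E 2] qq e(7)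
                  gball_monoD[of z E w 1 2] by auto
              ultimately show ?thesis using e wq by (auto simp: doubleton_eq_iff)
            qed
            then show "{w, l} \<notin> set (removed_edges c)" "{w', l} \<notin> set (removed_edges c)"
              unfolding set_removed_edges by blast+
          qed
          then have "{w, z} \<in> E'" "{w', a} \<in> E'" using e(3,5) sw by (auto simp: switch_def)
          moreover have "{q', z} \<in> set (added_edges c)" "{q, a} \<in> set (added_edges c)"
            using p e(1,2) by (force simp: set_added_edges insert_commute)+
          ultimately show ?thesis using e(1,2) sw by (auto simp: common_nbrs_def switch_def)
        qed
        then show "c \<in> {xs. set xs \<subseteq> ?Q \<and> length xs = j}" using c by (auto simp: cross_codes_def)
      qed
    qed
  qed
qed

text \<open>The at most \<open>2 s\<close> ends of a maximal matching of size below \<open>s\<close> cover all edges, so one of them lies on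
the average number of edges.\<close>

lemma matching_or_star:
  fixes s :: real
  assumes fin: "finite F" and F: "F \<subseteq> simple_edges V"
  shows "(\<exists>M\<subseteq>F. pairwise disjnt M \<and> s \<le> real (card M)) \<or>
    (\<exists>v. real (card F) \<le> 2 * s * real (card {e \<in> F. v \<in> e}))"
proof (rule disjCI)
  assume star: "\<not> (\<exists>v. real (card F) \<le> 2 * s * real (card {e \<in> F. v \<in> e}))"
  let ?P = "\<lambda>M. M \<subseteq> F \<and> pairwise disjnt M"
  have "?P {}" "\<forall>M. ?P M \<longrightarrow> card M < Suc (card F)" using fin by (auto simp: less_Suc_eq_le card_mono)
  then obtain M where M: "M \<subseteq> F" "pairwise disjnt M" and max: "\<And>N. ?P N \<Longrightarrow> card N \<le> card M"
    using ex_has_greatest_nat[of ?P "{}" card "Suc (card F)"] by blast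
  have finM: "finite M" using M(1) fin by (rule finite_subset)
  have two: "card e = 2 \<and> finite e" if "e \<in> F" for e
  proof -
    have "card e = 2" using that F by (auto simp: simple_edges_def)
    then show ?thesis using card_ge_0_finite[of e] by simp
  qed
  have "F \<noteq> {}" using star by auto
  have cover: "F \<subseteq> (\<Union>v\<in>\<Union>M. {e \<in> F. v \<in> e})"
  proof
    fix e assume e: "e \<in> F"
    have "\<exists>f\<in>M. e \<inter> f \<noteq> {}"
    proof (rule ccontr)
      assume "\<not> ?thesis"
      then have dis: "\<And>f. f \<in> M \<Longrightarrow> e \<inter> f = {}" by blast
      then have "e \<notin> M" using two[OF e] by fastforce
      moreover have "?P (insert e M)"
        using e M dis by (auto simp: pairwise_insert disjnt_def)
      ultimately show False using max[of "insert e M"] finM by simp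
    qed
    then show "e \<in> (\<Union>v\<in>\<Union>M. {e \<in> F. v \<in> e})" using e by auto
  qed
  have U: "finite (\<Union>M)" "card (\<Union>M) \<le> 2 * card M"
  proof -
    show "finite (\<Union>M)" using finM two M(1) by auto
    have "card (\<Union>M) \<le> sum card M" by (rule card_Union_le_sum_card)
    also have "\<dots> = (\<Sum>e\<in>M. 2)" using two M(1) by (intro sum.cong) auto
    finally show "card (\<Union>M) \<le> 2 * card M" by simp
  qed
  have Une: "\<Union>M \<noteq> {}" using cover \<open>F \<noteq> {}\<close> by auto
  have "s \<le> real (card M)"
  proof (rule ccontr)
    assume "\<not> s \<le> real (card M)"
    then have "real (card (\<Union>M)) \<le> 2 * s" "0 < s" using U(2) of_nat_0_le_iff[of "card M"] by linarith+
    have "card F \<le> card (\<Union>v\<in>\<Union>M. {e \<in> F. v \<in> e})" by (intro card_mono[OF _ cover] finite_subset[OF _ fin]) auto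
    also have "\<dots> \<le> (\<Sum>v\<in>\<Union>M. card {e \<in> F. v \<in> e})" using U(1) by (rule card_UN_le)
    finally have "real (card F) \<le> real (\<Sum>v\<in>\<Union>M. card {e \<in> F. v \<in> e})" by (rule of_nat_mono)
    then have "2 * s * real (card F) \<le> 2 * s * (\<Sum>v\<in>\<Union>M. real (card {e \<in> F. v \<in> e}))"
      using \<open>0 < s\<close> by simp
    also have "\<dots> = (\<Sum>v\<in>\<Union>M. 2 * s * real (card {e \<in> F. v \<in> e}))" by (rule sum_distrib_left)
    also have "\<dots> < (\<Sum>v\<in>\<Union>M. real (card F))" using star Une U(1) by (intro sum_strict_mono) (auto simp: not_le)
    also have "\<dots> = real (card (\<Union>M)) * real (card F)" by simp
    also have "\<dots> \<le> 2 * s * real (card F)" using \<open>real (card (\<Union>M)) \<le> 2 * s\<close> by (intro mult_right_mono) auto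
    finally show False by simp
  qed
  then show "\<exists>M\<subseteq>F. pairwise disjnt M \<and> s \<le> real (card M)" using M by blast
qed

section \<open>Balls are large and large balls meet\<close>

locale min_degree_three =
  fixes V :: "'a set" and d :: "'a \<Rightarrow> nat" and m :: real
  assumes fin: "finite V" and three: "\<And>v. v \<in> V \<Longrightarrow> 3 \<le> d v"
    and volume: "real (sum d V) = 2 * m" and m_pos: "0 < m"
begin

abbreviation "\<G> \<equiv> realizations V d"

definition rare :: "real \<Rightarrow> 'a set set set \<Rightarrow> bool" where
  "rare \<epsilon> \<Omega> \<longleftrightarrow> \<Omega> \<subseteq> \<G> \<and> real (card \<Omega>) \<le> \<epsilon> * real (card \<G>)"

lemma finite_\<G>: "finite \<G>"
  using fin by (rule finite_realizations)

lemma rare_Un: "rare \<epsilon> \<Omega> \<Longrightarrow> rare \<delta> \<Lambda> \<Longrightarrow> rare (\<epsilon> + \<delta>) (\<Omega> \<union> \<Lambda>)"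
  using card_Un_le[of \<Omega> \<Lambda>] unfolding rare_def by (auto simp: distrib_right)

lemma rare_UN:
  assumes "finite I" "\<And>i. i \<in> I \<Longrightarrow> rare \<epsilon> (\<Omega> i)"
  shows "rare (real (card I) * \<epsilon>) (\<Union>i\<in>I. \<Omega> i)"
proof -
  have "real (card (\<Union>i\<in>I. \<Omega> i)) \<le> real (\<Sum>i\<in>I. card (\<Omega> i))"
    using card_UN_le[OF assms(1)] by (rule of_nat_mono)
  also have "\<dots> = (\<Sum>i\<in>I. real (card (\<Omega> i)))" by simp
  also have "\<dots> \<le> (\<Sum>i\<in>I. \<epsilon> * real (card \<G>))"
    using assms(2) by (intro sum_mono) (auto simp: rare_def)
  finally show ?thesis using assms(2) by (auto simp: rare_def)
qed

lemma rare_subset: "rare \<epsilon> \<Omega> \<Longrightarrow> \<Lambda> \<subseteq> \<Omega> \<Longrightarrow> rare \<epsilon> \<Lambda>"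
  using card_mono[of \<Omega> \<Lambda>] finite_subset[OF _ finite_\<G>, of \<Omega>] unfolding rare_def by force

lemma rare_mono: "rare \<epsilon> \<Omega> \<Longrightarrow> \<epsilon> \<le> \<delta> \<Longrightarrow> rare \<delta> \<Omega>"
  using mult_right_mono[of \<epsilon> \<delta> "real (card \<G>)"] unfolding rare_def by force

lemma rare_of_switching:
  fixes a b :: real
  assumes "a ^ j * card \<Omega> \<le> b ^ j * card \<G>" "0 < a" "\<Omega> \<subseteq> \<G>"
  shows "rare ((b / a) ^ j) \<Omega>"
  using assms unfolding rare_def by (simp add: power_divide field_simps)

text \<open>Three excess edges are always present, but possibly not more. This is why the first stage switches exactly
three of them and loses the factor \<open>K\<^sup>6\<close>, so that \<open>K\<close> may be at most \<open>m powr (1/6)\<close> if the probability is to be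
\<open>O(m\<^sup>-\<^sup>2)\<close>.\<close>

lemma small_initial_ball_rare:
  assumes u: "u \<in> V" and l: "real (card V) < (3 / 2) ^ l"
    and K: "0 \<le> K" "K + m / 4 + 24 * sqrt m \<le> m / 2"
  shows "rare ((288 * K\<^sup>2 / m) ^ 3) {E \<in> \<G>. real (sum d (gball E u (l + 1))) \<le> K}"
proof -
  let ?\<Omega> = "{E \<in> \<G>. real (sum d (gball E u (l + 1))) \<le> K}"
  have "(3 / 2 :: real) ^ l \<le> 2 ^ l" by (rule power_mono) auto
  then have "real (card V) < 2 ^ l" using l by linarith
  then have "real (card V) < real (2 ^ l)" by (simp only: of_nat_power of_nat_numeral)
  then have l2: "card V < 2 ^ l" by (simp only: of_nat_less_iff)
  have "1 * (m / 2) ^ 3 * card ?\<Omega> \<le> (16 * (real 3)\<^sup>2 * K\<^sup>2) ^ 3 * card \<G>"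
  proof (rule excess_switching[OF fin u _ volume])
    fix E assume E: "E \<in> ?\<Omega>"
    then have "E \<in> \<G>" by simp
    then have "excess E u l \<subseteq> simple_edges V"
      using realizations_simple[of E V d] by (auto simp: excess_def)
    then show "1 \<le> real (card (head_lists (excess E u l) 3))"
      using head_lists_three[OF fin] excess_ge_three[OF fin \<open>E \<in> \<G>\<close> u three l2] by blast
  qed (use K in auto)
  then have "rare ((16 * (real 3)\<^sup>2 * K\<^sup>2 / (m / 2)) ^ 3) ?\<Omega>"
    using m_pos by (intro rare_of_switching) auto
  then show ?thesis by (simp add: mult.commute mult.left_commute)
qed

text \<open>A ball whose volume passes \<open>K\<close> has \<open>K / 16\<close> excess edges \<open>l + 1\<close> levels later. The last of the \<open>l + 2\<close> levels
makes sure that all neighbours of the ends of these edges lie in the ball whose volume is bounded.\<close>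

lemma stuck_ball_rare:
  assumes u: "u \<in> V" and l: "real (card V) < (3 / 2) ^ l"
    and K: "0 \<le> K'" "K' + m / 4 + 8 * real j * sqrt m \<le> m / 2" "128 * (real j)\<^sup>2 \<le> K" "0 < K"
  shows "rare ((1024 * (real j)\<^sup>2 * K'\<^sup>2 / (m * K)) ^ j)
    {E \<in> \<G>. K < real (sum d (gball E u r)) \<and> real (sum d (gball E u (r + l + 2))) \<le> K'}"
proof -
  let ?\<Omega> = "{E \<in> \<G>. K < real (sum d (gball E u r)) \<and> real (sum d (gball E u (r + l + 2))) \<le> K'}"
  have "(K / 16 / 2) ^ j * (m / 2) ^ j * card ?\<Omega> \<le> (16 * (real j)\<^sup>2 * K'\<^sup>2) ^ j * card \<G>"
  proof (rule excess_switching[OF fin u _ volume])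
    fix E assume E: "E \<in> ?\<Omega>"
    then have EG: "E \<in> \<G>" by simp
    then have sub: "excess E u (r + 1 + l) \<subseteq> simple_edges V"
      using realizations_simple[of E V d] by (auto simp: excess_def)
    have "K / 16 \<le> real (card (excess E u (r + 1 + l)))"
      using excess_ge_of_volume[OF fin EG u three l, of K r] E by simp
    then show "(K / 16 / 2) ^ j \<le> real (card (head_lists (excess E u (r + 1 + l)) j))"
      using K by (intro card_head_lists_ge[OF fin sub]) auto
    have "r + l + 2 = Suc (r + 1 + l)" by simp
    then show "real (sum d (gball E u (Suc (r + 1 + l)))) \<le> K'" using E by (metis (mono_tags, lifting) mem_Collect_eq)
  qed (use K in auto)
  then have "((K / 16 / 2) * (m / 2)) ^ j * card ?\<Omega> \<le> (16 * (real j)\<^sup>2 * K'\<^sup>2) ^ j * card \<G>"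
    by (simp only: power_mult_distrib)
  then have "rare ((16 * (real j)\<^sup>2 * K'\<^sup>2 / ((K / 16 / 2) * (m / 2))) ^ j) ?\<Omega>"
    using m_pos K by (intro rare_of_switching) auto
  moreover have "16 * (real j)\<^sup>2 * K'\<^sup>2 / ((K / 16 / 2) * (m / 2)) = 1024 * (real j)\<^sup>2 * K'\<^sup>2 / (m * K)"
    using m_pos K by (simp add: field_simps)
  ultimately show ?thesis by (simp only:)
qed

definition far_shells :: "real \<Rightarrow> real \<Rightarrow> 'a \<Rightarrow> nat \<Rightarrow> 'a \<Rightarrow> nat \<Rightarrow> 'a set set set" where
  "far_shells A B u r v r' = {E \<in> \<G>. gball E u (r + 2) \<inter> gball E v (r' + 1) = {} \<and>
     (\<exists>M\<subseteq>shell_edges E u r. pairwise disjnt M \<and> A \<le> real (card M)) \<and>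
     B \<le> real (card (shell_edges E v r'))}"

lemma far_shells_rare:
  assumes "2 * real j \<le> A" "2 * real j \<le> B" "0 < A" "0 < B"
  shows "rare ((16 * real j * m / (A * B)) ^ j) (far_shells A B u r v r')"
proof -
  have "((A / 2) * (B / 2)) ^ j * card (far_shells A B u r v r') \<le> (4 * real j * m) ^ j * card \<G>"
    using assms by (intro parallel_switching[OF fin _ volume]) (auto simp: far_shells_def)
  then have "rare ((4 * real j * m / ((A / 2) * (B / 2))) ^ j) (far_shells A B u r v r')"
    using assms by (intro rare_of_switching) (auto simp: far_shells_def)
  then show ?thesis by (simp add: field_simps)
qed

definition far_twins :: "real \<Rightarrow> 'a \<Rightarrow> 'a \<Rightarrow> 'a \<Rightarrow> 'a \<Rightarrow> 'a set set set" where
  "far_twins S w q w' q' = {E \<in> \<G>. w \<noteq> q \<and> w' \<noteq> q' \<and> gball E w 3 \<inter> gball E w' 2 = {} \<and>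
     S \<le> real (card (common_nbrs E w q)) \<and> S \<le> real (card (common_nbrs E w' q'))}"

lemma far_twins_rare:
  assumes "2 * real j \<le> S" "0 < S"
  shows "rare ((4 * (real j)\<^sup>2 / S\<^sup>2) ^ j) (far_twins S w q w' q')"
proof (cases "w \<noteq> q \<and> w' \<noteq> q'")
  case True
  then have "((S / 2) * (S / 2)) ^ j * card (far_twins S w q w' q') \<le> ((real j)\<^sup>2) ^ j * card \<G>"
    using assms by (intro cross_switching[OF fin]) (auto simp: far_twins_def)
  then have "rare (((real j)\<^sup>2 / ((S / 2) * (S / 2))) ^ j) (far_twins S w q w' q')"
    using assms by (intro rare_of_switching) (auto simp: far_twins_def)
  then show ?thesis by (simp add: power2_eq_square mult.commute)
next
  case False
  then have "far_twins S w q w' q' = {}" by (auto simp: far_twins_def)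
  then show ?thesis using assms by (auto simp: rare_def)
qed

text \<open>Each edge that touches the ball belongs to the shell of its end nearest to \<open>u\<close>. The factor two is needed
because edges inside the ball count twice in its volume.\<close>

lemma large_shell:
  assumes E: "E \<in> \<G>" and u: "u \<in> V"
    and K: "K < real (sum d (gball E u R))" "B * (2 * (real R + 1)) \<le> K"
  shows "\<exists>r\<le>R. B \<le> real (card (shell_edges E u r))"
proof (rule ccontr)
  assume "\<not> ?thesis"
  then have less: "real (card (shell_edges E u r)) < B" if "r \<le> R" for r using that by force
  have simp: "E \<subseteq> simple_edges V" using E by (rule realizations_simple)
  have finE: "finite E" using finite_subset[OF simp finite_simple_edges[OF fin]] .
  have sub: "gball E u R \<subseteq> V" using gball_subset[OF simp u] .
  have cover: "{e \<in> E. e \<inter> gball E u R \<noteq> {}} \<subseteq> (\<Union>r\<in>{..R}. shell_edges E u r)"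
  proof
    fix e assume e: "e \<in> {e \<in> E. e \<inter> gball E u R \<noteq> {}}"
    define r where "r = (LEAST r. e \<inter> gball E u r \<noteq> {})"
    have "e \<inter> gball E u R \<noteq> {}" using e by simp
    then have r: "e \<inter> gball E u r \<noteq> {}" "r \<le> R"
      unfolding r_def by (rule LeastI, rule Least_le)
    have "e \<inter> inner_ball E u r = {}"
    proof (cases r)
      case (Suc t)
      then have "\<not> (e \<inter> gball E u t \<noteq> {})" using not_less_Least[of t "\<lambda>r. e \<inter> gball E u r \<noteq> {}"] r_def by auto
      then show ?thesis using Suc by simp
    qed simp
    then show "e \<in> (\<Union>r\<in>{..R}. shell_edges E u r)" using e r by (auto simp: shell_edges_def)
  qed
  have fin': "finite (\<Union>r\<in>{..R}. shell_edges E u r)" using finE by (auto simp: shell_edges_def)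
  have "card {e \<in> E. e \<inter> gball E u R \<noteq> {}} \<le> (\<Sum>r\<le>R. card (shell_edges E u r))"
    using card_mono[OF fin' cover] card_UN_le[of "{..R}" "shell_edges E u"] by simp
  moreover have "card {e \<in> E. e \<subseteq> gball E u R} \<le> card {e \<in> E. e \<inter> gball E u R \<noteq> {}}"
    using finE simp by (intro card_mono) (auto simp: simple_edges_def Int_absorb2)
  ultimately have "sum d (gball E u R) \<le> 2 * (\<Sum>r\<le>R. card (shell_edges E u r))"
    using volume_eq_edge_count[OF fin E sub] by simp
  then have "real (sum d (gball E u R)) \<le> real (2 * (\<Sum>r\<le>R. card (shell_edges E u r)))" by (rule of_nat_mono)
  also have "\<dots> = 2 * (\<Sum>r\<le>R. real (card (shell_edges E u r)))" by simp
  also have "\<dots> \<le> 2 * (\<Sum>r\<le>R. B)" using less by (intro mult_left_mono sum_mono) (auto intro: less_imp_le)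
  also have "\<dots> \<le> K" using K(2) by (simp add: algebra_simps)
  finally show False using K(1) by simp
qed

lemma shell_matching_or_hub:
  assumes E: "E \<in> \<G>" and u: "u \<in> V" and B: "B \<le> real (card (shell_edges E u r))" "0 < B"
    and A: "0 < A" "D * (2 * A) \<le> B"
  shows "(\<exists>M\<subseteq>shell_edges E u r. pairwise disjnt M \<and> A \<le> real (card M)) \<or>
    (\<exists>w\<in>gball E u (r + 1). w \<in> V \<and> D \<le> real (d w))"
proof -
  have simp: "E \<subseteq> simple_edges V" using E by (rule realizations_simple)
  have finE: "finite E" using finite_subset[OF simp finite_simple_edges[OF fin]] .
  let ?F = "shell_edges E u r"
  have F: "finite ?F" "?F \<subseteq> simple_edges V" using finE simp by (auto simp: shell_edges_def)
  have "\<exists>w\<in>gball E u (r + 1). w \<in> V \<and> D \<le> real (d w)"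
    if w: "real (card ?F) \<le> 2 * A * real (card {e \<in> ?F. w \<in> e})" for w
  proof -
    have "{e \<in> ?F. w \<in> e} \<noteq> {}"
    proof
      assume "{e \<in> ?F. w \<in> e} = {}"
      then show False using w B unfolding \<open>{e \<in> ?F. w \<in> e} = {}\<close> by simp
    qed
    then obtain e where e: "e \<in> ?F" "w \<in> e" by auto
    have "e \<in> simple_edges V" using e F by auto
    then obtain z where z: "e = {w, z}" using e(2) by (rule simple_edges_other_end)
    have wV: "w \<in> V" using F(2) e(1) unfolding z by (auto simp: doubleton_simple_iff subset_iff)
    have wB: "w \<in> gball E u (r + 1)" using shell_edge_ball(1)[of w z E u r] e(1) z by simp
    have "card {e \<in> ?F. w \<in> e} \<le> card {e \<in> E. w \<in> e}"
      using finE by (intro card_mono) (auto simp: shell_edges_def)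
    then have "real (card {e \<in> ?F. w \<in> e}) \<le> real (d w)" using realizations_degree[OF E wV] by simp
    then have "2 * A * real (card {e \<in> ?F. w \<in> e}) \<le> 2 * A * real (d w)" using A(1) by (intro mult_left_mono) auto
    then have "2 * A * D \<le> 2 * A * real (d w)" using w B A(2) mult.commute[of D "2 * A"] by linarith
    then have "D \<le> real (d w)" using A(1) by simp
    then show ?thesis using wB wV by blast
  qed
  then show ?thesis using matching_or_star[OF F, of A] by blast
qed

text \<open>Choosing for each neighbour of \<open>w\<close> one edge that does not lead back to \<open>w\<close> prevents a single neighbour of
large degree from dominating: a star among the chosen edges with centre \<open>q\<close> consists, up to the edge
chosen for \<open>q\<close> itself, of edges from common neighbours of \<open>w\<close> and \<open>q\<close>.\<close>

lemma hub_matching_or_twin: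
  assumes E: "E \<in> \<G>" and w: "w \<in> V" and D: "D \<le> real (d w)" "0 < D"
    and A: "0 < A" "(S + 1) * (4 * A) \<le> D"
  shows "D / 2 \<le> real (card (shell_edges E w 1))"
    and "(\<exists>M\<subseteq>shell_edges E w 1. pairwise disjnt M \<and> A \<le> real (card M)) \<or>
      (\<exists>q\<in>V. w \<noteq> q \<and> S \<le> real (card (common_nbrs E w q)))"
proof -
  have simp: "E \<subseteq> simple_edges V" using E by (rule realizations_simple)
  have finE: "finite E" using finite_subset[OF simp finite_simple_edges[OF fin]] .
  let ?N = "{a. {w, a} \<in> E}"
  have finN: "finite ?N"
    by (rule finite_subset[OF _ fin]) (use simp in \<open>auto simp: doubleton_simple_iff subset_iff\<close>)
  have N: "card ?N = d w" using edges_at_eq_neighbours[OF simp] realizations_degree[OF E w] by simp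
  have "\<exists>b. b \<noteq> w \<and> {a, b} \<in> E" if a: "a \<in> ?N" for a
  proof (rule ccontr)
    assume "\<not> ?thesis"
    then have "{b. {a, b} \<in> E} \<subseteq> {w}" by auto
    from card_mono[OF _ this] have "card {b. {a, b} \<in> E} \<le> 1" by simp
    moreover have aV: "a \<in> V" using a simp by (auto simp: doubleton_simple_iff subset_iff)
    ultimately show False
      using edges_at_eq_neighbours[OF simp, of a] realizations_degree[OF E aV] three[OF aV] by simp
  qed
  then obtain b where b: "\<And>a. a \<in> ?N \<Longrightarrow> b a \<noteq> w \<and> {a, b a} \<in> E" by (metis (no_types, lifting))
  let ?F = "(\<lambda>a. {a, b a}) ` ?N"
  have FS: "?F \<subseteq> shell_edges E w 1"
  proof
    fix e assume "e \<in> ?F"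
    then obtain a where a: "a \<in> ?N" "e = {a, b a}" by auto
    have "a \<noteq> w" using a(1) simp doubleton_simple_iff[of w a V] by auto
    moreover have "a \<in> gball E w 1" using a(1) gball_step[of w E w 0 a] by auto
    ultimately show "e \<in> shell_edges E w 1" using a b[OF a(1)] by (auto simp: shell_edges_def)
  qed
  have finF: "finite ?F" using finN by simp
  have Fsimp: "?F \<subseteq> simple_edges V" using FS simp by (auto simp: shell_edges_def)
  have "?N \<subseteq> \<Union>?F" by auto
  moreover have two: "finite e \<and> card e = 2" if "e \<in> ?F" for e
  proof -
    have "card e = 2" using that Fsimp by (auto simp: simple_edges_def)
    then show ?thesis using card_ge_0_finite[of e] by simp
  qed
  ultimately have "card ?N \<le> card (\<Union>?F)" using finF by (intro card_mono) auto
  also have "\<dots> \<le> sum card ?F" by (rule card_Union_le_sum_card)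
  also have "\<dots> = (\<Sum>e\<in>?F. 2)" using two by (intro sum.cong) auto
  finally have "card ?N \<le> 2 * card ?F" by simp
  then have DF: "D / 2 \<le> real (card ?F)" using N D by linarith
  have "card ?F \<le> card (shell_edges E w 1)"
    using finE by (intro card_mono[OF _ FS]) (auto simp: shell_edges_def)
  then show "D / 2 \<le> real (card (shell_edges E w 1))" using DF by linarith
  have twin: "\<exists>q\<in>V. w \<noteq> q \<and> S \<le> real (card (common_nbrs E w q))"
    if q: "real (card ?F) \<le> 2 * A * real (card {e \<in> ?F. q \<in> e})" for q
  proof -
    have "{e \<in> ?F. q \<in> e} \<noteq> {}"
    proof
      assume "{e \<in> ?F. q \<in> e} = {}"
      then have "real (card ?F) \<le> 0" using q by (metis card.empty mult_zero_right of_nat_0)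
      then show False using DF D by simp
    qed
    then obtain e where e: "e \<in> ?F" "q \<in> e" by blast
    then have "e \<in> shell_edges E w 1" using FS by blast
    then have "w \<noteq> q" using e(2) by (auto simp: shell_edges_def)
    moreover have "q \<in> V" using e Fsimp by (auto simp: simple_edges_def)
    moreover have "S \<le> real (card (common_nbrs E w q))"
    proof -
      have finC: "finite (common_nbrs E w q)"
        by (rule finite_subset[OF _ finN]) (auto simp: common_nbrs_def)
      have "{e \<in> ?F. q \<in> e} \<subseteq> insert {q, b q} ((\<lambda>a. {a, q}) ` common_nbrs E w q)"
      proof
        fix e assume "e \<in> {e \<in> ?F. q \<in> e}"
        then obtain a where a: "a \<in> ?N" "e = {a, b a}" "q \<in> e" by auto
        show "e \<in> insert {q, b q} ((\<lambda>a. {a, q}) ` common_nbrs E w q)"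
        proof (cases "a = q")
          case False
          then have "b a = q" using a by auto
          then have "a \<in> common_nbrs E w q" using a b[OF a(1)] by (auto simp: common_nbrs_def insert_commute)
          then show ?thesis using a \<open>b a = q\<close> by auto
        qed (use a in auto)
      qed
      then have "card {e \<in> ?F. q \<in> e} \<le> card (insert {q, b q} ((\<lambda>a. {a, q}) ` common_nbrs E w q))"
        using finC by (intro card_mono) auto
      also have "\<dots> \<le> Suc (card ((\<lambda>a. {a, q}) ` common_nbrs E w q))" using finC by (simp add: card_insert_if)
      also have "\<dots> \<le> Suc (card (common_nbrs E w q))" using card_image_le[OF finC] by simp
      finally have "real (card {e \<in> ?F. q \<in> e}) \<le> real (card (common_nbrs E w q)) + 1" by linarith
      then have "2 * A * real (card {e \<in> ?F. q \<in> e}) \<le> 2 * A * (real (card (common_nbrs E w q)) + 1)"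
        using A(1) by (intro mult_left_mono) auto
      then have "D / 2 \<le> 2 * A * (real (card (common_nbrs E w q)) + 1)" using q DF by linarith
      moreover have "(S + 1) * (2 * A) \<le> D / 2" using A(2) by simp
      ultimately have "(2 * A) * (S + 1) \<le> (2 * A) * (real (card (common_nbrs E w q)) + 1)"
        by (simp only: mult.commute)
      then show ?thesis using A(1) by simp
    qed
    ultimately show ?thesis by blast
  qed
  then show "(\<exists>M\<subseteq>shell_edges E w 1. pairwise disjnt M \<and> A \<le> real (card M)) \<or>
      (\<exists>q\<in>V. w \<noteq> q \<and> S \<le> real (card (common_nbrs E w q)))"
  proof (cases "\<exists>M\<subseteq>?F. pairwise disjnt M \<and> A \<le> real (card M)")
    case True
    then obtain M where M: "M \<subseteq> ?F" "pairwise disjnt M" "A \<le> real (card M)"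
      by (elim exE conjE) (rule that)
    have "M \<subseteq> shell_edges E w 1" using M(1) FS by (rule subset_trans)
    then show ?thesis using M(2,3) by (intro disjI1 exI[of _ M] conjI)
  next
    case False
    then have "\<exists>q. real (card ?F) \<le> 2 * A * real (card {e \<in> ?F. q \<in> e})"
      using matching_or_star[OF finF Fsimp, of A] by argo
    then obtain q where "real (card ?F) \<le> 2 * A * real (card {e \<in> ?F. q \<in> e})" ..
    then show ?thesis by (intro disjI2 twin)
  qed
qed

text \<open>If the ball of radius \<open>R k\<close> is small, then either that of radius \<open>R 0\<close> is small or there is a stage at
which the growth gets stuck.\<close>

lemma all_balls_large:
  fixes K :: "nat \<Rightarrow> real" and R :: "nat \<Rightarrow> nat"
  assumes u: "u \<in> V" and l: "real (card V) < (3 / 2) ^ l"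
    and R0: "R 0 = l + 1" and R: "\<And>i. R (Suc i) = R i + l + 2"
    and K0: "K 0 + m / 4 + 24 * sqrt m \<le> m / 2"
    and K: "\<And>i. 0 < K i" "\<And>i. i \<le> k \<Longrightarrow> K i + m / 4 + 8 * real j * sqrt m \<le> m / 2"
      "\<And>i. 128 * (real j)\<^sup>2 \<le> K i"
    and \<epsilon>: "(288 * (K 0)\<^sup>2 / m) ^ 3 \<le> \<epsilon>"
      "\<And>i. i < k \<Longrightarrow> (1024 * (real j)\<^sup>2 * (K (Suc i))\<^sup>2 / (m * K i)) ^ j \<le> \<epsilon>"
  shows "rare (real (Suc k) * \<epsilon>) {E \<in> \<G>. real (sum d (gball E u (R k))) \<le> K k}"
  using K(2) \<epsilon>(2)
proof (induction k)
  case 0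
  have "0 \<le> K 0" using K(1)[of 0] by (rule less_imp_le)
  have "rare ((288 * (K 0)\<^sup>2 / m) ^ 3) {E \<in> \<G>. real (sum d (gball E u (l + 1))) \<le> K 0}"
    by (rule small_initial_ball_rare[OF u l \<open>0 \<le> K 0\<close> K0])
  from rare_mono[OF this \<epsilon>(1)] show ?case by (simp add: R0)
next
  case (Suc k)
  let ?\<Omega> = "{E \<in> \<G>. K k < real (sum d (gball E u (R k))) \<and> real (sum d (gball E u (R k + l + 2))) \<le> K (Suc k)}"
  have "rare ((1024 * (real j)\<^sup>2 * (K (Suc k))\<^sup>2 / (m * K k)) ^ j) ?\<Omega>"
    using Suc.prems(1)[of "Suc k"] K(1)[of k] K(1)[of "Suc k"] K(3)[of k]
    by (intro stuck_ball_rare[OF u l]) auto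
  then have "rare \<epsilon> ?\<Omega>" by (rule rare_mono) (use Suc.prems(2)[of k] in simp)
  moreover have "rare (real (Suc k) * \<epsilon>) {E \<in> \<G>. real (sum d (gball E u (R k))) \<le> K k}"
    using Suc by auto
  ultimately have "rare (\<epsilon> + real (Suc k) * \<epsilon>) (?\<Omega> \<union> {E \<in> \<G>. real (sum d (gball E u (R k))) \<le> K k})"
    by (rule rare_Un)
  then have "rare (real (Suc (Suc k)) * \<epsilon>) (?\<Omega> \<union> {E \<in> \<G>. real (sum d (gball E u (R k))) \<le> K k})"
    by (simp add: algebra_simps)
  then show ?case by (rule rare_subset) (auto simp: R)
qed

text \<open>The constant \<open>7\<close> is the sum of the radii needed for hubs: a hub lies in the ball of radius \<open>R + 1\<close> of its
vertex, and balls of radii \<open>3\<close> and \<open>2\<close> around the two hubs have to be disjoint.\<close>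

lemma meet_or_rare_configuration:
  fixes K A B D A' S :: real
  assumes E: "E \<in> \<G>" and uv: "u \<in> V" "v \<in> V" and far: "v \<notin> gball E u (2 * R + 7)"
    and large: "\<And>u. u \<in> V \<Longrightarrow> K < real (sum d (gball E u R))"
    and sizes: "B * (2 * (real R + 1)) \<le> K" "D * (2 * A) \<le> B" "(S + 1) * (4 * A') \<le> D"
      "0 < B" "0 < A" "0 < D" "0 < A'"
  shows "E \<in> (\<Union>u\<in>V. \<Union>v\<in>V. \<Union>r\<in>{..R}. \<Union>r'\<in>{..R}. far_shells A B u r v r') \<union>
    (\<Union>w\<in>V. \<Union>w'\<in>V. far_shells A' (D / 2) w 1 w' 1) \<union>
    (\<Union>w\<in>V. \<Union>q\<in>V. \<Union>w'\<in>V. \<Union>q'\<in>V. far_twins S w q w' q')"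
proof -
  \<comment> \<open>balls around points near \<open>u\<close> and \<open>v\<close> that meet would bring \<open>v\<close> close to \<open>u\<close>\<close>
  have disj: "gball E x r \<inter> gball E y s = {}"
    if "x \<in> gball E u a" "y \<in> gball E v b" "a + r + (s + b) \<le> 2 * R + 7" for x y r s a b
  proof (rule ccontr)
    assume "gball E x r \<inter> gball E y s \<noteq> {}"
    then obtain p where p: "p \<in> gball E x r" "p \<in> gball E y s" by auto
    have "p \<in> gball E u (a + r)" using gball_trans[OF that(1) p(1)] .
    moreover have "p \<in> gball E v (b + s)" using gball_trans[OF that(2) p(2)] .
    ultimately have "v \<in> gball E u (a + r + (b + s))" by (rule gball_Int_trans)
    then show False using far gball_monoD[of v E u "a + r + (b + s)" "2 * R + 7"] that(3) by auto
  qed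
  obtain r where r: "r \<le> R" "B \<le> real (card (shell_edges E u r))"
    using large_shell[OF E uv(1) large[OF uv(1)] sizes(1)] by blast
  obtain s where s: "s \<le> R" "B \<le> real (card (shell_edges E v s))"
    using large_shell[OF E uv(2) large[OF uv(2)] sizes(1)] by blast
  have self: "u \<in> gball E u 0" "v \<in> gball E v 0" by (auto intro: gball_self)
  have far_uv: "gball E u (r + 2) \<inter> gball E v (s + 1) = {}" "gball E v (s + 2) \<inter> gball E u (r + 1) = {}"
    using disj[OF self, of "r + 2" "s + 1"] disj[OF self, of "r + 1" "s + 2"] r(1) s(1) by auto
  consider (mu) "\<exists>M\<subseteq>shell_edges E u r. pairwise disjnt M \<and> A \<le> real (card M)"
    | (mv) "\<exists>M\<subseteq>shell_edges E v s. pairwise disjnt M \<and> A \<le> real (card M)"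
    | (hubs) w w' where "w \<in> gball E u (r + 1)" "w \<in> V" "D \<le> real (d w)"
        "w' \<in> gball E v (s + 1)" "w' \<in> V" "D \<le> real (d w')"
    using shell_matching_or_hub[OF E uv(1) r(2) sizes(4,5,2)]
      shell_matching_or_hub[OF E uv(2) s(2) sizes(4,5,2)] by blast
  then show ?thesis
  proof cases
    case mu
    then have "E \<in> far_shells A B u r v s" using E s(2) far_uv by (simp add: far_shells_def)
    then show ?thesis using uv r(1) s(1) by blast
  next
    case mv
    then have "E \<in> far_shells A B v s u r" using E r(2) far_uv by (simp add: far_shells_def)
    then show ?thesis using uv r(1) s(1) by blast
  next
    case hubs
    have far_ww: "gball E w 3 \<inter> gball E w' 2 = {}" "gball E w' 3 \<inter> gball E w 2 = {}"
      using disj[OF hubs(1,4), of 3 2] disj[OF hubs(1,4), of 2 3] r(1) s(1) by auto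
    note hw = hub_matching_or_twin[OF E hubs(2,3) sizes(6,7,3)]
      and hw' = hub_matching_or_twin[OF E hubs(5,6) sizes(6,7,3)]
    consider (mw) "\<exists>M\<subseteq>shell_edges E w 1. pairwise disjnt M \<and> A' \<le> real (card M)"
      | (mw') "\<exists>M\<subseteq>shell_edges E w' 1. pairwise disjnt M \<and> A' \<le> real (card M)"
      | (twins) q q' where "q \<in> V" "w \<noteq> q" "S \<le> real (card (common_nbrs E w q))"
          "q' \<in> V" "w' \<noteq> q'" "S \<le> real (card (common_nbrs E w' q'))"
      using hw(2) hw'(2) by blast
    then show ?thesis
    proof cases
      case mw
      then have "E \<in> far_shells A' (D / 2) w 1 w' 1"
        using E hw'(1) far_ww by (simp add: far_shells_def numeral_3_eq_3 numeral_2_eq_2)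
      then show ?thesis using hubs by blast
    next
      case mw'
      then have "E \<in> far_shells A' (D / 2) w' 1 w 1"
        using E hw(1) far_ww by (simp add: far_shells_def numeral_3_eq_3 numeral_2_eq_2)
      then show ?thesis using hubs by blast
    next
      case twins
      then have "E \<in> far_twins S w q w' q'" using E far_ww by (simp add: far_twins_def)
      then show ?thesis by (intro UnI2 UN_I[OF hubs(2)] UN_I[OF twins(1)] UN_I[OF hubs(5)] UN_I[OF twins(4)])
    qed
  qed
qed

text \<open>Union bound over all vertices, radii, hubs and twins. The centres \<open>q\<close> and \<open>q'\<close> may be summed over all
vertices because \<open>\<gamma>\<close> can be made smaller than any power of \<open>1/m\<close>.\<close>

lemma far_pair_rare:
  fixes K A B D A' S \<epsilon> \<alpha> \<beta> \<gamma> :: real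
  assumes large: "\<And>u. u \<in> V \<Longrightarrow> rare \<epsilon> {E \<in> \<G>. real (sum d (gball E u R)) \<le> K}"
    and sizes: "B * (2 * (real R + 1)) \<le> K" "D * (2 * A) \<le> B" "(S + 1) * (4 * A') \<le> D"
      "0 < B" "0 < A" "0 < D" "0 < A'" "0 < S"
    and j: "2 * real j \<le> A" "2 * real j \<le> B" "2 * real j \<le> A'" "2 * real j \<le> D / 2" "2 * real j \<le> S"
    and \<alpha>: "(16 * real j * m / (A * B)) ^ j \<le> \<alpha>"
    and \<beta>: "(16 * real j * m / (A' * (D / 2))) ^ j \<le> \<beta>"
    and \<gamma>: "(4 * (real j)\<^sup>2 / S\<^sup>2) ^ j \<le> \<gamma>"
  shows "rare (real (card V) * \<epsilon> + real (card V) ^ 2 * (real R + 1) ^ 2 * \<alpha> + real (card V) ^ 2 * \<beta> +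
      real (card V) ^ 4 * \<gamma>) {E \<in> \<G>. \<exists>u\<in>V. \<exists>v\<in>V. v \<notin> gball E u (2 * R + 7)}"
proof -
  let ?n = "real (card V)"
  let ?A = "\<Union>u\<in>V. {E \<in> \<G>. real (sum d (gball E u R)) \<le> K}"
    and ?B = "\<Union>u\<in>V. \<Union>v\<in>V. \<Union>r\<in>{..R}. \<Union>r'\<in>{..R}. far_shells A B u r v r'"
    and ?C = "\<Union>w\<in>V. \<Union>w'\<in>V. far_shells A' (D / 2) w 1 w' 1"
    and ?D = "\<Union>w\<in>V. \<Union>q\<in>V. \<Union>w'\<in>V. \<Union>q'\<in>V. far_twins S w q w' q'"
  have "rare (?n * \<epsilon>) ?A" by (rule rare_UN[OF fin large])
  moreover have "rare (?n * (?n * (real (card {..R}) * (real (card {..R}) * \<alpha>)))) ?B"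
    by (rule rare_UN[OF fin], rule rare_UN[OF fin], rule rare_UN[OF finite_atMost],
        rule rare_UN[OF finite_atMost], rule rare_mono[OF far_shells_rare \<alpha>]) (use sizes j in auto)
  moreover have "rare (?n * (?n * \<beta>)) ?C"
    by (rule rare_UN[OF fin], rule rare_UN[OF fin], rule rare_mono[OF far_shells_rare \<beta>])
      (use sizes j in auto)
  moreover have "rare (?n * (?n * (?n * (?n * \<gamma>)))) ?D"
    by (rule rare_UN[OF fin], rule rare_UN[OF fin], rule rare_UN[OF fin], rule rare_UN[OF fin],
        rule rare_mono[OF far_twins_rare \<gamma>]) (use sizes j in auto)
  ultimately have "rare (?n * \<epsilon> + ?n * (?n * (real (card {..R}) * (real (card {..R}) * \<alpha>))) +
      ?n * (?n * \<beta>) + ?n * (?n * (?n * (?n * \<gamma>)))) (?A \<union> ?B \<union> ?C \<union> ?D)"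
    by (blast intro: rare_Un)
  then have "rare (?n * \<epsilon> + ?n ^ 2 * (real R + 1) ^ 2 * \<alpha> + ?n ^ 2 * \<beta> + ?n ^ 4 * \<gamma>) (?A \<union> ?B \<union> ?C \<union> ?D)"
    by (simp add: power2_eq_square power4_eq_xxxx mult.assoc mult.left_commute add.commute)
  then show ?thesis
  proof (rule rare_subset)
    show "{E \<in> \<G>. \<exists>u\<in>V. \<exists>v\<in>V. v \<notin> gball E u (2 * R + 7)} \<subseteq> ?A \<union> ?B \<union> ?C \<union> ?D"
    proof
      fix E assume "E \<in> {E \<in> \<G>. \<exists>u\<in>V. \<exists>v\<in>V. v \<notin> gball E u (2 * R + 7)}"
      then obtain u v where E: "E \<in> \<G>" and uv: "u \<in> V" "v \<in> V" "v \<notin> gball E u (2 * R + 7)" by auto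
      show "E \<in> ?A \<union> ?B \<union> ?C \<union> ?D"
      proof (cases "E \<in> ?A")
        case False
        then have "K < real (sum d (gball E u R))" if "u \<in> V" for u using that E by force
        from meet_or_rare_configuration[OF E uv this sizes(1-7)] show ?thesis by blast
      qed blast
    qed
  qed
qed

end

section \<open>Choice of the parameters\<close>

text \<open>The volumes of the stages are \<open>m powr (1/6)\<close>, \<open>m powr (1/2)\<close>, \<open>m powr (2/3)\<close> and \<open>m powr (4/5)\<close>, and \<open>j = 200\<close>
edges are switched at a time. A shell then has \<open>B = m powr (79/100)\<close> edges, the number \<open>R + 1 \<le> 20 * ln m + 12\<close>
of radii being absorbed by the exponent. The remaining sizes are \<open>m powr (1/4)\<close> for the matching in a
shell, \<open>m powr (27/50) / 4\<close> for the degree of a hub, \<open>m powr (1/2)\<close> for the matching at a hub and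
\<open>m powr (1/25) / 32\<close> for the number of common neighbours. From the second stage on, the base of each power
that bounds a probability is then at most \<open>m powr (-3/100)\<close>, which gives \<open>m powr (-6)\<close> after raising it to the power
\<open>200\<close>.\<close>

definition large_enough :: "real \<Rightarrow> bool" where
  "large_enough m \<longleftrightarrow> 1 \<le> m \<and> 1280000 * 4 \<le> m powr (1/6) \<and>
     m powr (1/6) + m / 4 + 1600 * sqrt m \<le> m / 2 \<and> m powr (1/2) + m / 4 + 1600 * sqrt m \<le> m / 2 \<and>
     m powr (2/3) + m / 4 + 1600 * sqrt m \<le> m / 2 \<and> m powr (4/5) + m / 4 + 1600 * sqrt m \<le> m / 2 \<and>
     40960000 * (m powr (1/2))\<^sup>2 / (m * m powr (1/6)) \<le> m powr (-3/100) \<and>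
     40960000 * (m powr (2/3))\<^sup>2 / (m * m powr (1/2)) \<le> m powr (-3/100) \<and>
     40960000 * (m powr (4/5))\<^sup>2 / (m * m powr (2/3)) \<le> m powr (-3/100) \<and>
     20 * ln m + 12 \<le> m \<and> m powr (79/100) * (2 * (20 * ln m + 12)) \<le> m powr (4/5) \<and>
     m powr (27/50) / 4 * (2 * m powr (1/4)) \<le> m powr (79/100) \<and>
     (m powr (1/25) / 32 + 1) * (4 * m powr (1/2)) \<le> m powr (27/50) / 4 \<and>
     400 \<le> m powr (1/4) \<and> 400 \<le> m powr (79/100) \<and> 400 \<le> m powr (1/2) \<and>
     400 \<le> m powr (27/50) / 4 / 2 \<and> 400 \<le> m powr (1/25) / 32 \<and>
     3200 * m / (m powr (1/4) * m powr (79/100)) \<le> m powr (-3/100) \<and>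
     3200 * m / (m powr (1/2) * (m powr (27/50) / 4 / 2)) \<le> m powr (-3/100) \<and>
     160000 / (m powr (1/25) / 32)\<^sup>2 \<le> m powr (-3/100)"

lemma eventually_large_enough: "eventually large_enough at_top"
  unfolding large_enough_def by (intro eventually_conj; real_asymp)

lemma power_200_le:
  fixes x m :: real
  assumes "x \<le> m powr (-3/100)" "0 \<le> x" "1 \<le> m"
  shows "x ^ 200 \<le> 1 / m ^ 6"
proof -
  have "x ^ 200 \<le> (m powr (-3/100)) ^ 200" using assms by (intro power_mono)
  also have "\<dots> = m powr (-3/100 * 200)" using assms by (subst powr_power) auto
  also have "\<dots> = 1 / m ^ 6" using assms by (simp add: powr_minus powr_numeral divide_simps)
  finally show ?thesis .
qed

text \<open>The factor \<open>5\<close> suffices as \<open>ln (3/2) \<ge> 1/4\<close>.\<close>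

lemma log_radius:
  assumes n: "2 \<le> n"
  shows "real n < (3 / 2) ^ nat \<lceil>5 * ln (real n)\<rceil>"
proof -
  let ?l = "nat \<lceil>5 * ln (real n)\<rceil>"
  have "(1/2 :: real) - (1/2)\<^sup>2 \<le> ln (1 + 1/2)" by (rule ln_one_plus_pos_lower_bound) auto
  then have log: "1/4 \<le> ln (3/2 :: real)" by (simp add: power2_eq_square)
  have pos: "0 < ln (real n)" using n by simp
  have l: "5 * ln (real n) \<le> real ?l" by linarith
  have "ln (real n) < 5 * ln (real n) * (1/4)" using pos by simp
  also have "\<dots> \<le> real ?l * ln (3/2)" using l log pos by (intro mult_mono) auto
  also have "\<dots> = ln ((3/2) ^ ?l)" by (simp add: ln_realpow)
  finally show ?thesis using n by simp
qed

text \<open>The growth part contributes \<open>n * O(m\<^sup>-\<^sup>2)\<close> and each term of the joining part is at most \<open>m\<^sup>4 * m\<^sup>-\<^sup>6\<close>. Both are \<open>O(1/n)\<close> since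
minimum degree three implies \<open>n \<le> m\<close>. The size condition is on \<open>m\<close> and not on \<open>n\<close>, as \<open>m\<close> may be anything
between the orders \<open>n\<close> and \<open>n\<^sup>2\<close>.\<close>

lemma diameter_rare:
  fixes V :: "'a set" and d :: "'a \<Rightarrow> nat"
  assumes "min_degree_three V d m" and m: "large_enough m" and n: "2 \<le> card V"
  defines "R \<equiv> 4 * nat \<lceil>5 * ln (real (card V))\<rceil> + 7"
  shows "real (card {E \<in> realizations V d. \<exists>u\<in>V. \<exists>v\<in>V. v \<notin> gball E u (2 * R + 7)})
    \<le> (4 * 288 ^ 3 + 3) / real (card V) * real (card (realizations V d))"
proof -
  interpret min_degree_three V d m by fact
  let ?n = "real (card V)"
  define l where "l = nat \<lceil>5 * ln ?n\<rceil>"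
  have m1: "1 \<le> m" using m by (simp add: large_enough_def)
  have nm: "?n \<le> m"
  proof -
    have "real (3 * card V) \<le> real (sum d V)" using sum_degrees_ge[of V d V] three by (intro of_nat_mono) auto
    then show ?thesis using volume by simp
  qed
  have n0: "0 < ?n" using n by simp
  have R: "R = 4 * l + 7" by (simp add: R_def l_def)
  have Rm: "real R + 1 \<le> 20 * ln m + 12"
  proof -
    have "ln ?n \<le> ln m" using nm n0 by simp
    moreover have "0 \<le> ln ?n" using n by simp
    ultimately have "real l \<le> 5 * ln m + 1" unfolding l_def by linarith
    then show ?thesis unfolding R by simp
  qed
  \<comment> \<open>the bound for the first stage, which is weaker than those for the later ones\<close>
  define \<epsilon> where "\<epsilon> = 288 ^ 3 / m ^ 2"
  define K where "K i = m powr (if i = 0 then 1/6 else if i = 1 then 1/2 else if i = 2 then 2/3 else 4/5)" for i :: nat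
  have Kmono: "m powr (1/6) \<le> K i" for i using m1 by (auto simp: K_def intro: powr_mono)
  have small6: "1 / m ^ 6 \<le> \<epsilon>"
  proof -
    have "m ^ 2 \<le> m ^ 6" using m1 by (intro power_increasing) auto
    then have "1 / m ^ 6 \<le> 1 / m ^ 2" using m1 by (intro divide_left_mono) auto
    also have "\<dots> \<le> \<epsilon>" unfolding \<epsilon>_def using m1 by (intro divide_right_mono) auto
    finally show ?thesis .
  qed
  have "rare (real (Suc 3) * \<epsilon>) {E \<in> \<G>. real (sum d (gball E u ((\<lambda>i. l + 1 + i * (l + 2)) 3))) \<le> K 3}"
    if u: "u \<in> V" for u
  proof (rule all_balls_large[OF u, where j = 200])
    show "real (card V) < (3 / 2) ^ l" unfolding l_def using n by (rule log_radius)
    have s: "m powr (1/6) + m / 4 + 1600 * sqrt m \<le> m / 2" "0 \<le> sqrt m"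
      using m m1 by (auto simp: large_enough_def)
    have "K 0 + m / 4 + 24 * sqrt m \<le> m powr (1/6) + m / 4 + 1600 * sqrt m"
      using s(2) by (simp add: K_def)
    then show "K 0 + m / 4 + 24 * sqrt m \<le> m / 2" using s(1) by linarith
    show "0 < K i" for i using m1 by (simp add: K_def)
    show "K i + m / 4 + 8 * real 200 * sqrt m \<le> m / 2" for i
      using m by (simp add: large_enough_def K_def)
    have "128 * (real 200)\<^sup>2 \<le> m powr (1/6)" using m by (simp add: large_enough_def)
    then show "128 * (real 200)\<^sup>2 \<le> K i" for i using Kmono[of i] by linarith
    have "(K 0)\<^sup>2 = m powr (1/3)" using m1 by (simp add: K_def power2_eq_square flip: powr_add)
    moreover have "m powr (1/3) / m = m powr (-2/3)"
      using m1 powr_diff[of m "1/3" 1] by simp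
    ultimately have "(288 * (K 0)\<^sup>2 / m) ^ 3 = 288 ^ 3 * (m powr (-2/3)) ^ 3"
      by (metis power_mult_distrib times_divide_eq_right)
    also have "(m powr (-2/3)) ^ 3 = m powr (-2/3 * 3)" using m1 by (subst powr_power) auto
    also have "\<dots> = 1 / m ^ 2" using m1 by (simp add: powr_minus powr_numeral divide_simps)
    finally show "(288 * (K 0)\<^sup>2 / m) ^ 3 \<le> \<epsilon>" by (simp add: \<epsilon>_def)
    show "(1024 * (real 200)\<^sup>2 * (K (Suc i))\<^sup>2 / (m * K i)) ^ 200 \<le> \<epsilon>" if "i < 3" for i
    proof -
      have "1024 * (real 200)\<^sup>2 * (K (Suc i))\<^sup>2 / (m * K i) \<le> m powr (-3/100)"
      proof -
        have "i = 0 \<or> i = 1 \<or> i = 2" using that by linarith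
        then show ?thesis using m by (auto simp: large_enough_def K_def numeral_2_eq_2)
      qed
      moreover have "0 \<le> 1024 * (real 200)\<^sup>2 * (K (Suc i))\<^sup>2 / (m * K i)" using m1 by (simp add: K_def)
      ultimately have "(1024 * (real 200)\<^sup>2 * (K (Suc i))\<^sup>2 / (m * K i)) ^ 200 \<le> 1 / m ^ 6"
        using m1 by (rule power_200_le)
      then show ?thesis using small6 by linarith
    qed
  qed auto
  moreover have "l + 1 + 3 * (l + 2) = R" by (simp add: R)
  ultimately have large: "rare (4 * \<epsilon>) {E \<in> \<G>. real (sum d (gball E u R)) \<le> m powr (4/5)}" if "u \<in> V" for u
    using that by (simp add: K_def)
  have "rare (?n * (4 * \<epsilon>) + ?n ^ 2 * (real R + 1) ^ 2 * (1 / m ^ 6) + ?n ^ 2 * (1 / m ^ 6) + ?n ^ 4 * (1 / m ^ 6))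
      {E \<in> \<G>. \<exists>u\<in>V. \<exists>v\<in>V. v \<notin> gball E u (2 * R + 7)}"
  proof (rule far_pair_rare[OF large, where j = 200])
    have "m powr (79/100) * (2 * (real R + 1)) \<le> m powr (79/100) * (2 * (20 * ln m + 12))"
      using Rm by (intro mult_left_mono) auto
    then show "m powr (79/100) * (2 * (real R + 1)) \<le> m powr (4/5)"
      using m unfolding large_enough_def by linarith
    show "(16 * real 200 * m / (m powr (1/4) * m powr (79/100))) ^ 200 \<le> 1 / m ^ 6"
      using m m1 by (intro power_200_le) (auto simp: large_enough_def)
    show "(16 * real 200 * m / (m powr (1/2) * (m powr (27/50) / 4 / 2))) ^ 200 \<le> 1 / m ^ 6"
      using m m1 by (intro power_200_le) (auto simp: large_enough_def)
    show "(4 * (real 200)\<^sup>2 / (m powr (1/25) / 32)\<^sup>2) ^ 200 \<le> 1 / m ^ 6"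
      using m m1 by (intro power_200_le) (auto simp: large_enough_def)
  qed (use m m1 in \<open>auto simp: large_enough_def\<close>)
  moreover have "?n * (4 * \<epsilon>) + ?n ^ 2 * (real R + 1) ^ 2 * (1 / m ^ 6) + ?n ^ 2 * (1 / m ^ 6) + ?n ^ 4 * (1 / m ^ 6)
      \<le> (4 * 288 ^ 3 + 3) / ?n"
  proof -
    have Rm': "real R + 1 \<le> m" using Rm m unfolding large_enough_def by linarith
    have inv: "x / m ^ 6 \<le> 1 / ?n" if "x \<le> m ^ 4" for x
    proof -
      have "x / m ^ 6 \<le> m ^ 4 / m ^ 6" using that m1 by (intro divide_right_mono) auto
      also have "\<dots> = 1 / m ^ 2" using m1 by (simp add: divide_simps flip: power_add)
      also have "\<dots> \<le> 1 / m ^ 1" using m1 by (intro divide_left_mono power_increasing) auto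
      also have "\<dots> \<le> 1 / ?n" using nm n0 m1 by (intro divide_left_mono) auto
      finally show ?thesis .
    qed
    have n4: "?n ^ 4 \<le> m ^ 4" using nm n0 by (intro power_mono) auto
    have n2: "?n ^ 2 \<le> m ^ 2" using nm n0 by (intro power_mono) auto
    have R2: "(real R + 1) ^ 2 \<le> m ^ 2" using Rm' by (intro power_mono) auto
    have m24: "m ^ 2 \<le> m ^ 4" using m1 by (intro power_increasing) auto
    have "?n ^ 2 * (real R + 1) ^ 2 \<le> m ^ 2 * m ^ 2" using n2 R2 by (intro mult_mono) auto
    then have 1: "?n ^ 2 * (real R + 1) ^ 2 \<le> m ^ 4" by (simp flip: power_add)
    have 2: "?n ^ 2 \<le> m ^ 4" using n2 m24 by linarith
    have "?n * (4 * \<epsilon>) = 4 * 288 ^ 3 * (?n / m ^ 2)" by (simp add: \<epsilon>_def)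
    also have "?n / m ^ 2 \<le> m / m ^ 2" using nm m1 by (intro divide_right_mono) auto
    also have "m / m ^ 2 = 1 / m" using m1 by (simp add: power2_eq_square)
    also have "1 / m \<le> 1 / ?n" using nm n0 m1 by (intro divide_left_mono) auto
    finally have 0: "?n * (4 * \<epsilon>) \<le> 4 * 288 ^ 3 * (1 / ?n)" by simp
    show ?thesis using 0 inv[OF 1] inv[OF 2] inv[OF n4] by (simp add: add_divide_distrib)
  qed
  ultimately have "rare ((4 * 288 ^ 3 + 3) / ?n) {E \<in> \<G>. \<exists>u\<in>V. \<exists>v\<in>V. v \<notin> gball E u (2 * R + 7)}"
    by (rule rare_mono)
  then show ?thesis by (simp add: rare_def)
qed

section \<open>Edge sets as digraphs\<close>

definition edge_set :: "'a pair_pre_digraph \<Rightarrow> 'a set set" where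
  "edge_set G = {{a, b} | a b. (a, b) \<in> parcs G}"

lemma edge_set_iff:
  assumes "pair_graph G"
  shows "{a, b} \<in> edge_set G \<longleftrightarrow> (a, b) \<in> parcs G"
proof -
  interpret pair_graph G by fact
  have "(b, a) \<in> parcs G" if "(a, b) \<in> parcs G" for a b
    using pair_sym_arcs that by (auto simp: symmetric_def sym_def)
  then show ?thesis by (auto simp: edge_set_def doubleton_eq_iff)
qed

lemma edge_set_realization:
  assumes "G \<in> graphs_with_degrees n d"
  shows "edge_set G \<in> realizations {1..n} d"
proof -
  have G: "pair_graph G" "pverts G = {1..n}" "\<And>v. v \<in> {1..n} \<Longrightarrow> out_degree (with_proj G) v = d v"
    using assms by (auto simp: graphs_with_degrees_def)
  interpret pair_graph G by fact
  have sub: "edge_set G \<subseteq> simple_edges {1..n}"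
    using in_arcsD1 in_arcsD2 pair_no_loops G(2) by (fastforce simp: edge_set_def doubleton_simple_iff)
  have "card {e \<in> edge_set G. v \<in> e} = d v" if v: "v \<in> {1..n}" for v
  proof -
    have "out_arcs (with_proj G) v = Pair v ` {w. (v, w) \<in> parcs G}"
      by (auto simp: out_arcs_def)
    then have "out_degree (with_proj G) v = card {w. (v, w) \<in> parcs G}"
      by (simp add: out_degree_def card_image inj_on_def)
    then show ?thesis
      using edges_at_eq_neighbours[OF sub, of v] G(3)[OF v] by (simp add: edge_set_iff[OF G(1)])
  qed
  then show ?thesis using sub by (auto simp: realizations_def)
qed

lemma bij_edge_set: "bij_betw edge_set (graphs_with_degrees n d) (realizations {1..n} d)"
proof (rule bij_betwI)
  let ?g = "\<lambda>E. \<lparr>pverts = {1..n}, parcs = {(a, b). {a, b} \<in> E}\<rparr>"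
  show "edge_set \<in> graphs_with_degrees n d \<rightarrow> realizations {1..n} d"
    using edge_set_realization by blast
  show "?g \<in> realizations {1..n} d \<rightarrow> graphs_with_degrees n d"
  proof
    fix E assume E: "E \<in> realizations {1..n} d"
    have simp: "E \<subseteq> simple_edges {1..n}" using E by (rule realizations_simple)
    have arcs: "a \<noteq> b \<and> a \<in> {1..n} \<and> b \<in> {1..n}" if "{a, b} \<in> E" for a b
      using subsetD[OF simp that] by (simp add: doubleton_simple_iff)
    have fin: "finite (parcs (?g E))"
      by (rule finite_subset[of _ "{1..n} \<times> {1..n}"]) (use arcs in auto)
    have "pair_graph (?g E)"
      by unfold_locales
        (use fin in \<open>auto dest: arcs simp: symmetric_def sym_def insert_commute\<close>)
    moreover have "out_degree (with_proj (?g E)) v = d v" if v: "v \<in> {1..n}" for v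
    proof -
      have "out_arcs (with_proj (?g E)) v = Pair v ` {w. {v, w} \<in> E}"
        by (auto simp: out_arcs_def)
      then have "out_degree (with_proj (?g E)) v = card {w. {v, w} \<in> E}"
        by (simp add: out_degree_def card_image inj_on_def)
      then show ?thesis
        using edges_at_eq_neighbours[OF simp, of v] realizations_degree[OF E v] by simp
    qed
    ultimately show "?g E \<in> graphs_with_degrees n d" by (simp add: graphs_with_degrees_def)
  qed
  show "?g (edge_set G) = G" if "G \<in> graphs_with_degrees n d" for G
  proof -
    have G: "pair_graph G" "pverts G = {1..n}" using that by (auto simp: graphs_with_degrees_def)
    have "{(a, b). {a, b} \<in> edge_set G} = parcs G" using edge_set_iff[OF G(1)] by auto
    then show ?thesis using G(2) by simp
  qed
  show "edge_set (?g E) = E" if E: "E \<in> realizations {1..n} d" for E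
  proof
    show "edge_set (?g E) \<subseteq> E" by (auto simp: edge_set_def)
    show "E \<subseteq> edge_set (?g E)"
    proof
      fix e assume e: "e \<in> E"
      then have "e \<in> simple_edges {1..n}" using realizations_simple[OF E] by blast
      then obtain x y where "e = {x, y}" by (rule simple_edgesE)
      then show "e \<in> edge_set (?g E)" using e by (auto simp: edge_set_def)
    qed
  qed
qed

lemma graph_dist_le:
  assumes G: "pair_graph G" and u: "u \<in> pverts G" and v: "v \<in> gball (edge_set G) u r"
  shows "graph_dist G u v \<le> ereal (real r)"
proof -
  interpret pair_graph G by fact
  have "\<exists>p. awalk u p v \<and> length p \<le> r" using v
  proof (induction r arbitrary: v)
    case 0
    then show ?case using u by (auto simp: awalk_Nil_iff intro!: exI[of _ "[]"])
  next
    case (Suc r)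
    then consider "v \<in> gball (edge_set G) u r" | x where "x \<in> gball (edge_set G) u r" "{x, v} \<in> edge_set G"
      by (auto simp: gball.simps(2))
    then show ?case
    proof cases
      case 1
      then show ?thesis using Suc.IH le_SucI by blast
    next
      case 2
      obtain p where p: "awalk u p x" "length p \<le> r" using Suc.IH[OF 2(1)] by blast
      have "(x, v) \<in> parcs G" using 2(2) edge_set_iff[OF G] by simp
      then have "awalk x [(x, v)] v" using arc_implies_awalk[of "(x, v)"] by simp
      with p(1) have "awalk u (p @ [(x, v)]) v" by (rule awalk_appendI)
      then show ?thesis using p(2) by (intro exI[of _ "p @ [(x, v)]"]) simp
    qed
  qed
  then obtain p where p: "awalk u p v" "length p \<le> r" by blast
  have "graph_dist G u v \<le> ereal (awalk_cost (\<lambda>_. 1) p)"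
    unfolding graph_dist_def using p(1) by (rule min_cost_le_walk_cost)
  also have "awalk_cost (\<lambda>_. 1) p = real (length p)" by (simp add: awalk_cost_def sum_list_triv)
  also have "ereal (real (length p)) \<le> ereal (real r)" using p(2) by simp
  finally show ?thesis .
qed

lemma far_pair_of_large_diameter:
  assumes G: "G \<in> graphs_with_degrees n d" and n: "1 \<le> n"
    and diam: "diam_plus G \<ge> ereal x" and r: "real r < x"
  shows "\<exists>u\<in>{1..n}. \<exists>v\<in>{1..n}. v \<notin> gball (edge_set G) u r"
proof (rule ccontr)
  assume "\<not> ?thesis"
  then have all: "\<And>u v. u \<in> {1..n} \<Longrightarrow> v \<in> {1..n} \<Longrightarrow> v \<in> gball (edge_set G) u r" by blast
  have pg: "pair_graph G" and V: "pverts G = {1..n}" using G by (auto simp: graphs_with_degrees_def)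
  let ?S = "{graph_dist G u v | u v. u \<in> pverts G \<and> v \<in> pverts G}"
  have S: "?S = (\<lambda>(u, v). graph_dist G u v) ` ({1..n} \<times> {1..n})"
    unfolding V by force
  have "Max ?S \<in> ?S" by (rule Max_in) (use n in \<open>auto simp: S\<close>)
  then obtain u v where uv: "u \<in> pverts G" "v \<in> pverts G" "diam_plus G = graph_dist G u v"
    by (auto simp: diam_plus_def)
  then have "diam_plus G \<le> ereal (real r)" using graph_dist_le[OF pg uv(1)] all V by simp
  then have "ereal x \<le> ereal (real r)" using diam by (rule order_trans[rotated])
  then show False using r by simp
qed

text \<open>For small \<open>n\<close> the constant \<open>C\<close> makes the bound trivial. Otherwise two vertices at distance at least
\<open>62 * ln n\<close> are farther apart than twice the radius \<open>4 * l + 7\<close>, up to a constant, where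
\<open>l = \<lceil>5 * ln n\<rceil>\<close>: this distance is about \<open>40 * ln n\<close>.\<close>

theorem theorem1p5:
  shows "\<exists>C>0::real. \<forall>(n::nat) (d::nat \<Rightarrow> nat).
    degree_sequence n d \<longrightarrow> num_degree n d 1 = 0 \<longrightarrow> num_degree n d 2 = 0 \<longrightarrow>
    graphs_with_degrees n d \<noteq> {} \<longrightarrow>
    measure_pmf.prob (pmf_of_set (graphs_with_degrees n d))
      {G. diam_plus G \<ge> ereal (62 * ln (real n))} \<le> C / real n"
proof -
  obtain m0 where m0: "\<And>m. m0 \<le> m \<Longrightarrow> large_enough m"
    using eventually_large_enough unfolding eventually_at_top_linorder by blast
  define C where "C = 4 * 288 ^ 3 + 3 + \<bar>m0\<bar>"
  have "measure_pmf.prob (pmf_of_set (graphs_with_degrees n d))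
      {G. diam_plus G \<ge> ereal (62 * ln (real n))} \<le> C / real n"
    if d: "degree_sequence n d" and d1: "num_degree n d 1 = 0" and d2: "num_degree n d 2 = 0"
      and ne: "graphs_with_degrees n d \<noteq> {}" for n d
  proof (cases "real n \<le> C")
    case True
    have "n \<ge> 1" using d by (simp add: degree_sequence_def)
    then have "1 \<le> C / real n" using True by simp
    then show ?thesis using measure_pmf.prob_le_1 order_trans by blast
  next
    case False
    then have nC: "4 * 288 ^ 3 + 3 \<le> real n" "m0 \<le> real n"
      using abs_ge_self[of m0] abs_ge_zero[of m0] zero_le_power[of "288 :: real" 3] unfolding C_def
      by linarith+
    let ?V = "{1..n}" and ?S = "graphs_with_degrees n d" and ?m = "real (sum d {1..n}) / 2"
    have three: "3 \<le> d v" if "v \<in> ?V" for v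
    proof -
      have "d v \<noteq> 0" "d v \<noteq> 1" "d v \<noteq> 2"
        using d d1 d2 that by (auto simp: degree_sequence_def num_degree_def)
      then show ?thesis by linarith
    qed
    have "3 * n \<le> sum d ?V" using sum_degrees_ge[of ?V d ?V] three by simp
    then have "3 * real n \<le> real (sum d ?V)" by (metis of_nat_le_iff of_nat_mult of_nat_numeral)
    then have nm: "real n \<le> ?m" by linarith
    have degrees: "min_degree_three ?V d ?m"
      by unfold_locales (use three nm nC in auto)
    let ?l = "nat \<lceil>5 * ln (real n)\<rceil>"
    let ?r = "2 * (4 * ?l + 7) + 7"
    let ?Far = "{E \<in> realizations ?V d. \<exists>u\<in>?V. \<exists>v\<in>?V. v \<notin> gball E u ?r}"
    have rare: "real (card ?Far) \<le> (4 * 288 ^ 3 + 3) / real n * real (card (realizations ?V d))"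
      using diameter_rare[OF degrees m0] nm nC by simp
    have r: "real ?r < 62 * ln (real n)"
    proof -
      have "exp 2 = exp (1::real) ^ 2" using exp_double[of "1::real"] by simp
      also have "\<dots> \<le> 3 ^ 2" using exp_le by (intro power_mono) auto
      finally have "exp 2 \<le> real n" using nC by simp
      then have ln2: "2 \<le> ln (real n)" using nC by (simp add: ln_ge_iff)
      then have "real ?l \<le> 5 * ln (real n) + 1" by linarith
      moreover have "real (2 * (4 * k + 7) + 7) = 8 * real k + 21" for k by simp
      ultimately show ?thesis using ln2 by (simp only:)
    qed
    let ?Bad = "{G. diam_plus G \<ge> ereal (62 * ln (real n))}"
    have inj: "inj_on edge_set ?S" and img: "edge_set ` ?S = realizations ?V d"
      using bij_edge_set[of n d] by (auto simp: bij_betw_def)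
    have "edge_set ` (?S \<inter> ?Bad) \<subseteq> ?Far"
      using far_pair_of_large_diameter[OF _ _ _ r] edge_set_realization d
      by (auto simp: degree_sequence_def)
    moreover have "finite ?Far" using finite_realizations[of ?V d] by simp
    ultimately have "card (?S \<inter> ?Bad) \<le> card ?Far"
      using inj by (intro card_inj_on_le[of edge_set]) (auto intro: inj_on_subset)
    moreover have "card ?S = card (realizations ?V d)"
      using card_image[OF inj] img by simp
    ultimately have "real (card (?S \<inter> ?Bad)) \<le> (4 * 288 ^ 3 + 3) / real n * real (card ?S)"
      using rare by simp
    moreover have "0 < card ?S" using ne finite_graphs_with_degrees by (simp add: card_gt_0_iff)
    ultimately have "real (card (?S \<inter> ?Bad)) / real (card ?S) \<le> (4 * 288 ^ 3 + 3) / real n"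
      by (simp add: divide_le_eq)
    also have "\<dots> \<le> C / real n" unfolding C_def by (intro divide_right_mono) auto
    finally show ?thesis
      using measure_pmf_of_set[OF ne finite_graphs_with_degrees] by simp
  qed
  moreover have "0 < C" using zero_le_power[of "288 :: real" 3] unfolding C_def by linarith
  ultimately show ?thesis by blast
qed

end
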